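(* Let $\Omega\subset\mathbb{C}^n$ be a bounded $L^{\infty}$-pseudoconvex domain. Then $\Omega$ is Gleason solvable; that is, for every $\alpha=(\alpha_1,\dots,\alpha_n)\in\Omega$ and every $g\in H^{\infty}(\Omega)$ with $g(\alpha)=0$, there exist $g_1,\dots,g_n\in H^{\infty}(\Omega)$ such that \[ g(z)=\sum_{j=1}^n (z_j-\alpha_j)\,g_j(z)\quad\text{for all } z\in\Omega. \]
   Context: $H^{\infty}(\Omega)$ denotes the space of bounded holomorphic functions on $\Omega$. $L^{\infty}_{(0,s)}(\Omega)$ denotes the $(0,s)$-forms on $\Omega$ with coefficients in $L^{\infty}(\Omega)$; $\overline{\partial}$ is taken in the sense of distributions, and a bounded form is in $\mathrm{dom}(\overline{\partial})$ if its $\overline{\partial}$ is also a bounded form. A bounded pseudoconvex domain $\Omega\subset\mathbb{C}^n$ is called $L^{\infty}$-pseudoconvex if for any $s\ge 1$ and any $\overline{\partial}$-closed bounded form $\beta\in L^{\infty}_{(0,s)}(\Omega)$ there exists $\gamma\in L^{\infty}_{(0,s-1)}(\Omega)\cap\mathrm{dom}(\overline{\partial})$ such that $\overline{\partial}\gamma=\beta$. *)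

theory Defs
  imports "HOL-Analysis.Analysis"
begin

section \<open>Bounded holomorphic functions of several variables\<close>

definition holomorphic_several_on ::
  "(complex ^ 'n \<Rightarrow> complex) \<Rightarrow> (complex ^ 'n) set \<Rightarrow> bool" where
  "holomorphic_several_on f \<Omega> \<longleftrightarrow>
     (\<forall>z\<in>\<Omega>. \<exists>L. (f has_derivative L) (at z) \<and> (\<forall>c v. L (c *s v) = c * L v))"

definition H_infty :: "(complex ^ 'n) set \<Rightarrow> (complex ^ 'n \<Rightarrow> complex) set" where
  "H_infty \<Omega> = {f. holomorphic_several_on f \<Omega> \<and> bounded (f ` \<Omega>)}"


section \<open>Pseudoconvex domains\<close>

definition continuous_psh_on ::
  "(complex ^ 'n \<Rightarrow> real) \<Rightarrow> (complex ^ 'n) set \<Rightarrow> bool" where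
  "continuous_psh_on u \<Omega> \<longleftrightarrow>
     continuous_on \<Omega> u \<and>
     (\<forall>z w. (\<forall>\<tau>\<in>cball 0 1. z + \<tau> *s w \<in> \<Omega>) \<longrightarrow>
        u z \<le> (1 / (2 * pi)) * integral {0..2 * pi} (\<lambda>t. u (z + cis t *s w)))"

definition pseudoconvex_domain :: "(complex ^ 'n) set \<Rightarrow> bool" where
  "pseudoconvex_domain \<Omega> \<longleftrightarrow>
     open \<Omega> \<and> connected \<Omega> \<and> \<Omega> \<noteq> {} \<and>
     (\<exists>u. continuous_psh_on u \<Omega> \<and> (\<forall>c. compact {z \<in> \<Omega>. u z \<le> c}))"


section \<open>Test functions and Wirtinger derivatives\<close>

primrec C_k :: "nat \<Rightarrow> ('a::euclidean_space \<Rightarrow> 'b::real_normed_vector) \<Rightarrow> bool" where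
  "C_k 0 f \<longleftrightarrow> continuous_on UNIV f"
| "C_k (Suc k) f \<longleftrightarrow>
     (\<forall>x. f differentiable (at x)) \<and> (\<forall>v. C_k k (\<lambda>x. frechet_derivative f (at x) v))"

definition test_functions :: "(complex ^ 'n) set \<Rightarrow> (complex ^ 'n \<Rightarrow> complex) set" where
  "test_functions \<Omega> =
     {\<phi>. (\<forall>k. C_k k \<phi>) \<and> compact (closure {z. \<phi> z \<noteq> 0}) \<and> closure {z. \<phi> z \<noteq> 0} \<subseteq> \<Omega>}"

definition wirtinger_bar ::
  "'n \<Rightarrow> (complex ^ 'n \<Rightarrow> complex) \<Rightarrow> complex ^ 'n \<Rightarrow> complex" where
  "wirtinger_bar k \<phi> z =
     (frechet_derivative \<phi> (at z) (axis k 1) + \<i> * frechet_derivative \<phi> (at z) (axis k \<i>)) / 2"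


section \<open>Bounded forms of type (0,s) and the distributional d-bar operator\<close>

text \<open>
  A form of type (0,s) is the family of its coefficients with respect to the forms
  \<open>d\<zeta>_J = d\<zeta>_j1 \<and> \<dots> \<and> d\<zeta>_js\<close>, where \<open>\<zeta>_j\<close> is the complex conjugate of the coordinate
  \<open>z_j\<close> and \<open>J = {j1 < \<dots> < js}\<close>.  Increasing multi-indices are encoded as index sets, and only the
  values at sets of cardinality \<open>s\<close> are meaningful for a form of type (0,s).  In particular every
  form of type (0,s) with \<open>s > CARD('n)\<close> is zero.
\<close>

type_synonym 'n form = "'n set \<Rightarrow> complex ^ 'n \<Rightarrow> complex"

definition L_infty :: "(complex ^ 'n) set \<Rightarrow> (complex ^ 'n \<Rightarrow> complex) set" where
  "L_infty \<Omega> =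
     {f. f \<in> borel_measurable (lebesgue_on \<Omega>) \<and> (\<exists>C. AE z in lebesgue_on \<Omega>. norm (f z) \<le> C)}"

definition L_infty_forms :: "nat \<Rightarrow> (complex ^ 'n) set \<Rightarrow> 'n form set" where
  "L_infty_forms s \<Omega> = {\<beta>. \<forall>J. card J = s \<longrightarrow> \<beta> J \<in> L_infty \<Omega>}"

text \<open>The sign with \<open>d\<zeta>_k \<and> d\<zeta>_(K - {k}) = wedge_sign k K d\<zeta>_K\<close> for \<open>k \<in> K\<close>.\<close>

definition wedge_sign :: "'n::linorder \<Rightarrow> 'n set \<Rightarrow> complex" where
  "wedge_sign k K = (- 1) ^ card {j \<in> K. j < k}"

text \<open>
  The coefficient at \<open>K\<close> of the d-bar derivative of \<open>\<gamma>\<close> is the distribution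
  \<open>\<Sum>k\<in>K. wedge_sign k K * \<partial>\<gamma>_(K - {k})/\<partial>\<zeta>_k\<close>.  The equality is tested on the whole sum:
  the individual derivatives need not be functions.
\<close>

definition has_dbar ::
  "nat \<Rightarrow> (complex ^ 'n::{finite,linorder}) set \<Rightarrow> 'n form \<Rightarrow> 'n form \<Rightarrow> bool" where
  "has_dbar s \<Omega> \<gamma> \<beta> \<longleftrightarrow>
     (\<forall>K. card K = Suc s \<longrightarrow> (\<forall>\<phi>\<in>test_functions \<Omega>.
        (LINT z|lebesgue_on \<Omega>. \<beta> K z * \<phi> z) =
        - (\<Sum>k\<in>K. wedge_sign k K *
             (LINT z|lebesgue_on \<Omega>. \<gamma> (K - {k}) z * wirtinger_bar k \<phi> z))))"

definition dbar_closed ::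
  "nat \<Rightarrow> (complex ^ 'n::{finite,linorder}) set \<Rightarrow> 'n form \<Rightarrow> bool" where
  "dbar_closed s \<Omega> \<beta> \<longleftrightarrow> has_dbar s \<Omega> \<beta> (\<lambda>K z. 0)"

definition dom_dbar :: "nat \<Rightarrow> (complex ^ 'n::{finite,linorder}) set \<Rightarrow> 'n form set" where
  "dom_dbar s \<Omega> =
     {\<gamma> \<in> L_infty_forms s \<Omega>. \<exists>\<beta> \<in> L_infty_forms (Suc s) \<Omega>. has_dbar s \<Omega> \<gamma> \<beta>}"


section \<open>L-infinity pseudoconvexity and Gleason solvability\<close>

definition L_infty_pseudoconvex :: "(complex ^ 'n::{finite,linorder}) set \<Rightarrow> bool" where
  "L_infty_pseudoconvex \<Omega> \<longleftrightarrow>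
     bounded \<Omega> \<and> pseudoconvex_domain \<Omega> \<and>
     (\<forall>s\<ge>1. \<forall>\<beta>\<in>L_infty_forms s \<Omega>. dbar_closed s \<Omega> \<beta> \<longrightarrow>
        (\<exists>\<gamma>\<in>L_infty_forms (s - 1) \<Omega> \<inter> dom_dbar (s - 1) \<Omega>. has_dbar (s - 1) \<Omega> \<gamma> \<beta>))"

definition gleason_solvable :: "(complex ^ 'n) set \<Rightarrow> bool" where
  "gleason_solvable \<Omega> \<longleftrightarrow>
     (\<forall>\<alpha>\<in>\<Omega>. \<forall>g\<in>H_infty \<Omega>. g \<alpha> = 0 \<longrightarrow>
        (\<exists>G :: 'n \<Rightarrow> complex ^ 'n \<Rightarrow> complex.
           (\<forall>j. G j \<in> H_infty \<Omega>) \<and> (\<forall>z\<in>\<Omega>. g z = (\<Sum>j\<in>UNIV. (z $ j - \<alpha> $ j) * G j z))))"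

end

theory Submission
  imports Defs "HOL-Complex_Analysis.Cauchy_Integral_Formula"
begin

text \<open>
  The Koszul complex of \<open>z - \<alpha>\<close> with smooth coefficients is exact away from \<open>\<alpha>\<close>, and near \<open>\<alpha>\<close> the
  function \<open>g\<close> is divisible with holomorphic quotients.  Patching both with a cutoff gives bounded
  smooth \<open>u_j\<close> with \<open>g = \<Sum>j. (z_j - \<alpha>_j) u_j\<close> that are holomorphic near \<open>\<alpha>\<close>.  Lifting d-bar of \<open>u\<close>
  repeatedly through the Koszul differential raises the form degree, hence ends after \<open>n\<close> steps;
  going back down, each lifting is corrected by a bounded solution of a d-bar equation.  The result is
  a family of bounded functions with \<open>\<Sum>j. (z_j - \<alpha>_j) f_j = g\<close> and d-bar \<open>f_j = 0\<close> in the sense of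
  distributions.  Averaging against radial kernels of Bochner-Martinelli type replaces the \<open>f_j\<close> by
  holomorphic functions: the average does not depend on the radius, and letting the radius tend to
  zero preserves the identity for \<open>g\<close> everywhere, without an almost-everywhere argument.
\<close>

section \<open>Smooth functions and a smooth step\<close>

text \<open>Two difficulties shape the proof. The homotopy for the Koszul complex divides by |z -
  \<alpha>|^2, so it is singular at \<alpha>; and every lift takes another d-bar derivative, while
  the derivatives of the bounded function g need not be bounded near the boundary. The first is met
  by starting from a u that is holomorphic on a neighbourhood V of \<alpha>: d-bar of every lift
  then vanishes on V, and a second family of multipliers, whose pairing with z - \<alpha> differs
  from 1 only inside V, lifts without error. The second is met because d-bar annihilates g and the
  local quotients, so only fixed smooth factors are ever differentiated and all coefficients stay
  bounded. The solutions of the d-bar equations are merely bounded measurable functions, but they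
  enter through the Koszul differential alone: applying the differential once more removes them at
  every point. This is why the identity for g survives exactly, although d-bar of the corrected
  functions is known only in the sense of distributions.\<close>

lemma C_k_SucI:
  assumes "\<And>x. (f has_derivative f' x) (at x)" and "\<And>v. C_k k (\<lambda>x. f' x v)"
  shows "C_k (Suc k) f"
proof -
  have "frechet_derivative f (at x) = f' x" for x
    using assms(1)[of x] by (metis frechet_derivative_at)
  with assms show ?thesis
    by (auto simp: differentiable_def)
qed

lemma C_k_Suc_has_derivative:
  assumes "C_k (Suc k) f"
  shows "(f has_derivative frechet_derivative f (at x)) (at x)"
  using assms by (simp add: frechet_derivative_works)

lemma C_k_continuous: "C_k k f \<Longrightarrow> continuous_on UNIV f"
proof (cases k)
  case (Suc m)
  then show "C_k k f \<Longrightarrow> continuous_on UNIV f"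
    by (auto simp: continuous_on_eq_continuous_at intro: differentiable_imp_continuous_within)
qed simp

lemma C_k_pred: "C_k (Suc k) f \<Longrightarrow> C_k k f"
proof (induction k arbitrary: f)
  case 0
  then show ?case using C_k_continuous[of "Suc 0" f] by simp
next
  case (Suc k)
  then show ?case by (meson C_k.simps(2))
qed

lemma C_k_const: "C_k k (\<lambda>x. c)"
proof (induction k arbitrary: c)
  case (Suc k)
  show ?case by (rule C_k_SucI[where f' = "\<lambda>x v. 0"]) (auto simp: Suc)
qed simp

lemma C_k_bounded_linear:
  assumes "bounded_linear B"
  shows "C_k k f \<Longrightarrow> C_k k (\<lambda>x. B (f x))"
proof (induction k arbitrary: f)
  case 0
  then show ?case
    using bounded_linear.continuous_on[OF assms] by auto
next
  case (Suc k)
  show ?case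
    by (rule C_k_SucI[where f' = "\<lambda>x v. B (frechet_derivative f (at x) v)"])
      (use Suc in \<open>auto intro!: bounded_linear.has_derivative[OF assms] simp: frechet_derivative_works\<close>)
qed

lemma C_k_id: "C_k k (\<lambda>x. x)"
  by (cases k) (auto intro!: C_k_SucI[where f' = "\<lambda>x v. v"] C_k_const)

lemma C_k_linear: "bounded_linear B \<Longrightarrow> C_k k B"
  using C_k_bounded_linear[OF _ C_k_id] .

lemma C_k_add: "C_k k f \<Longrightarrow> C_k k g \<Longrightarrow> C_k k (\<lambda>x. f x + g x)"
proof (induction k arbitrary: f g)
  case 0
  then show ?case by (auto intro: continuous_intros)
next
  case (Suc k)
  show ?case
    by (rule C_k_SucI[where f' = "\<lambda>x v. frechet_derivative f (at x) v + frechet_derivative g (at x) v"])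
      (use Suc in \<open>auto intro!: has_derivative_add simp: frechet_derivative_works\<close>)
qed

lemma C_k_mult:
  fixes f g :: "'a::euclidean_space \<Rightarrow> 'b::real_normed_algebra"
  shows "C_k k f \<Longrightarrow> C_k k g \<Longrightarrow> C_k k (\<lambda>x. f x * g x)"
proof (induction k arbitrary: f g)
  case 0
  then show ?case by (auto intro: continuous_intros)
next
  case (Suc k)
  have "C_k k f" "C_k k g"
    using Suc.prems C_k_pred by blast+
  then show ?case
    by (intro C_k_SucI[where f' = "\<lambda>x v. f x * frechet_derivative g (at x) v + frechet_derivative f (at x) v * g x"]
          C_k_add Suc.IH)
      (use Suc.prems in \<open>auto intro!: has_derivative_mult simp: frechet_derivative_works\<close>)
qed

lemma C_k_real_SucI:
  fixes f :: "real \<Rightarrow> real"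
  assumes "\<And>x. (f has_real_derivative f' x) (at x)" and "C_k k f'"
  shows "C_k (Suc k) f"
  by (rule C_k_SucI[where f' = "\<lambda>x v. f' x * v"])
    (use assms in \<open>auto simp: has_field_derivative_def intro: C_k_mult C_k_const\<close>)

lemma C_k_real_SucD:
  fixes f :: "real \<Rightarrow> real"
  assumes "C_k (Suc k) f"
  shows "(f has_real_derivative deriv f x) (at x)" and "C_k k (deriv f)"
proof -
  have d: "(f has_real_derivative deriv f x) (at x)" for x
    using assms
    by (meson C_k.simps(2) DERIV_deriv_iff_real_differentiable)
  then show "(f has_real_derivative deriv f x) (at x)" .
  have "deriv f x = frechet_derivative f (at x) 1" for x
    using frechet_derivative_at[OF d[of x, unfolded has_field_derivative_def]]
    by (metis mult.right_neutral)
  then have "deriv f = (\<lambda>x. frechet_derivative f (at x) 1)"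
    by auto
  then show "C_k k (deriv f)"
    using assms by simp
qed

lemma C_k_compose_real:
  fixes K :: "real \<Rightarrow> real" and q :: "'a::euclidean_space \<Rightarrow> real"
  shows "C_k k K \<Longrightarrow> C_k k q \<Longrightarrow> C_k k (\<lambda>x. K (q x))"
proof (induction k arbitrary: K)
  case 0
  then show ?case by (auto intro: continuous_on_compose2)
next
  case (Suc k)
  have "C_k k (\<lambda>x. deriv K (q x))"
    by (rule Suc.IH[OF C_k_real_SucD(2)[OF Suc.prems(1)] C_k_pred[OF Suc.prems(2)]])
  then have "C_k k (\<lambda>x. deriv K (q x) * frechet_derivative q (at x) v)" for v
    using Suc.prems(2) by (intro C_k_mult) auto
  moreover have "((\<lambda>x. K (q x)) has_derivative (\<lambda>v. deriv K (q x) * frechet_derivative q (at x) v)) (at x)" for x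
    using has_derivative_compose[OF C_k_Suc_has_derivative[OF Suc.prems(2)]
        C_k_real_SucD(1)[OF Suc.prems(1), unfolded has_field_derivative_def]] .
  ultimately show ?case
    by (rule C_k_SucI[rotated])
qed

definition smooth :: "('a::euclidean_space \<Rightarrow> 'b::real_normed_vector) \<Rightarrow> bool" where
  "smooth f \<longleftrightarrow> (\<forall>k. C_k k f)"

lemma smooth_const: "smooth (\<lambda>x. c)"
  and smooth_linear: "bounded_linear f \<Longrightarrow> smooth f"
  and smooth_bounded_linear: "bounded_linear B \<Longrightarrow> smooth v \<Longrightarrow> smooth (\<lambda>x. B (v x))"
  and smooth_add: "smooth g \<Longrightarrow> smooth h \<Longrightarrow> smooth (\<lambda>x. g x + h x)"
  by (auto simp: smooth_def intro: C_k_const C_k_linear C_k_bounded_linear C_k_add)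

lemma smooth_mult:
  fixes f g :: "'a::euclidean_space \<Rightarrow> 'b::real_normed_algebra"
  shows "smooth f \<Longrightarrow> smooth g \<Longrightarrow> smooth (\<lambda>x. f x * g x)"
  by (auto simp: smooth_def intro: C_k_mult)

lemma smooth_compose_real:
  fixes K :: "real \<Rightarrow> real"
  shows "smooth K \<Longrightarrow> smooth q \<Longrightarrow> smooth (\<lambda>x. K (q x))"
  by (auto simp: smooth_def intro: C_k_compose_real)

lemma smooth_minus: "smooth (f :: 'a::euclidean_space \<Rightarrow> 'b::real_normed_vector) \<Longrightarrow> smooth (\<lambda>x. - f x)"
  by (rule smooth_bounded_linear[OF bounded_linear_minus[OF bounded_linear_ident]])

lemma smooth_diff: "smooth f \<Longrightarrow> smooth g \<Longrightarrow> smooth (\<lambda>x. f x - g x)"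
  using smooth_add[OF _ smooth_minus, of f g] by simp

lemma smooth_has_derivative: "smooth f \<Longrightarrow> (f has_derivative frechet_derivative f (at x)) (at x)"
  unfolding smooth_def using C_k_Suc_has_derivative by blast

lemma smooth_continuous: "smooth f \<Longrightarrow> continuous_on S f"
  unfolding smooth_def using C_k_continuous[of 0 f] continuous_on_subset by blast

lemma smooth_frechet: "smooth f \<Longrightarrow> smooth (\<lambda>x. frechet_derivative f (at x) v)"
  unfolding smooth_def using C_k.simps(2) by blast

lemma smooth_deriv: "smooth (f :: real \<Rightarrow> real) \<Longrightarrow> smooth (deriv f)"
  unfolding smooth_def using C_k_real_SucD(2) by blast

lemma smooth_has_real_derivative:
  "smooth (f :: real \<Rightarrow> real) \<Longrightarrow> (f has_real_derivative deriv f x) (at x)"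
  unfolding smooth_def using C_k_real_SucD(1) by blast

lemma smooth_antiderivative:
  fixes f :: "real \<Rightarrow> real"
  assumes "\<And>x. (f has_real_derivative f' x) (at x)" and "smooth f'"
  shows "smooth f"
  unfolding smooth_def
proof
  fix k
  show "C_k k f"
    using C_k_pred[OF C_k_real_SucI[OF assms(1)]] assms(2) by (auto simp: smooth_def)
qed

text \<open>Since \<open>K\<close> vanishes near 0, so does the quotient, the convention x / 0 = 0
  supplying its value at 0. Its derivative is a combination of quotients of the same kind, with
  numerators \<open>deriv K\<close> and \<open>K s / s\<close>; this is why the induction runs over
  all \<open>K\<close> at once.\<close>

lemma smooth_divide_ident:
  fixes K :: "real \<Rightarrow> real"
  assumes K: "smooth K" and "a > 0" and z: "\<And>s. \<bar>s\<bar> < a \<Longrightarrow> K s = 0"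
  shows "smooth (\<lambda>s. K s / s)"
proof -
  have "C_k k (\<lambda>s. K s / s)" if "C_k k K" "\<And>s. \<bar>s\<bar> < a \<Longrightarrow> K s = 0" for k and K :: "real \<Rightarrow> real"
    using that
  proof (induction k arbitrary: K)
    case 0
    have op: "open (- {0::real})" "open {- a <..< a}" by auto
    have "continuous_on (- {0}) (\<lambda>s. K s / s)"
      using 0 by (auto intro!: continuous_intros elim: continuous_on_subset)
    moreover have "continuous_on {- a <..< a} (\<lambda>s. K s / s)"
      using 0 by (subst continuous_on_cong[OF refl, where g = "\<lambda>_. 0"]) auto
    ultimately have "continuous_on (- {0} \<union> {- a <..< a}) (\<lambda>s. K s / s)"
      by (intro continuous_on_open_Un op)
    moreover have "- {0} \<union> {- a <..< a} = UNIV" using \<open>a > 0\<close> by auto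
    ultimately show ?case by simp
  next
    case (Suc k)
    have d0: "deriv K s = 0" if "\<bar>s\<bar> < a" for s
    proof -
      have "(K has_field_derivative 0) (at s)"
        by (rule has_field_derivative_transform_within_open[where f = "\<lambda>_. 0" and S = "{- a <..< a}"])
          (use that Suc.prems in auto)
      then show ?thesis by (rule DERIV_imp_deriv)
    qed
    let ?D = "\<lambda>s. deriv K s / s + - 1 * (K s / s / s)"
    have "C_k k (\<lambda>s. K s / s)"
      using Suc C_k_pred by blast
    then have 1: "C_k k (\<lambda>s. K s / s / s)"
      by (rule Suc.IH) (simp add: Suc.prems(2))
    have 2: "C_k k (\<lambda>s. deriv K s / s)"
      by (rule Suc.IH[OF C_k_real_SucD(2)[OF Suc.prems(1)] d0])
    have "((\<lambda>s. K s / s) has_real_derivative ?D s) (at s)" for s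
    proof (cases "s = 0")
      case True
      have "((\<lambda>s. K s / s) has_real_derivative 0) (at s)"
        by (rule has_field_derivative_transform_within_open[where f = "\<lambda>_. 0" and S = "{- a <..< a}"])
          (use True Suc.prems \<open>a > 0\<close> in auto)
      then show ?thesis using True by simp
    next
      case False
      then show ?thesis
        using C_k_real_SucD(1)[OF Suc.prems(1), of s]
        by (auto intro!: derivative_eq_intros simp: field_simps)
    qed
    then show ?case
      using 1 2 by (intro C_k_real_SucI[where f' = ?D] C_k_add C_k_mult C_k_const)
  qed
  then show ?thesis
    using K z by (auto simp: smooth_def)
qed

lemma deriv_eq_0_beyond:
  fixes K :: "real \<Rightarrow> real"
  assumes "\<And>s. s > a \<Longrightarrow> K s = 0" "s > a"
  shows "deriv K s = 0"
proof (rule DERIV_imp_deriv)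
  show "(K has_real_derivative 0) (at s)"
    by (rule has_field_derivative_transform_within_open[where f = "\<lambda>_. 0" and S = "{a<..}"])
      (use assms in auto)
qed

section \<open>Flat exponentials and a smooth step\<close>

definition flat_exp :: "nat \<Rightarrow> real \<Rightarrow> real" where
  "flat_exp m x = (if x > 0 then exp (- 1 / x) / x ^ m else 0)"

text \<open>The exponential of 1 / x dominates its Taylor term of order \<open>m + 2\<close>. The
  two spare powers of x make the difference quotient at 0 tend to 0.\<close>

lemma flat_exp_bound:
  assumes "x > 0"
  shows "flat_exp m x \<le> fact (m + 2) * x ^ 2"
proof -
  define F :: real where "F = fact (m + 2)"
  have F: "F > 0" by (simp add: F_def)
  have "inverse F * (1 / x) ^ (m + 2) \<le> exp (1 / x)"
    using assms sum_le_suminf[OF summable_exp, of "{m+2}" "1/x"]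
    by (simp add: exp_def F_def del: fact_Suc add_2_eq_Suc' power_Suc)
  then have "exp (- 1 / x) \<le> F * x ^ (m + 2)"
    using assms F by (simp add: exp_minus field_simps del: fact_Suc add_2_eq_Suc' power_Suc)
  then have "exp (- 1 / x) \<le> fact (m + 2) * x ^ (m + 2)"
    by (simp only: F_def)
  then have "exp (- 1 / x) / x ^ m \<le> fact (m + 2) * x ^ (m + 2) / x ^ m"
    using assms by (intro divide_right_mono) auto
  also have "\<dots> = fact (m + 2) * x ^ 2"
    using assms by (simp add: power_add power2_eq_square)
  finally show ?thesis using assms by (simp add: flat_exp_def)
qed

text \<open>The parameter \<open>m\<close> closes the family under differentiation, up to linear
  combinations: derivatives of \<open>flat_exp 0\<close> involve only higher members, and all of
  them are flat at 0.\<close>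

lemma flat_exp_derivative:
  "(flat_exp m has_real_derivative (flat_exp (m + 2) x - m * flat_exp (m + 1) x)) (at x)"
proof -
  consider "x < 0" | "x = 0" | "x > 0" by linarith
  then show ?thesis
  proof cases
    case 1
    show ?thesis
      by (rule has_field_derivative_transform_within_open[where f = "\<lambda>_. 0" and S = "{..<0}"])
        (use 1 in \<open>auto simp: flat_exp_def\<close>)
  next
    case 3
    have "((\<lambda>x. x ^ m) has_real_derivative m * x ^ m / x) (at x)"
      using 3 DERIV_pow[of m x UNIV] by (cases m) (simp_all del: power_Suc add: power_Suc2)
    then have "((\<lambda>x. exp (- 1 / x) / x ^ m) has_real_derivative (flat_exp (m + 2) x - m * flat_exp (m + 1) x)) (at x)"
      using 3
      by (auto intro!: derivative_eq_intros simp: flat_exp_def field_simps power2_eq_square)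
        (cases m; simp)
    then show ?thesis
      by (rule has_field_derivative_transform_within_open[where S = "{0<..}"])
        (use 3 in \<open>auto simp: flat_exp_def\<close>)
  next
    case 2
    have "((\<lambda>h. (flat_exp m (0 + h) - flat_exp m 0) / h) \<longlongrightarrow> 0) (at 0)"
    proof (rule Lim_null_comparison[where g = "\<lambda>h. fact (m + 2) * \<bar>h\<bar>"])
      have "\<bar>flat_exp m h / h\<bar> \<le> fact (m + 2) * \<bar>h\<bar>" for h
      proof (cases "h > 0")
        case True
        then have "0 \<le> flat_exp m h" by (simp add: flat_exp_def)
        with True flat_exp_bound[OF True, of m] show ?thesis
          by (simp add: field_simps power2_eq_square)
      next
        case False
        then have "flat_exp m h / h = 0" by (simp add: flat_exp_def)
        moreover have "0 \<le> fact (m + 2) * \<bar>h\<bar>" by (intro mult_nonneg_nonneg) auto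
        ultimately show ?thesis by linarith
      qed
      then show "\<forall>\<^sub>F h in at 0. norm ((flat_exp m (0 + h) - flat_exp m 0) / h) \<le> fact (m + 2) * \<bar>h\<bar>"
        by (intro always_eventually) (simp add: flat_exp_def)
      show "((\<lambda>h. fact (m + 2) * \<bar>h\<bar>) \<longlongrightarrow> (0::real)) (at 0)"
        by (auto intro!: tendsto_eq_intros)
    qed
    then show ?thesis using 2 by (simp add: has_field_derivative_def[symmetric] DERIV_def flat_exp_def)
  qed
qed

lemma smooth_flat_exp: "smooth (flat_exp m)"
proof -
  have "C_k k (flat_exp m)" for k
  proof (induction k arbitrary: m)
    case 0
    show ?case
      using DERIV_isCont[OF flat_exp_derivative[of m]] by (simp add: continuous_at_imp_continuous_on)
  next
    case (Suc k)
    have "C_k k (\<lambda>x. flat_exp (m + 2) x + (- real m) * flat_exp (m + 1) x)"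
      by (intro C_k_add C_k_mult C_k_const Suc)
    then show ?case
      using flat_exp_derivative[of m] by (intro C_k_real_SucI) auto
  qed
  then show ?thesis by (simp add: smooth_def)
qed

text \<open>\<open>X\<close> is 1 minus the normalised antiderivative of a bump living on the
  interval from 1/4 to 1. The strict decrease there is what later makes the averaging kernels
  nonzero.\<close>

lemma smooth_step_exists:
  obtains X :: "real \<Rightarrow> real" where "smooth X"
    and "\<And>s. s \<le> 1/4 \<Longrightarrow> X s = 1" and "\<And>s. s \<ge> 1 \<Longrightarrow> X s = 0"
    and "\<And>s. deriv X s \<le> 0" and "\<And>s. 1/4 < s \<Longrightarrow> s < 1 \<Longrightarrow> deriv X s < 0"
proof -
  define b where "b = (\<lambda>s. flat_exp 0 (s - 1/4) * flat_exp 0 (1 + - s))"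
  have sb: "smooth b"
    unfolding b_def
    by (intro smooth_mult smooth_compose_real[OF smooth_flat_exp] smooth_diff smooth_add
        smooth_const smooth_minus smooth_linear[OF bounded_linear_ident])
  have contb: "continuous_on S b" for S
    by (rule smooth_continuous[OF sb])
  have b0: "b s \<ge> 0" for s by (simp add: b_def flat_exp_def)
  have bpos: "b s > 0" if "1/4 < s" "s < 1" for s
    using that by (simp add: b_def flat_exp_def)
  have bz: "b s = 0" if "s \<le> 1/4 \<or> s \<ge> 1" for s
    using that by (auto simp: b_def flat_exp_def)
  \<comment> \<open>An interval with reversed ends is empty, so this is the signed integral of
    \<open>b\<close> from 0 to s.\<close>
  define B where "B = (\<lambda>s. integral {0..s} b - integral {s..0} b)"
  have dB: "(B has_real_derivative b s) (at s)" for s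
  proof -
    define u where "u = \<bar>s\<bar> + 1"
    have "((\<lambda>x. integral {-u..x} b) has_real_derivative b s) (at s within {-u..u})"
      using integral_has_real_derivative[of "-u" u b s] contb u_def by (auto simp: abs_if)
    then have 1: "((\<lambda>x. integral {-u..x} b - integral {-u..0} b) has_real_derivative b s) (at s)"
      by (subst (asm) at_within_interior) (auto simp: u_def intro!: derivative_eq_intros)
    have int: "b integrable_on {x..y}" for x y
      by (rule integrable_continuous_real[OF contb])
    show ?thesis
    proof (rule has_field_derivative_transform_within_open[OF 1, of "{-u<..<u}"])
      fix x assume x: "x \<in> {-u<..<u}"
      show "integral {-u..x} b - integral {-u..0} b = B x"
      proof (cases "x \<ge> 0")
        case True
        then have "integral {-u..0} b + integral {0..x} b = integral {-u..x} b"
          using x by (intro Henstock_Kurzweil_Integration.integral_combine int) (auto simp: u_def)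
        moreover have "integral {x..0} b = 0"
          using True by (cases "x = 0") auto
        ultimately show ?thesis by (simp add: B_def)
      next
        case False
        then have "integral {-u..x} b + integral {x..0} b = integral {-u..0} b"
          using x by (intro Henstock_Kurzweil_Integration.integral_combine int) (auto simp: u_def)
        then show ?thesis using False by (simp add: B_def)
      qed
    qed (auto simp: u_def)
  qed
  have constB: "B s = B t" if "s \<le> t" "\<And>r. s < r \<Longrightarrow> r < t \<Longrightarrow> b r = 0" for s t
  proof (cases "s = t")
    case False
    have "continuous_on {s..t} B"
      using DERIV_isCont[OF dB] by (simp add: continuous_at_imp_continuous_on)
    moreover have "(B has_real_derivative 0) (at x)" if "s < x" "x < t" for x
      using dB[of x] \<open>\<And>r. s < r \<Longrightarrow> r < t \<Longrightarrow> b r = 0\<close> that by simp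
    ultimately show ?thesis
      using that False DERIV_isconst_end[of s t B] by simp
  qed simp
  have B14: "B s = B (1/4)" if "s \<le> 1/4" for s
    using constB[OF that] bz by auto
  have B1: "B s = B 1" if "s \<ge> 1" for s
    using constB[OF that] bz by auto
  have lt: "B (1/4) < B 1"
  proof (rule DERIV_pos_imp_increasing_open[where f = B])
    show "\<exists>y. (B has_real_derivative y) (at x) \<and> 0 < y" if "1/4 < x" "x < 1" for x
      using dB bpos[OF that] by blast
  qed (use DERIV_isCont[OF dB] in \<open>auto simp: continuous_at_imp_continuous_on\<close>)
  define C where "C = B 1 - B (1/4)"
  have C: "C > 0" using lt by (simp add: C_def)
  define X where "X = (\<lambda>s. (B 1 - B s) / C)"
  have dX: "(X has_real_derivative (- 1 / C) * b s) (at s)" for s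
    unfolding X_def using C by (auto intro!: derivative_eq_intros dB)
  have derivX: "deriv X s = (- 1 / C) * b s" for s
    using dX by (rule DERIV_imp_deriv)
  have "smooth X"
    by (rule smooth_antiderivative[OF dX smooth_mult[OF smooth_const sb]])
  moreover have "X s = 1" if "s \<le> 1/4" for s
    using C B14[OF that] by (simp add: X_def C_def)
  moreover have "X s = 0" if "s \<ge> 1" for s
    using B1[OF that] by (simp add: X_def)
  moreover have "deriv X s \<le> 0" for s
    using C b0[of s] by (simp add: derivX)
  moreover have "deriv X s < 0" if "1/4 < s" "s < 1" for s
    using C bpos[OF that] by (simp add: derivX)
  ultimately show ?thesis ..
qed

section \<open>Differentiation under the integral and integration by parts\<close>

text \<open>Needed for measurability: as a pointwise limit of difference quotients, a derivative
  inherits measurability in a parameter from the functions themselves.\<close>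

lemma has_derivative_difference_quotient:
  fixes f :: "'a::euclidean_space \<Rightarrow> 'b::real_normed_vector"
  assumes f: "(f has_derivative f') (at x)" and t: "t \<longlonglongrightarrow> 0" "\<And>n. t n > (0::real)"
  shows "(\<lambda>n. (f (x + t n *\<^sub>R v) - f x) /\<^sub>R t n) \<longlonglongrightarrow> f' v"
proof (cases "v = 0")
  case True
  interpret bounded_linear f' using f by (rule has_derivative_bounded_linear)
  show ?thesis using True by (simp add: zero)
next
  case False
  interpret bounded_linear f' using f by (rule has_derivative_bounded_linear)
  have lim: "((\<lambda>y. ((f y - f x) - f' (y - x)) /\<^sub>R norm (y - x)) \<longlongrightarrow> 0) (at x)"
    using f by (simp add: has_derivative_def netlimit_at)
  have "filterlim (\<lambda>n. x + t n *\<^sub>R v) (at x) sequentially"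
    unfolding filterlim_at
  proof
    have "(\<lambda>n. x + t n *\<^sub>R v) \<longlonglongrightarrow> x + 0 *\<^sub>R v"
      by (intro tendsto_intros t)
    then show "(\<lambda>n. x + t n *\<^sub>R v) \<longlonglongrightarrow> x" by simp
    show "\<forall>\<^sub>F n in sequentially. x + t n *\<^sub>R v \<in> UNIV \<and> x + t n *\<^sub>R v \<noteq> x"
      using False t(2) by (auto intro!: always_eventually simp: less_imp_neq[symmetric])
  qed
  from filterlim_compose[OF lim this]
  have "(\<lambda>n. norm v *\<^sub>R (((f (x + t n *\<^sub>R v) - f x) - t n *\<^sub>R f' v) /\<^sub>R (t n * norm v)) + f' v) \<longlonglongrightarrow> norm v *\<^sub>R 0 + f' v"
    using t(2) by (intro tendsto_intros) (simp add: scaleR abs_of_pos)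
  moreover have "norm v *\<^sub>R (((f (x + t n *\<^sub>R v) - f x) - t n *\<^sub>R f' v) /\<^sub>R (t n * norm v)) + f' v
      = (f (x + t n *\<^sub>R v) - f x) /\<^sub>R t n" for n
  proof -
    have e: "norm v * (inverse (t n) * inverse (norm v)) = inverse (t n)"
      "norm v * (inverse (t n) * inverse (norm v) * t n) = 1"
      using False t(2)[of n] by (simp_all add: field_simps)
    show ?thesis by (simp add: scaleR_diff_right e)
  qed
  ultimately show ?thesis by simp
qed

text \<open>The bound \<open>G p\<close> is a Lipschitz constant of \<open>f p\<close> on the ball,
  so the normalised remainders are dominated by the integrable function \<open>2 * G p\<close> and
  dominated convergence applies. Measurability of the derivative in p is not assumed but obtained
  from difference quotients.\<close>

lemma
  fixes f :: "'p \<Rightarrow> 'a::euclidean_space \<Rightarrow> 'b::{banach,second_countable_topology}"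
  assumes r: "r > 0"
    and meas: "\<And>z. z \<in> ball z0 r \<Longrightarrow> (\<lambda>p. f p z) \<in> borel_measurable M"
    and der: "\<And>p z. p \<in> space M \<Longrightarrow> z \<in> ball z0 r \<Longrightarrow> (f p has_derivative f' p z) (at z)"
    and bd: "\<And>p z v. p \<in> space M \<Longrightarrow> z \<in> ball z0 r \<Longrightarrow> norm (f' p z v) \<le> G p * norm v"
    and G: "integrable M G"
    and int: "integrable M (\<lambda>p. f p z0)"
  shows integrable_parameter_derivative: "\<And>v. integrable M (\<lambda>p. f' p z0 v)"
    and has_derivative_parameter_integral:
      "((\<lambda>z. integral\<^sup>L M (\<lambda>p. f p z)) has_derivative (\<lambda>v. integral\<^sup>L M (\<lambda>p. f' p z0 v))) (at z0)"
proof -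
  have z0: "z0 \<in> ball z0 r" using r by simp
  have bl: "bounded_linear (f' p z0)" if "p \<in> space M" for p
    using der[OF that z0] by (rule has_derivative_bounded_linear)
  have meas': "(\<lambda>p. f' p z0 v) \<in> borel_measurable M" for v
  proof (rule borel_measurable_LIMSEQ_metric)
    \<comment> \<open>The factor \<open>r / (norm v + 1)\<close> keeps every
      \<open>z0 + t n *\<^sub>R v\<close> inside the ball; the summand 1 covers
      \<open>v = 0\<close>.\<close>
    define t where "t = (\<lambda>n. r / (norm v + 1) * inverse (real (Suc n)))"
    have t: "t n > 0" for n
      unfolding t_def using r
      by (intro mult_pos_pos divide_pos_pos add_nonneg_pos positive_imp_inverse_positive) auto
    have t0: "t \<longlonglongrightarrow> 0"
      unfolding t_def by (rule tendsto_mult_right_zero[OF LIMSEQ_inverse_real_of_nat])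
    have "z0 + t n *\<^sub>R v \<in> ball z0 r" for n
    proof -
      have "norm v / (norm v + 1) * inverse (real (Suc n)) \<le> norm v / (norm v + 1) * 1"
        by (rule mult_left_mono) (auto simp: field_simps)
      also have "\<dots> < 1 * 1" by (simp add: add_nonneg_pos divide_simps)
      finally have "norm v / (norm v + 1) * inverse (real (Suc n)) < 1 * 1" .
      then have "r * (norm v / (norm v + 1) * inverse (real (Suc n))) < r * 1"
        using r by (intro mult_strict_left_mono) auto
      moreover have "norm (t n *\<^sub>R v) = r * (norm v / (norm v + 1) * inverse (real (Suc n)))"
        using t[of n] by (simp only: norm_scaleR abs_of_pos) (simp add: t_def)
      ultimately have "norm (t n *\<^sub>R v) < r" by simp
      then show ?thesis by (simp add: dist_norm)
    qed
    then show "(\<lambda>p. (f p (z0 + t n *\<^sub>R v) - f p z0) /\<^sub>R t n) \<in> borel_measurable M" for n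
      using meas z0 by measurable
    show "(\<lambda>n. (f p (z0 + t n *\<^sub>R v) - f p z0) /\<^sub>R t n) \<longlonglongrightarrow> f' p z0 v" if "p \<in> space M" for p
      by (rule has_derivative_difference_quotient[OF der[OF that z0] t0 t])
  qed
  show int': "integrable M (\<lambda>p. f' p z0 v)" for v
    by (rule Bochner_Integration.integrable_bound[where f = "\<lambda>p. G p * norm v"])
      (use G meas' bd[OF _ z0] in \<open>auto intro!: AE_I2 order_trans[OF _ abs_ge_self]\<close>)
  have lip: "norm (f p z - f p z0) \<le> G p * norm (z - z0)" if "p \<in> space M" "z \<in> ball z0 r" for p z
  proof (rule differentiable_bound[where f' = "f' p" and S = "ball z0 r"])
    show "(f p has_derivative f' p x) (at x within ball z0 r)" if "x \<in> ball z0 r" for x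
      using der[OF \<open>p \<in> space M\<close> that] by (rule has_derivative_at_withinI)
    show "onorm (f' p x) \<le> G p" if "x \<in> ball z0 r" for x
      using bd[OF \<open>p \<in> space M\<close> that] by (rule onorm_le)
  qed (use that z0 in auto)
  have intz: "integrable M (\<lambda>p. f p z)" if "z \<in> ball z0 r" for z
  proof -
    have "integrable M (\<lambda>p. f p z - f p z0)"
      by (rule Bochner_Integration.integrable_bound[where f = "\<lambda>p. G p * norm (z - z0)"])
        (use G meas that z0 lip[OF _ that] in \<open>auto intro!: AE_I2 order_trans[OF _ abs_ge_self]\<close>)
    from Bochner_Integration.integrable_add[OF this int] show ?thesis by simp
  qed
  show "((\<lambda>z. integral\<^sup>L M (\<lambda>p. f p z)) has_derivative (\<lambda>v. integral\<^sup>L M (\<lambda>p. f' p z0 v))) (at z0)"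
    unfolding has_derivative_def netlimit_at
  proof
    show "bounded_linear (\<lambda>v. integral\<^sup>L M (\<lambda>p. f' p z0 v))"
    proof (rule bounded_linear_intro)
      fix x y :: 'a and c :: real
      have "integral\<^sup>L M (\<lambda>p. f' p z0 (x + y)) = integral\<^sup>L M (\<lambda>p. f' p z0 x + f' p z0 y)"
        by (rule Bochner_Integration.integral_cong) (auto simp: bounded_linear.linear[OF bl] linear_add)
      then show "integral\<^sup>L M (\<lambda>p. f' p z0 (x + y)) = integral\<^sup>L M (\<lambda>p. f' p z0 x) + integral\<^sup>L M (\<lambda>p. f' p z0 y)"
        using int' by simp
      have "integral\<^sup>L M (\<lambda>p. f' p z0 (c *\<^sub>R x)) = integral\<^sup>L M (\<lambda>p. c *\<^sub>R f' p z0 x)"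
        by (rule Bochner_Integration.integral_cong) (auto simp: bounded_linear.linear[OF bl] linear_scale)
      then show "integral\<^sup>L M (\<lambda>p. f' p z0 (c *\<^sub>R x)) = c *\<^sub>R integral\<^sup>L M (\<lambda>p. f' p z0 x)"
        by simp
      have "norm (integral\<^sup>L M (\<lambda>p. f' p z0 x)) \<le> integral\<^sup>L M (\<lambda>p. norm (f' p z0 x))"
        by (rule integral_norm_bound)
      also have "\<dots> \<le> integral\<^sup>L M (\<lambda>p. G p * norm x)"
        using G bd[OF _ z0] int' by (intro integral_mono) auto
      finally have "norm (integral\<^sup>L M (\<lambda>p. f' p z0 x)) \<le> integral\<^sup>L M (\<lambda>p. G p * norm x)" .
      then show "norm (integral\<^sup>L M (\<lambda>p. f' p z0 x)) \<le> norm x * integral\<^sup>L M G"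
        by (simp add: mult.commute)
    qed
    show "((\<lambda>y. (integral\<^sup>L M (\<lambda>p. f p y) - integral\<^sup>L M (\<lambda>p. f p z0)
             - integral\<^sup>L M (\<lambda>p. f' p z0 (y - z0))) /\<^sub>R norm (y - z0)) \<longlongrightarrow> 0) (at z0)"
      unfolding tendsto_at_iff_sequentially comp_def
    proof (intro allI impI)
      fix y :: "nat \<Rightarrow> 'a"
      assume "\<forall>i. y i \<in> UNIV - {z0}" and y: "y \<longlonglongrightarrow> z0"
      then have yz: "y i \<noteq> z0" for i by auto
      obtain N where N: "\<And>i. i \<ge> N \<Longrightarrow> y i \<in> ball z0 r"
        using y r by (metis lim_sequentially dist_commute mem_ball)
      \<comment> \<open>Dropping the first \<open>N\<close> terms puts the whole sequence inside the
        ball, where the Lipschitz bound holds; the limit is insensitive to the shift.\<close>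
      define s where "s = (\<lambda>i p. (f p (y (i + N)) - f p z0 - f' p z0 (y (i + N) - z0)) /\<^sub>R norm (y (i + N) - z0))"
      have yN: "y (i + N) \<in> ball z0 r" for i using N by simp
      have "(\<lambda>i. integral\<^sup>L M (s i)) \<longlonglongrightarrow> integral\<^sup>L M (\<lambda>p. 0)"
      proof (rule integral_dominated_convergence[where w = "\<lambda>p. 2 * G p"])
        show "s i \<in> borel_measurable M" for i
          unfolding s_def using meas[OF yN] meas[OF z0] meas' by measurable
        show "AE p in M. (\<lambda>i. s i p) \<longlonglongrightarrow> 0"
        proof (rule AE_I2)
          fix p assume p: "p \<in> space M"
          have "((\<lambda>x. (f p x - f p z0 - f' p z0 (x - z0)) /\<^sub>R norm (x - z0)) \<longlongrightarrow> 0) (at z0)"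
            using der[OF p z0] by (simp add: has_derivative_def netlimit_at)
          moreover have "filterlim (\<lambda>i. y (i + N)) (at z0) sequentially"
            unfolding filterlim_at using yz LIMSEQ_ignore_initial_segment[OF y] by auto
          ultimately show "(\<lambda>i. s i p) \<longlonglongrightarrow> 0"
            unfolding s_def by (rule filterlim_compose)
        qed
        show "AE p in M. norm (s i p) \<le> 2 * G p" for i
        proof (rule AE_I2)
          fix p assume p: "p \<in> space M"
          have "norm (f p (y (i + N)) - f p z0 - f' p z0 (y (i + N) - z0))
              \<le> G p * norm (y (i + N) - z0) + G p * norm (y (i + N) - z0)"
            using lip[OF p yN[of i]] bd[OF p z0, of "y (i + N) - z0"]
              norm_triangle_ineq4[of "f p (y (i + N)) - f p z0" "f' p z0 (y (i + N) - z0)"] by linarith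
          then show "norm (s i p) \<le> 2 * G p"
            using yz[of "i + N"] by (simp add: s_def divide_simps mult_ac)
        qed
      qed (use G in auto)
      moreover have "integral\<^sup>L M (s i) = (integral\<^sup>L M (\<lambda>p. f p (y (i + N))) - integral\<^sup>L M (\<lambda>p. f p z0)
             - integral\<^sup>L M (\<lambda>p. f' p z0 (y (i + N) - z0))) /\<^sub>R norm (y (i + N) - z0)" for i
        unfolding s_def using intz[OF yN] int int' by simp
      ultimately have "(\<lambda>i. (integral\<^sup>L M (\<lambda>p. f p (y (i + N))) - integral\<^sup>L M (\<lambda>p. f p z0)
             - integral\<^sup>L M (\<lambda>p. f' p z0 (y (i + N) - z0))) /\<^sub>R norm (y (i + N) - z0)) \<longlonglongrightarrow> 0"
        by simp
      then show "(\<lambda>i. (integral\<^sup>L M (\<lambda>p. f p (y i)) - integral\<^sup>L M (\<lambda>p. f p z0)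
             - integral\<^sup>L M (\<lambda>p. f' p z0 (y i - z0))) /\<^sub>R norm (y i - z0)) \<longlonglongrightarrow> 0"
        by (rule LIMSEQ_offset)
    qed
  qed
qed

lemma cball_subset_cball_double:
  assumes "z \<in> ball z0 r"
  shows "cball z r \<subseteq> cball z0 (2 * r)"
proof
  fix x assume "x \<in> cball z r"
  then show "x \<in> cball z0 (2 * r)" using assms dist_triangle[of z0 x z] by simp
qed

lemma integrable_lborel_compact_support:
  fixes h :: "'a::euclidean_space \<Rightarrow> 'b::{banach,second_countable_topology}"
  assumes "continuous_on UNIV h" "compact K" "\<And>z. z \<notin> K \<Longrightarrow> h z = 0"
  shows "integrable lborel h"
proof -
  have "integrable lborel (\<lambda>z. indicator K z *\<^sub>R h z)"
    by (rule borel_integrable_compact[unfolded set_integrable_def])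
      (use assms(2) continuous_on_subset[OF assms(1)] in auto)
  moreover have "(\<lambda>z. indicator K z *\<^sub>R h z) = h"
    using assms(3) by (auto simp: fun_eq_iff indicator_def)
  ultimately show ?thesis by simp
qed

lemma lborel_integral_translate:
  fixes f :: "'a::euclidean_space \<Rightarrow> 'b::{banach, second_countable_topology}"
  assumes "f \<in> borel_measurable borel"
  shows "integral\<^sup>L lborel (\<lambda>x. f (c + x)) = integral\<^sup>L lborel f"
  using integral_distr[of "(+) c" lborel borel f] assms by (simp add: lborel_distr_plus)

text \<open>By translation invariance the integral of \<open>G (p + t *\<^sub>R v)\<close> over p
  does not depend on t; differentiating at t = 0 under the integral gives 0. The argument uses a
  bound for the derivative, but no continuity of it.\<close>

lemma
  fixes G :: "'a::euclidean_space \<Rightarrow> complex"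
  assumes G: "\<And>z. (G has_derivative G' z) (at z)"
    and bd: "\<And>z v. norm (G' z v) \<le> C * norm v"
    and supp: "\<And>z. norm z > R \<Longrightarrow> G z = 0"
  shows integrable_derivative: "integrable lborel (\<lambda>z. G' z v)"
    and integral_derivative_eq_0: "integral\<^sup>L lborel (\<lambda>z. G' z v) = 0"
proof -
  define f where "f = (\<lambda>p (t::real). G (p + t *\<^sub>R v))"
  define f' where "f' = (\<lambda>p (t::real) (h::real). G' (p + t *\<^sub>R v) (h *\<^sub>R v))"
  \<comment> \<open>For |t| < 1 the point \<open>p + t *\<^sub>R v\<close> can lie in the ball of
    radius \<open>R\<close> only if \<open>norm p \<le> R + norm v\<close>; outside this larger ball
    the derivative is 0.\<close>
  define g where "g = (\<lambda>p. indicator (cball (0::'a) (R + norm v)) p *\<^sub>R (C * norm v))"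
  have contG: "continuous_on UNIV G"
    using G by (auto simp: continuous_on_eq_continuous_at intro: has_derivative_continuous)
  then have mG: "G \<in> borel_measurable borel"
    by (rule borel_measurable_continuous_onI)
  have d: "(f p has_derivative f' p t) (at t)" for p t
  proof -
    have "((\<lambda>t. p + t *\<^sub>R v) has_derivative (\<lambda>h. h *\<^sub>R v)) (at t)"
      by (auto intro!: derivative_eq_intros)
    from has_derivative_compose[OF this G] show ?thesis by (simp add: f_def f'_def)
  qed
  have z: "G' z w = 0" if "norm z > R" for z w
  proof -
    have "(G has_derivative (\<lambda>_. 0)) (at z)"
      by (rule has_derivative_transform_within_open[where s = "- cball 0 R" and f = "\<lambda>_. 0"])
        (use that supp in auto)
    then have "G' z = (\<lambda>_. 0)" using G has_derivative_unique by blast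
    then show ?thesis by simp
  qed
  have C: "C * norm v \<ge> 0"
    using bd[of 0 v] norm_ge_zero order_trans by blast
  have bd': "norm (f' p t h) \<le> g p * norm h" if "t \<in> ball 0 1" for p t h
  proof (cases "norm p \<le> R + norm v")
    case True
    then show ?thesis
      using bd[of "p + t *\<^sub>R v" "h *\<^sub>R v"] by (simp add: f'_def g_def mult_ac)
  next
    case False
    have "norm (t *\<^sub>R v) \<le> 1 * norm v"
      unfolding norm_scaleR by (rule mult_right_mono) (use that in auto)
    then have "norm (p + t *\<^sub>R v) > R"
      using False norm_diff_ineq[of p "t *\<^sub>R v"] by simp
    then show ?thesis using z False by (simp add: f'_def g_def)
  qed
  have intG: "integrable lborel G"
    by (rule integrable_lborel_compact_support[OF contG compact_cball[of 0 R]]) (simp add: supp)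
  have "emeasure lborel (cball (0::'a) (R + norm v)) < \<infinity>"
    by (rule emeasure_bounded_finite[OF bounded_cball])
  then have g: "integrable lborel g"
    unfolding g_def by (auto intro!: integrable_scaleR_left integrable_real_indicator simp del: scaleR_conv_of_real)
  have mf: "(\<lambda>p. f p t) \<in> borel_measurable lborel" for t
    unfolding f_def using mG by measurable
  have "integrable lborel (\<lambda>p. f' p 0 h)" for h
    by (rule integrable_parameter_derivative[where r = 1 and G = g and f = f])
      (use mf d bd' g intG in \<open>auto simp: f_def\<close>)
  from this[of 1] show "integrable lborel (\<lambda>z. G' z v)"
    by (simp add: f'_def)
  have "((\<lambda>t. integral\<^sup>L lborel (\<lambda>p. f p t)) has_derivative (\<lambda>h. integral\<^sup>L lborel (\<lambda>p. f' p 0 h))) (at 0)"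
    by (rule has_derivative_parameter_integral[where r = 1 and G = g])
      (use mf d bd' g intG in \<open>auto simp: f_def\<close>)
  moreover have "integral\<^sup>L lborel (\<lambda>p. f p t) = integral\<^sup>L lborel G" for t
    using lborel_integral_translate[OF mG, of "t *\<^sub>R v"] by (simp add: f_def add.commute)
  ultimately have "(\<lambda>h. integral\<^sup>L lborel (\<lambda>p. f' p 0 h)) = (\<lambda>h. 0)"
    using has_derivative_unique[OF _ has_derivative_const] by simp
  from fun_cong[OF this, of 1] show "integral\<^sup>L lborel (\<lambda>z. G' z v) = 0"
    by (simp add: f'_def)
qed

text \<open>Common ground of smooth and holomorphic functions: integration by parts against a test
  function needs a derivative bounded on compact sets, but not its continuity. For holomorphic
  functions, given by complex-linear total derivatives, the bound comes from Cauchy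
  estimates.\<close>

definition tame_on :: "'a::euclidean_space set \<Rightarrow> ('a \<Rightarrow> complex) \<Rightarrow> bool" where
  "tame_on U f \<longleftrightarrow> (\<forall>z\<in>U. f differentiable (at z) \<and>
     (\<exists>\<delta>>0. \<exists>C. \<forall>w\<in>ball z \<delta> \<inter> U. \<forall>v. norm (frechet_derivative f (at w) v) \<le> C * norm v))"

lemma tame_on_has_derivative:
  "tame_on U f \<Longrightarrow> z \<in> U \<Longrightarrow> (f has_derivative frechet_derivative f (at z)) (at z)"
  by (auto simp: tame_on_def frechet_derivative_works)

lemma tame_on_continuous: "tame_on U f \<Longrightarrow> continuous_on U f"
  by (intro continuous_at_imp_continuous_on ballI has_derivative_continuous[OF tame_on_has_derivative])

lemma tame_onI:
  assumes "\<And>z. z \<in> U \<Longrightarrow> (f has_derivative f' z) (at z)"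
    and "\<And>z. z \<in> U \<Longrightarrow> \<exists>\<delta>>0. \<exists>C. \<forall>w\<in>ball z \<delta> \<inter> U. \<forall>v. norm (f' w v) \<le> C * norm v"
  shows "tame_on U f"
proof -
  have "frechet_derivative f (at z) = f' z" if "z \<in> U" for z
    using assms(1)[OF that] by (metis frechet_derivative_at)
  moreover have "f differentiable (at z)" if "z \<in> U" for z
    using assms(1)[OF that] by (rule differentiableI)
  ultimately show ?thesis
    using assms(2) unfolding tame_on_def by auto
qed

lemma tame_on_subset: "tame_on U f \<Longrightarrow> V \<subseteq> U \<Longrightarrow> tame_on V f"
proof -
  assume f: "tame_on U f" and V: "V \<subseteq> U"
  show "tame_on V f"
    unfolding tame_on_def
  proof (intro ballI conjI)
    fix z assume z: "z \<in> V"
    then show "f differentiable (at z)" using f V by (auto simp: tame_on_def)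
    obtain d C where "d > 0" "\<forall>w\<in>ball z d \<inter> U. \<forall>v. norm (frechet_derivative f (at w) v) \<le> C * norm v"
      using f V z unfolding tame_on_def by blast
    then show "\<exists>d>0. \<exists>C. \<forall>w\<in>ball z d \<inter> V. \<forall>v. norm (frechet_derivative f (at w) v) \<le> C * norm v"
      using V by (intro exI[of _ d] conjI exI[of _ C]) auto
  qed
qed

lemma locally_bounded_of_continuous:
  fixes f :: "'a::euclidean_space \<Rightarrow> 'b::real_normed_vector"
  assumes "continuous_on U f" "z \<in> U"
  shows "\<exists>\<delta>>0. \<forall>w\<in>ball z \<delta> \<inter> U. norm (f w) \<le> norm (f z) + 1"
proof -
  obtain \<delta> where "\<delta> > 0" "\<And>w. w \<in> U \<Longrightarrow> dist w z < \<delta> \<Longrightarrow> dist (f w) (f z) < 1"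
    using assms by (metis continuous_on_iff zero_less_one)
  moreover have "norm (f w) \<le> norm (f z) + 1" if "dist (f w) (f z) < 1" for w
    using that norm_triangle_ineq2[of "f w" "f z"] by (simp add: dist_norm)
  ultimately show ?thesis
    by (intro exI[of _ \<delta>]) (auto simp: dist_commute)
qed

lemma tame_on_add:
  assumes f: "tame_on U f" and g: "tame_on U g"
  shows "tame_on U (\<lambda>z. f z + g z)"
proof (rule tame_onI)
  fix z assume z: "z \<in> U"
  show "((\<lambda>z. f z + g z) has_derivative (\<lambda>v. frechet_derivative f (at z) v + frechet_derivative g (at z) v)) (at z)"
    by (intro has_derivative_add tame_on_has_derivative[OF f z] tame_on_has_derivative[OF g z])
  obtain d1 C1 d2 C2 where *: "d1 > 0" "d2 > 0"
    "\<And>w v. w \<in> ball z d1 \<inter> U \<Longrightarrow> norm (frechet_derivative f (at w) v) \<le> C1 * norm v"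
    "\<And>w v. w \<in> ball z d2 \<inter> U \<Longrightarrow> norm (frechet_derivative g (at w) v) \<le> C2 * norm v"
    using f g z unfolding tame_on_def by metis
  have "norm (frechet_derivative f (at w) v + frechet_derivative g (at w) v) \<le> (C1 + C2) * norm v"
    if "w \<in> ball z (min d1 d2) \<inter> U" for w v
    using *(3)[of w v] *(4)[of w v] that norm_triangle_ineq[of "frechet_derivative f (at w) v" "frechet_derivative g (at w) v"]
    by (simp add: distrib_right)
  then show "\<exists>\<delta>>0. \<exists>C. \<forall>w\<in>ball z \<delta> \<inter> U. \<forall>v. norm (frechet_derivative f (at w) v + frechet_derivative g (at w) v) \<le> C * norm v"
    using *(1,2) by (intro exI[of _ "min d1 d2"] conjI exI[of _ "C1 + C2"] ballI allI) auto
qed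

lemma tame_on_mult:
  assumes f: "tame_on U f" and g: "tame_on U g"
  shows "tame_on U (\<lambda>z. f z * g z)"
proof (rule tame_onI)
  fix z assume z: "z \<in> U"
  show "((\<lambda>z. f z * g z) has_derivative (\<lambda>v. f z * frechet_derivative g (at z) v + frechet_derivative f (at z) v * g z)) (at z)"
    by (intro has_derivative_mult tame_on_has_derivative[OF f z] tame_on_has_derivative[OF g z])
  obtain d1 C1 d2 C2 where *: "d1 > 0" "d2 > 0"
    "\<And>w v. w \<in> ball z d1 \<inter> U \<Longrightarrow> norm (frechet_derivative f (at w) v) \<le> C1 * norm v"
    "\<And>w v. w \<in> ball z d2 \<inter> U \<Longrightarrow> norm (frechet_derivative g (at w) v) \<le> C2 * norm v"
    using f g z unfolding tame_on_def by metis
  obtain d3 d4 where **: "d3 > 0" "d4 > 0"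
    "\<And>w. w \<in> ball z d3 \<inter> U \<Longrightarrow> norm (f w) \<le> norm (f z) + 1"
    "\<And>w. w \<in> ball z d4 \<inter> U \<Longrightarrow> norm (g w) \<le> norm (g z) + 1"
    using locally_bounded_of_continuous[OF tame_on_continuous[OF f] z]
      locally_bounded_of_continuous[OF tame_on_continuous[OF g] z] by metis
  define d where "d = min (min d1 d2) (min d3 d4)"
  let ?C = "(norm (f z) + 1) * C2 + C1 * (norm (g z) + 1)"
  have "norm (f w * frechet_derivative g (at w) v + frechet_derivative f (at w) v * g w) \<le> ?C * norm v"
    if w: "w \<in> ball z d \<inter> U" for w v
  proof -
    have f': "norm (frechet_derivative f (at w) v) \<le> C1 * norm v"
      and g': "norm (frechet_derivative g (at w) v) \<le> C2 * norm v"
      using *(3)[of w v] *(4)[of w v] w by (auto simp: d_def)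
    have "norm (f w * frechet_derivative g (at w) v) \<le> (norm (f z) + 1) * (C2 * norm v)"
      unfolding norm_mult using **(3)[of w] w g' by (intro mult_mono) (auto simp: d_def)
    moreover have "norm (frechet_derivative f (at w) v * g w) \<le> (C1 * norm v) * (norm (g z) + 1)"
      unfolding norm_mult using **(4)[of w] w f' order_trans[OF norm_ge_zero f']
      by (intro mult_mono) (auto simp: d_def)
    ultimately show ?thesis
      by (intro norm_triangle_le) (simp add: algebra_simps)
  qed
  moreover have "d > 0" using *(1,2) **(1,2) by (simp add: d_def)
  ultimately show "\<exists>\<delta>>0. \<exists>C. \<forall>w\<in>ball z \<delta> \<inter> U. \<forall>v.
      norm (f w * frechet_derivative g (at w) v + frechet_derivative f (at w) v * g w) \<le> C * norm v"
    by (intro exI[of _ d] conjI exI[of _ ?C] ballI allI) auto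
qed

lemma linear_norm_le_Basis:
  fixes L :: "'a::euclidean_space \<Rightarrow> 'b::real_normed_vector"
  assumes "linear L"
  shows "norm (L v) \<le> (\<Sum>b\<in>Basis. norm (L b)) * norm v"
proof -
  have "L v = (\<Sum>b\<in>Basis. (v \<bullet> b) *\<^sub>R L b)"
    using linear_sum[OF assms, of "\<lambda>b. (v \<bullet> b) *\<^sub>R b" Basis] linear_scale[OF assms]
    by (simp add: euclidean_representation)
  then have "norm (L v) \<le> (\<Sum>b\<in>Basis. \<bar>v \<bullet> b\<bar> * norm (L b))"
    using norm_sum[of "\<lambda>b. (v \<bullet> b) *\<^sub>R L b" Basis] by simp
  also have "\<dots> \<le> (\<Sum>b\<in>Basis. norm v * norm (L b))"
    by (intro sum_mono mult_right_mono Basis_le_norm) auto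
  finally show ?thesis by (simp add: sum_distrib_left mult.commute)
qed

lemma smooth_tame_on:
  fixes f :: "'a::euclidean_space \<Rightarrow> complex"
  assumes f: "smooth f"
  shows "tame_on U f"
proof -
  have "tame_on UNIV f"
  proof (rule tame_onI[OF smooth_has_derivative[OF f]])
    fix z :: 'a
    define N where "N = (\<lambda>w. \<Sum>b\<in>Basis. norm (frechet_derivative f (at w) b))"
    have "continuous_on UNIV N"
      unfolding N_def by (intro continuous_intros smooth_continuous smooth_frechet f)
    then obtain \<delta> where "\<delta> > 0" "\<And>w. w \<in> ball z \<delta> \<inter> UNIV \<Longrightarrow> norm (N w) \<le> norm (N z) + 1"
      using locally_bounded_of_continuous[of UNIV N z] by blast
    have "norm (frechet_derivative f (at w) v) \<le> N w * norm v" for w v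
      unfolding N_def
      by (rule linear_norm_le_Basis[OF has_derivative_linear[OF smooth_has_derivative[OF f]]])
    then have "norm (frechet_derivative f (at w) v) \<le> (norm (N z) + 1) * norm v" if "w \<in> ball z \<delta>" for w v
    proof -
      have "N w \<le> norm (N z) + 1"
        using \<open>\<And>w. w \<in> ball z \<delta> \<inter> UNIV \<Longrightarrow> norm (N w) \<le> norm (N z) + 1\<close>[of w] that by simp
      then show ?thesis
        using mult_right_mono[of "N w" "norm (N z) + 1" "norm v"]
          \<open>\<And>w v. norm (frechet_derivative f (at w) v) \<le> N w * norm v\<close>[of w v] by simp
    qed
    then show "\<exists>\<delta>>0. \<exists>C. \<forall>w\<in>ball z \<delta> \<inter> UNIV. \<forall>v. norm (frechet_derivative f (at w) v) \<le> C * norm v"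
      using \<open>\<delta> > 0\<close> by blast
  qed
  then show ?thesis by (rule tame_on_subset) simp
qed

text \<open>Local bounds pass to compact sets through a finite subcover, with the sum of the local
  constants as a crude common one.\<close>

lemma tame_on_compact_bound:
  assumes f: "tame_on U f" and K: "compact K" "K \<subseteq> U"
  obtains C where "C \<ge> 0" "\<And>z v. z \<in> K \<Longrightarrow> norm (frechet_derivative f (at z) v) \<le> C * norm v"
proof -
  obtain \<delta> C where dC: "\<And>z. z \<in> K \<Longrightarrow> \<delta> z > 0"
    "\<And>z w v. z \<in> K \<Longrightarrow> w \<in> ball z (\<delta> z) \<inter> U \<Longrightarrow> norm (frechet_derivative f (at w) v) \<le> C z * norm v"
    using f K(2) unfolding tame_on_def by (metis subsetD)
  have "K \<subseteq> (\<Union>z\<in>K. ball z (\<delta> z))" using dC(1) by force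
  then obtain F where F: "F \<subseteq> K" "finite F" "K \<subseteq> (\<Union>z\<in>F. ball z (\<delta> z))"
    using compactE_image[OF K(1), of K "\<lambda>z. ball z (\<delta> z)"] by (metis open_ball)
  define B where "B = (\<Sum>z\<in>F. \<bar>C z\<bar>)"
  show thesis
  proof
    show "B \<ge> 0" by (simp add: B_def sum_nonneg)
    fix w v assume w: "w \<in> K"
    then obtain z where z: "z \<in> F" "w \<in> ball z (\<delta> z)" using F by auto
    have "norm (frechet_derivative f (at w) v) \<le> C z * norm v"
      using dC(2)[of z w v] z w F K by auto
    also have "\<dots> \<le> B * norm v"
    proof (rule mult_right_mono)
      have "\<bar>C z\<bar> \<le> B" unfolding B_def using F(2) z(1) by (intro member_le_sum) auto
      then show "C z \<le> B" by simp
    qed simp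
    finally show "norm (frechet_derivative f (at w) v) \<le> B * norm v" .
  qed
qed

section \<open>Wirtinger derivatives and Cauchy estimates\<close>

lemma wirtinger_bar_eqI:
  "(f has_derivative f') (at z) \<Longrightarrow> wirtinger_bar k f z = (f' (axis k 1) + \<i> * f' (axis k \<i>)) / 2"
  unfolding wirtinger_bar_def by (metis frechet_derivative_at)

lemma wirtinger_bar_transform:
  assumes "open U" "z \<in> U" "\<And>w. w \<in> U \<Longrightarrow> f w = g w"
  shows "wirtinger_bar k f z = wirtinger_bar k g z"
proof -
  have "frechet_derivative f (at z) = frechet_derivative g (at z)"
  proof (cases "f differentiable (at z)")
    case True
    then show ?thesis using frechet_derivative_transform_within_open assms by blast
  next
    case False
    \<comment> \<open>If \<open>f\<close> is not differentiable at z,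
      \<open>frechet_derivative\<close> still selects from the same predicate for \<open>f\<close>
      and \<open>g\<close>, so the two values agree all the same.\<close>
    have "(f has_derivative L) (at z) = (g has_derivative L) (at z)" for L
      using assms has_derivative_transform_within_open[of _ L z UNIV U] by metis
    then show ?thesis by (simp add: frechet_derivative_def)
  qed
  then show ?thesis by (simp add: wirtinger_bar_def)
qed

lemma wirtinger_bar_add:
  assumes "f differentiable (at z)" "g differentiable (at z)"
  shows "wirtinger_bar k (\<lambda>z. f z + g z) z = wirtinger_bar k f z + wirtinger_bar k g z"
  unfolding wirtinger_bar_eqI[OF has_derivative_add[OF assms[unfolded frechet_derivative_works]]]
  by (simp add: wirtinger_bar_def field_simps)

lemma wirtinger_bar_mult:
  assumes "f differentiable (at z)" "g differentiable (at z)"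
  shows "wirtinger_bar k (\<lambda>z. f z * g z) z = f z * wirtinger_bar k g z + wirtinger_bar k f z * g z"
  unfolding wirtinger_bar_eqI[OF has_derivative_mult[OF assms[unfolded frechet_derivative_works]]]
  by (simp add: wirtinger_bar_def field_simps)

lemma wirtinger_bar_const: "wirtinger_bar k (\<lambda>z. c) z = 0"
  by (simp add: wirtinger_bar_def)

lemma wirtinger_bar_sum:
  assumes "finite A" "\<And>i. i \<in> A \<Longrightarrow> f i differentiable (at z)"
  shows "wirtinger_bar k (\<lambda>z. \<Sum>i\<in>A. f i z) z = (\<Sum>i\<in>A. wirtinger_bar k (f i) z)"
proof -
  have "((\<lambda>z. \<Sum>i\<in>A. f i z) has_derivative (\<lambda>v. \<Sum>i\<in>A. frechet_derivative (f i) (at z) v)) (at z)"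
    using assms by (intro has_derivative_sum) (simp add: frechet_derivative_works)
  from wirtinger_bar_eqI[OF this] show ?thesis
    by (simp add: wirtinger_bar_def sum_distrib_left sum.distrib sum_divide_distrib add_divide_distrib)
qed

lemma axis_imaginary: "axis k \<i> = \<i> *s (axis k 1 :: complex ^ 'n)"
  by (simp add: vec_eq_iff axis_def)

lemma wirtinger_bar_complex_linear:
  assumes "(f has_derivative L) (at z)" "\<And>c v. L (c *s v) = c * L v"
  shows "wirtinger_bar k f z = 0"
  using wirtinger_bar_eqI[OF assms(1), of k] by (simp add: axis_imaginary assms(2))

lemma wirtinger_bar_holomorphic:
  "holomorphic_several_on f U \<Longrightarrow> z \<in> U \<Longrightarrow> wirtinger_bar k f z = 0"
  unfolding holomorphic_several_on_def using wirtinger_bar_complex_linear by blast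

lemma has_derivative_cnj_coordinate:
  "((\<lambda>z. cnj (z $ j - a)) has_derivative (\<lambda>v. cnj (v $ j))) (at (z :: complex ^ 'n))"
proof -
  have "((\<lambda>z. z $ j - a) has_derivative (\<lambda>v. v $ j)) (at z)"
    by (auto intro!: derivative_eq_intros bounded_linear.has_derivative[OF bounded_linear_vec_nth])
  then show ?thesis by (rule bounded_linear.has_derivative[OF bounded_linear_cnj])
qed

lemma wirtinger_bar_cnj_coordinate:
  "wirtinger_bar k (\<lambda>z. cnj (z $ j - a)) z = (if j = k then 1 else 0)"
  unfolding wirtinger_bar_eqI[OF has_derivative_cnj_coordinate] by (simp add: axis_def)

lemma has_derivative_norm_sq:
  fixes a :: "'a::euclidean_space"
  shows "((\<lambda>z. (norm (z - a))\<^sup>2) has_derivative (\<lambda>v. 2 * ((z - a) \<bullet> v))) (at z)"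
  unfolding power2_norm_eq_inner
  by (auto intro!: derivative_eq_intros simp: inner_commute)

lemma smooth_norm_sq: "smooth (\<lambda>z :: 'a::euclidean_space. (norm (z - a))\<^sup>2)"
proof -
  have "C_k k (\<lambda>z :: 'a. (norm (z - a))\<^sup>2)" for k
  proof -
    have "C_k (Suc k) (\<lambda>z :: 'a. (norm (z - a))\<^sup>2)"
    proof (rule C_k_SucI[OF has_derivative_norm_sq])
      fix v :: 'a
      have "smooth (\<lambda>z. 2 * (z \<bullet> v) + - 2 * (a \<bullet> v))"
        by (intro smooth_add smooth_const smooth_mult smooth_linear[OF bounded_linear_inner_left])
      then show "C_k k (\<lambda>z. 2 * ((z - a) \<bullet> v))"
        by (simp add: smooth_def inner_diff_left right_diff_distrib)
    qed
    then show ?thesis by (rule C_k_pred)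
  qed
  then show ?thesis by (simp add: smooth_def)
qed

section \<open>Radial functions\<close>

definition radial :: "(real \<Rightarrow> real) \<Rightarrow> complex ^ 'n \<Rightarrow> complex ^ 'n \<Rightarrow> complex" where
  "radial K a z = complex_of_real (K ((norm (z - a))\<^sup>2))"

lemma smooth_radial: "smooth K \<Longrightarrow> smooth (radial K a)"
  unfolding radial_def
  by (rule smooth_bounded_linear[OF bounded_linear_of_real smooth_compose_real[OF _ smooth_norm_sq]])

lemma has_derivative_radial:
  assumes "smooth K"
  shows "(radial K a has_derivative (\<lambda>v. complex_of_real (deriv K ((norm (z - a))\<^sup>2) * (2 * ((z - a) \<bullet> v))))) (at z)"
  unfolding radial_def
  by (rule bounded_linear.has_derivative[OF bounded_linear_of_real
      has_derivative_compose[OF has_derivative_norm_sq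
        smooth_has_real_derivative[OF assms, unfolded has_field_derivative_def]]])

text \<open>The squared distance is the sum of (z_j - a_j) times its conjugate, so its derivative in
  the conjugate of z_k is z_k - a_k. A radial function becomes another one times a holomorphic
  coordinate, and iterated derivatives remain explicit.\<close>

lemma wirtinger_bar_radial:
  assumes "smooth K"
  shows "wirtinger_bar k (radial K a) z = (z $ k - a $ k) * radial (deriv K) a z"
proof -
  have e: "(z - a) \<bullet> axis k 1 = Re (z $ k - a $ k)" "(z - a) \<bullet> axis k \<i> = Im (z $ k - a $ k)"
    by (simp_all add: inner_axis inner_complex_def)
  show ?thesis
    unfolding wirtinger_bar_eqI[OF has_derivative_radial[OF assms]] e
    by (simp add: radial_def complex_eq_iff)
qed

lemma smooth_coordinate: "smooth (\<lambda>z :: complex ^ 'n. z $ j - a)"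
  by (rule smooth_diff[OF smooth_linear[OF bounded_linear_vec_nth] smooth_const])

lemma smooth_cnj_coordinate: "smooth (\<lambda>z :: complex ^ 'n. cnj (z $ j - a))"
  by (rule smooth_bounded_linear[OF bounded_linear_cnj smooth_coordinate])

lemma has_derivative_coordinate: "((\<lambda>z. z $ j - a) has_derivative (\<lambda>v. v $ j)) (at (z :: complex ^ 'n))"
  by (auto intro!: derivative_eq_intros bounded_linear.has_derivative[OF bounded_linear_vec_nth])

lemma holomorphic_coordinate: "holomorphic_several_on (\<lambda>z. z $ j - a) U"
  unfolding holomorphic_several_on_def
  by (intro ballI exI[of _ "\<lambda>v. v $ j"] conjI has_derivative_coordinate) simp

lemma holomorphic_const: "holomorphic_several_on (\<lambda>z. c) U"
  unfolding holomorphic_several_on_def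
  by (intro ballI exI[of _ "\<lambda>v. 0"] conjI) auto

lemma wirtinger_bar_coordinate: "wirtinger_bar k (\<lambda>z. z $ j - a) z = 0"
  by (rule wirtinger_bar_holomorphic[OF holomorphic_coordinate, of _ UNIV]) simp

section \<open>Complex lines and Cauchy estimates\<close>

lemma holomorphic_has_derivative:
  assumes "holomorphic_several_on f U" "z \<in> U"
  shows "(f has_derivative frechet_derivative f (at z)) (at z)"
    and "frechet_derivative f (at z) (c *s v) = c * frechet_derivative f (at z) v"
proof -
  obtain L where L: "(f has_derivative L) (at z)" "\<And>c v. L (c *s v) = c * L v"
    using assms unfolding holomorphic_several_on_def by blast
  moreover have "frechet_derivative f (at z) = L" using L(1) by (metis frechet_derivative_at)
  ultimately show "(f has_derivative frechet_derivative f (at z)) (at z)"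
    and "frechet_derivative f (at z) (c *s v) = c * frechet_derivative f (at z) v" by simp_all
qed

lemma norm_vector_smult: "norm (c *s (v :: complex ^ 'n)) = norm c * norm v"
  by (simp add: norm_vec_def L2_set_def norm_mult power_mult_distrib sum_distrib_left[symmetric]
      real_sqrt_mult)

lemma bounded_linear_vector_smult: "bounded_linear (\<lambda>c. c *s (v :: complex ^ 'n))"
  by (rule bounded_linear_intro[where K = "norm v"])
    (auto simp: norm_vector_smult vec_eq_iff algebra_simps)

lemma holomorphic_on_line:
  assumes f: "holomorphic_several_on f U" and z: "z + c *s v \<in> U"
  shows "((\<lambda>c. f (z + c *s v)) has_field_derivative frechet_derivative f (at (z + c *s v)) v) (at c)"
proof -
  have "((\<lambda>c. z + c *s v) has_derivative (\<lambda>c. c *s v)) (at c)"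
    by (auto intro!: derivative_eq_intros bounded_linear.has_derivative[OF bounded_linear_vector_smult])
  from has_derivative_compose[OF this holomorphic_has_derivative(1)[OF f z]]
  have "((\<lambda>c. f (z + c *s v)) has_derivative (\<lambda>x. x * frechet_derivative f (at (z + c *s v)) v)) (at c)"
    by (simp add: holomorphic_has_derivative(2)[OF f z])
  moreover have "(\<lambda>x. x * frechet_derivative f (at (z + c *s v)) v) = (*) (frechet_derivative f (at (z + c *s v)) v)"
    by (simp add: fun_eq_iff)
  ultimately show ?thesis by (simp only: has_field_derivative_def)
qed

text \<open>Restricted to the complex line through \<open>z\<close> in direction \<open>v\<close>,
  \<open>f\<close> is a function of one variable on a disc of radius \<open>r / norm v\<close>,
  whose derivative at 0 is the directional derivative; the classical estimate applies to it.\<close>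

lemma Cauchy_estimate_several:
  assumes f: "holomorphic_several_on f U" and r: "r > 0" "cball z r \<subseteq> U"
    and M: "\<And>w. w \<in> cball z r \<Longrightarrow> norm (f w) \<le> M"
  shows "norm (frechet_derivative f (at z) v) \<le> M / r * norm v"
proof (cases "v = 0")
  case True
  have "z \<in> U" using r by auto
  from has_derivative_linear[OF holomorphic_has_derivative(1)[OF f this]] True
  show ?thesis by (simp add: linear_0)
next
  case False
  define F where "F = (\<lambda>c. f (z + c *s v))"
  define \<rho> where "\<rho> = r / norm v"
  have \<rho>: "\<rho> > 0" using False r by (simp add: \<rho>_def)
  have mem: "z + c *s v \<in> cball z r" if "c \<in> cball 0 \<rho>" for c
    using that False by (simp add: dist_norm norm_vector_smult \<rho>_def field_simps)
  have d: "(F has_field_derivative frechet_derivative f (at (z + c *s v)) v) (at c)" if "c \<in> cball 0 \<rho>" for c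
    unfolding F_def by (rule holomorphic_on_line[OF f]) (use mem[OF that] r in auto)
  have "norm ((deriv ^^ 1) F 0) \<le> fact 1 * M / \<rho> ^ 1"
  proof (rule Cauchy_inequality)
    show "F holomorphic_on ball 0 \<rho>"
      unfolding holomorphic_on_open[OF open_ball] using d by (meson ball_subset_cball subsetD)
    show "continuous_on (cball 0 \<rho>) F"
      using d by (intro continuous_at_imp_continuous_on ballI DERIV_isCont) blast
    show "norm (F x) \<le> M" if "norm (0 - x) = \<rho>" for x
      unfolding F_def by (rule M[OF mem]) (use that in simp)
  qed (rule \<rho>)
  moreover have "deriv F 0 = frechet_derivative f (at z) v"
    using DERIV_imp_deriv[OF d, of 0] \<rho> by simp
  ultimately show ?thesis by (simp add: \<rho>_def)
qed

lemma holomorphic_continuous: "holomorphic_several_on f U \<Longrightarrow> continuous_on U f"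
  by (intro continuous_at_imp_continuous_on ballI has_derivative_continuous[OF holomorphic_has_derivative(1)])

lemma holomorphic_tame_on:
  assumes f: "holomorphic_several_on f U" and U: "open U"
  shows "tame_on U f"
proof (rule tame_onI[OF holomorphic_has_derivative(1)[OF f]])
  fix z assume z: "z \<in> U"
  obtain d where d: "d > 0" "\<And>w. w \<in> ball z d \<inter> U \<Longrightarrow> norm (f w) \<le> norm (f z) + 1"
    using locally_bounded_of_continuous[OF holomorphic_continuous[OF f] z] by blast
  obtain e where e: "e > 0" "ball z e \<subseteq> U" using U z openE by blast
  \<comment> \<open>A third of the smaller radius leaves room, inside both balls, for a closed ball
    of radius \<open>r\<close> around every point of \<open>ball z r\<close>.\<close>
  define r where "r = min d e / 3"
  have r: "r > 0" using d e by (simp add: r_def)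
  have "norm (frechet_derivative f (at w) v) \<le> (norm (f z) + 1) / r * norm v" if "w \<in> ball z r" for w v
  proof (rule Cauchy_estimate_several[OF f r])
    have *: "x \<in> ball z d \<inter> ball z e" if "x \<in> cball w r" for x
      using that \<open>w \<in> ball z r\<close> dist_triangle[of z x w] r by (auto simp: r_def)
    then show "cball w r \<subseteq> U" using e by auto
    show "norm (f x) \<le> norm (f z) + 1" if "x \<in> cball w r" for x
      using d(2)[of x] *[OF that] e by auto
  qed
  then show "\<exists>\<delta>>0. \<exists>C. \<forall>w\<in>ball z \<delta> \<inter> U. \<forall>v. norm (frechet_derivative f (at w) v) \<le> C * norm v"
    using r by blast
qed simp

section \<open>Test functions and integration by parts\<close>

lemma test_functions_smooth: "\<phi> \<in> test_functions \<Omega> \<Longrightarrow> smooth \<phi>"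
  by (simp add: test_functions_def smooth_def)

lemma test_functionsI:
  assumes "smooth \<phi>" "compact K" "K \<subseteq> \<Omega>" "\<And>z. z \<notin> K \<Longrightarrow> \<phi> z = 0"
  shows "\<phi> \<in> test_functions \<Omega>"
proof -
  have "closure {z. \<phi> z \<noteq> 0} \<subseteq> K"
    using assms(2,4) by (intro closure_minimal compact_imp_closed) auto
  moreover from this have "compact (closure {z. \<phi> z \<noteq> 0})"
    using compact_Int_closed[OF assms(2) closed_closure, of "{z. \<phi> z \<noteq> 0}"] by (simp only: Int_absorb1)
  ultimately show ?thesis
    using assms(1,3) unfolding test_functions_def smooth_def by auto
qed

lemma test_functions_support:
  assumes "\<phi> \<in> test_functions \<Omega>"
  shows "\<exists>K. compact K \<and> K \<subseteq> \<Omega> \<and> (\<forall>z. z \<notin> K \<longrightarrow> \<phi> z = 0 \<and> (\<forall>k. wirtinger_bar k \<phi> z = 0))"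
proof (intro exI conjI allI impI)
  let ?K = "closure {z. \<phi> z \<noteq> 0}"
  show "compact ?K" "?K \<subseteq> \<Omega>" using assms by (auto simp: test_functions_def)
  have *: "\<phi> z = 0" if "z \<notin> ?K" for z
  proof (rule ccontr)
    assume "\<phi> z \<noteq> 0"
    then have "z \<in> ?K" by (intro subsetD[OF closure_subset]) simp
    with that show False by simp
  qed
  then show "\<phi> z = 0" if "z \<notin> ?K" for z using that .
  show "wirtinger_bar k \<phi> z = 0" if "z \<notin> ?K" for z k
  proof -
    have "wirtinger_bar k \<phi> z = wirtinger_bar k (\<lambda>_. 0) z"
    proof (rule wirtinger_bar_transform[of "- ?K"])
      show "open (- ?K)" by (rule open_Compl[OF closed_closure])
      show "\<phi> w = 0" if "w \<in> - ?K" for w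
        by (rule *) (use that in simp)
    qed (use that in simp)
    then show ?thesis by (simp only: wirtinger_bar_const)
  qed
qed

lemma test_functions_mult:
  assumes "\<phi> \<in> test_functions \<Omega>" "smooth f"
  shows "(\<lambda>z. f z * \<phi> z) \<in> test_functions \<Omega>"
proof -
  obtain K where "compact K" "K \<subseteq> \<Omega>" "\<And>z. z \<notin> K \<Longrightarrow> \<phi> z = 0"
    using test_functions_support[OF assms(1)] by blast
  then show ?thesis
    by (intro test_functionsI[of _ K] smooth_mult assms(2) test_functions_smooth[OF assms(1)]) simp_all
qed

lemma smooth_wirtinger_bar:
  assumes "smooth \<phi>"
  shows "smooth (wirtinger_bar k \<phi>)"
proof -
  have "smooth (\<lambda>z. (1/2) * (frechet_derivative \<phi> (at z) (axis k 1) + \<i> * frechet_derivative \<phi> (at z) (axis k \<i>)))"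
    by (intro smooth_mult smooth_add smooth_const smooth_frechet assms)
  moreover have "wirtinger_bar k \<phi> = (\<lambda>z. (1/2) * (frechet_derivative \<phi> (at z) (axis k 1) + \<i> * frechet_derivative \<phi> (at z) (axis k \<i>)))"
    by (simp add: wirtinger_bar_def fun_eq_iff)
  ultimately show ?thesis by simp
qed

text \<open>The distributional definitions integrate over the completed measure on \<open>U\<close>,
  the calculus above over \<open>lborel\<close>; extension by zero connects the two.\<close>

lemma
  fixes h :: "'a::euclidean_space \<Rightarrow> complex"
  assumes U: "open U" and h: "integrable lborel (\<lambda>z. if z \<in> U then h z else 0)"
  shows integrable_lebesgue_on_open: "integrable (lebesgue_on U) h"
    and integral_lebesgue_on_open: "integral\<^sup>L (lebesgue_on U) h = integral\<^sup>L lborel (\<lambda>z. if z \<in> U then h z else 0)"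
proof -
  have eq: "(\<lambda>z. if z \<in> U then h z else 0) = (\<lambda>z. indicator U z *\<^sub>R h z)"
    by (auto simp: fun_eq_iff)
  have s: "U \<inter> space lebesgue \<in> sets lebesgue" using U by simp
  have m: "(\<lambda>z. indicator U z *\<^sub>R h z) \<in> borel_measurable lborel"
    using borel_measurable_integrable[OF h] by (simp add: eq)
  show "integrable (lebesgue_on U) h"
    using h m unfolding integrable_restrict_space[OF s] by (simp add: eq integrable_completion)
  show "integral\<^sup>L (lebesgue_on U) h = integral\<^sup>L lborel (\<lambda>z. if z \<in> U then h z else 0)"
    unfolding integral_restrict_space[OF s] eq by (rule integral_completion[OF m])
qed

lemma continuous_on_extend_by_zero:
  fixes h :: "'a::euclidean_space \<Rightarrow> complex"
  assumes "open U" "continuous_on U h" "compact K" "K \<subseteq> U" "\<And>z. z \<in> U \<Longrightarrow> z \<notin> K \<Longrightarrow> h z = 0"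
  shows "continuous_on UNIV (\<lambda>z. if z \<in> U then h z else 0)"
proof -
  have "continuous_on (U \<union> - K) (\<lambda>z. if z \<in> U then h z else 0)"
  proof (rule continuous_on_open_Un)
    show "continuous_on U (\<lambda>z. if z \<in> U then h z else 0)"
      using assms(2) by (subst continuous_on_cong[OF refl, where g = h]) auto
    show "continuous_on (- K) (\<lambda>z. if z \<in> U then h z else 0)"
      using assms(5) by (subst continuous_on_cong[OF refl, where g = "\<lambda>_. 0"]) auto
  qed (use assms compact_imp_closed in auto)
  moreover have "U \<union> - K = UNIV" using assms(4) by auto
  ultimately show ?thesis by simp
qed

text \<open>The product \<open>f z * \<phi> z\<close>, extended by 0, is differentiable everywhere
  with bounded derivative and bounded support, so its derivative integrates to 0; the product rule
  splits that integral into the two sides.\<close>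

lemma integral_wirtinger_bar_by_parts:
  assumes U: "open U" and f: "tame_on U f" and \<phi>: "\<phi> \<in> test_functions U"
  shows "integral\<^sup>L (lebesgue_on U) (\<lambda>z. wirtinger_bar k f z * \<phi> z)
       = - integral\<^sup>L (lebesgue_on U) (\<lambda>z. f z * wirtinger_bar k \<phi> z)"
proof -
  obtain K where K: "compact K" "K \<subseteq> U" "\<And>z. z \<notin> K \<Longrightarrow> \<phi> z = 0"
    "\<And>z k. z \<notin> K \<Longrightarrow> wirtinger_bar k \<phi> z = 0"
    using test_functions_support[OF \<phi>] by metis
  have s\<phi>: "smooth \<phi>" by (rule test_functions_smooth[OF \<phi>])
  define G where "G = (\<lambda>z. if z \<in> U then f z * \<phi> z else 0)"
  have f\<phi>: "tame_on U (\<lambda>z. f z * \<phi> z)"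
    by (rule tame_on_mult[OF f smooth_tame_on[OF s\<phi>]])
  have GU: "(G has_derivative frechet_derivative (\<lambda>z. f z * \<phi> z) (at z)) (at z)" if "z \<in> U" for z
    by (rule has_derivative_transform_within_open[OF tame_on_has_derivative[OF f\<phi> that] U that])
      (simp add: G_def)
  have GK: "(G has_derivative (\<lambda>v. 0)) (at z)" if "z \<notin> K" for z
    by (rule has_derivative_transform_within_open[where s = "- K" and f = "\<lambda>_. 0"])
      (use that K open_Compl[OF compact_imp_closed[OF K(1)]] in \<open>auto simp: G_def\<close>)
  have G: "(G has_derivative frechet_derivative G (at z)) (at z)" for z
  proof (cases "z \<in> U")
    case True
    then show ?thesis using GU[OF True] by (metis frechet_derivative_at)
  next
    case False
    then show ?thesis using GK[of z] K(2) by (metis frechet_derivative_at subsetD)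
  qed
  obtain C where C: "C \<ge> 0" "\<And>z v. z \<in> K \<Longrightarrow> norm (frechet_derivative (\<lambda>z. f z * \<phi> z) (at z) v) \<le> C * norm v"
    using tame_on_compact_bound[OF f\<phi> K(1,2)] by blast
  have bd: "norm (frechet_derivative G (at z) v) \<le> C * norm v" for z v
  proof (cases "z \<in> K")
    case True
    then have "z \<in> U" using K by auto
    from frechet_derivative_at[OF GU[OF this]] C(2)[OF True] show ?thesis by metis
  next
    case False
    from frechet_derivative_at[OF GK[OF this]] C(1) show ?thesis
      by (metis norm_zero mult_nonneg_nonneg norm_ge_zero)
  qed
  obtain R where R: "\<And>z. z \<in> K \<Longrightarrow> norm z \<le> R"
    using compact_imp_bounded[OF K(1)] by (auto simp: bounded_iff)
  have supp: "G z = 0" if "norm z > R" for z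
    using R[of z] K(3)[of z] that by (auto simp: G_def)
  note G0 = integrable_derivative[OF G bd supp] integral_derivative_eq_0[OF G bd supp]
  have intG: "integrable lborel (wirtinger_bar k G)" "integral\<^sup>L lborel (wirtinger_bar k G) = 0"
    unfolding wirtinger_bar_def using G0 by simp_all
  have wG: "wirtinger_bar k G z = (if z \<in> U then wirtinger_bar k f z * \<phi> z else 0)
      + (if z \<in> U then f z * wirtinger_bar k \<phi> z else 0)" for z
  proof (cases "z \<in> U")
    case True
    have "wirtinger_bar k G z = wirtinger_bar k (\<lambda>z. f z * \<phi> z) z"
      by (rule wirtinger_bar_transform[OF U True]) (simp add: G_def)
    also have "\<dots> = f z * wirtinger_bar k \<phi> z + wirtinger_bar k f z * \<phi> z"
      using differentiableI[OF tame_on_has_derivative[OF f True]]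
        differentiableI[OF smooth_has_derivative[OF s\<phi>]] by (rule wirtinger_bar_mult)
    finally show ?thesis using True by simp
  next
    case False
    then show ?thesis using wirtinger_bar_eqI[OF GK, of z k] K by auto
  qed
  have int2: "integrable lborel (\<lambda>z. if z \<in> U then f z * wirtinger_bar k \<phi> z else 0)"
  proof (rule integrable_lborel_compact_support[OF continuous_on_extend_by_zero[OF U _ K(1,2)] K(1)])
    show "continuous_on U (\<lambda>z. f z * wirtinger_bar k \<phi> z)"
      by (intro continuous_intros tame_on_continuous[OF f] smooth_continuous smooth_wirtinger_bar s\<phi>)
  qed (use K in auto)
  \<comment> \<open>Integrability of this term is read off from the product rule, as a difference of
    two integrable functions; \<open>tame_on\<close> does not speak of measurability of the
    derivative.\<close>
  have int1: "integrable lborel (\<lambda>z. if z \<in> U then wirtinger_bar k f z * \<phi> z else 0)"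
    using Bochner_Integration.integrable_diff[OF intG(1) int2] unfolding wG by simp
  have "integral\<^sup>L lborel (\<lambda>z. if z \<in> U then wirtinger_bar k f z * \<phi> z else 0)
      + integral\<^sup>L lborel (\<lambda>z. if z \<in> U then f z * wirtinger_bar k \<phi> z else 0) = 0"
    using intG(2) Bochner_Integration.integral_add[OF int1 int2] unfolding wG by simp
  then show ?thesis
    unfolding integral_lebesgue_on_open[OF U int1] integral_lebesgue_on_open[OF U int2]
    by (simp add: eq_neg_iff_add_eq_0)
qed

section \<open>Radial averaging kernels\<close>

lemma smooth_divide_power:
  fixes K :: "real \<Rightarrow> real"
  assumes "smooth K" "a > 0" "\<And>s. \<bar>s\<bar> < a \<Longrightarrow> K s = 0"
  shows "smooth (\<lambda>s. K s / s ^ m)"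
proof (induction m)
  case (Suc m)
  have "smooth (\<lambda>s. K s / s ^ m / s)"
    by (rule smooth_divide_ident[OF Suc assms(2)]) (simp add: assms(3))
  then show ?case by (simp add: mult.commute)
qed (use assms in simp)

text \<open>
  With a smooth step \<open>X\<close> equal to 1 near 0 and \<open>X_\<epsilon> s = X (s / \<epsilon>\<^sup>2)\<close>, take \<open>\<rho> \<epsilon> s = - X_\<epsilon>' s * s powr (1 - n)\<close>
  and \<open>Q = (X_\<delta> - X_\<epsilon>) / s ^ n\<close>.  The last identity makes \<open>\<rho> \<epsilon> (norm w ^ 2) - \<rho> \<delta> (norm w ^ 2)\<close> a sum of
  Wirtinger derivatives of the compactly supported functions \<open>cnj w_k * Q (norm w ^ 2)\<close>.
\<close>

definition averaging_family :: "nat \<Rightarrow> (real \<Rightarrow> real \<Rightarrow> real) \<Rightarrow> bool" where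
  "averaging_family n \<rho> \<longleftrightarrow>
    (\<forall>\<epsilon>>0. smooth (\<rho> \<epsilon>) \<and> (\<forall>s. \<rho> \<epsilon> s \<ge> 0) \<and> (\<forall>s\<ge>\<epsilon>\<^sup>2. \<rho> \<epsilon> s = 0) \<and> (\<exists>s>0. \<rho> \<epsilon> s > 0)) \<and>
    (\<forall>\<epsilon>>0. \<forall>\<delta>>0. \<exists>Q :: real \<Rightarrow> real. smooth Q \<and> (\<forall>s\<ge>(max \<epsilon> \<delta>)\<^sup>2. Q s = 0) \<and>
      (\<forall>s. \<rho> \<epsilon> s - \<rho> \<delta> s = real n * Q s + s * deriv Q s))"

lemma averaging_family_exists:
  assumes n: "n \<ge> 1"
  shows "\<exists>\<rho>. averaging_family n \<rho>"
proof -
  obtain X :: "real \<Rightarrow> real" where X: "smooth X"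
    "\<And>s. s \<le> 1/4 \<Longrightarrow> X s = 1" "\<And>s. s \<ge> 1 \<Longrightarrow> X s = 0"
    "\<And>s. deriv X s \<le> 0" "\<And>s. 1/4 < s \<Longrightarrow> s < 1 \<Longrightarrow> deriv X s < 0"
    using smooth_step_exists by metis
  define \<xi> where "\<xi> = (\<lambda>\<epsilon> s. X (s * inverse (\<epsilon>\<^sup>2)))"
  have sl: "smooth (\<lambda>s::real. s * c)" for c
    by (rule smooth_mult[OF smooth_linear[OF bounded_linear_ident] smooth_const])
  have s\<xi>: "smooth (\<xi> \<epsilon>)" for \<epsilon>
    unfolding \<xi>_def by (rule smooth_compose_real[OF X(1) sl])
  have d\<xi>: "(\<xi> \<epsilon> has_real_derivative deriv X (s * inverse (\<epsilon>\<^sup>2)) * inverse (\<epsilon>\<^sup>2)) (at s)" for \<epsilon> s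
    unfolding \<xi>_def
    by (rule DERIV_chain2[OF smooth_has_real_derivative[OF X(1)]]) (auto intro!: derivative_eq_intros)
  then have deriv\<xi>: "deriv (\<xi> \<epsilon>) s = deriv X (s * inverse (\<epsilon>\<^sup>2)) * inverse (\<epsilon>\<^sup>2)" for \<epsilon> s
    by (rule DERIV_imp_deriv)
  have X0: "deriv X s = 0" if "s < 1/4 \<or> s \<ge> 1" for s
  proof -
    have "(X has_real_derivative 0) (at s)" if "s < 1/4"
      by (rule has_field_derivative_transform_within_open[where f = "\<lambda>_. 1" and S = "{..<1/4}"])
        (use that X(2) in auto)
    moreover have z: "deriv X s = 0" if "s > 1" for s
      by (rule deriv_eq_0_beyond[OF _ that]) (simp add: X(3))
    \<comment> \<open>The endpoint 1 is not interior to the zero set of \<open>X\<close>; continuity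
      of the derivative and its vanishing to the right settle it.\<close>
    moreover have "deriv X 1 = 0"
    proof (rule tendsto_unique[of "at_right (1::real)"])
      have "isCont (deriv X) 1"
        using smooth_continuous[OF smooth_deriv[OF X(1)], of UNIV] by (simp add: continuous_on_eq_continuous_at)
      then show "(deriv X \<longlongrightarrow> deriv X 1) (at_right 1)"
        by (simp add: isCont_def filterlim_at_split)
      show "(deriv X \<longlongrightarrow> 0) (at_right 1)"
        by (rule tendsto_eventually) (auto simp: eventually_at_right_field z intro!: exI[of _ 2])
    qed simp
    ultimately show ?thesis
      using that DERIV_imp_deriv[of X 0 s] by (cases "s = 1") auto
  qed
  \<comment> \<open>\<open>s / s ^ n\<close> stands for s to the power 1 - n. The derivative of the
    cutoff vanishes near 0, so the singularity is never seen.\<close>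
  define \<rho> where "\<rho> = (\<lambda>\<epsilon> s. - deriv (\<xi> \<epsilon>) s * s / s ^ n)"
  have "smooth (\<rho> \<epsilon>) \<and> (\<forall>s. \<rho> \<epsilon> s \<ge> 0) \<and> (\<forall>s\<ge>\<epsilon>\<^sup>2. \<rho> \<epsilon> s = 0) \<and> (\<exists>s>0. \<rho> \<epsilon> s > 0)" if e: "\<epsilon> > 0" for \<epsilon>
  proof (intro conjI allI impI)
    have z: "deriv (\<xi> \<epsilon>) s = 0" if "s < \<epsilon>\<^sup>2 / 4 \<or> s \<ge> \<epsilon>\<^sup>2" for s
      unfolding deriv\<xi> using that e by (auto intro!: X0 simp: divide_simps)
    have "smooth (\<lambda>s. (- deriv (\<xi> \<epsilon>) s * s) / s ^ n)"
    proof (rule smooth_divide_power)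
      show "smooth (\<lambda>s. - deriv (\<xi> \<epsilon>) s * s)"
        by (intro smooth_mult smooth_minus smooth_deriv s\<xi> smooth_linear[OF bounded_linear_ident])
      show "- deriv (\<xi> \<epsilon>) s * s = 0" if "\<bar>s\<bar> < \<epsilon>\<^sup>2 / 4" for s
      proof -
        have "s < \<epsilon>\<^sup>2 / 4" using that by linarith
        then show ?thesis using z[of s] by simp
      qed
    qed (use e in simp)
    then show "smooth (\<rho> \<epsilon>)" by (simp add: \<rho>_def)
    show "\<rho> \<epsilon> s \<ge> 0" for s
    proof (cases "s \<ge> 0")
      case True
      have "- deriv (\<xi> \<epsilon>) s \<ge> 0"
        unfolding deriv\<xi> using X(4) by (simp add: mult_nonpos_nonneg)
      then show ?thesis
        unfolding \<rho>_def using True by (intro divide_nonneg_nonneg mult_nonneg_nonneg) auto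
    next
      case False
      moreover have "0 < \<epsilon>\<^sup>2 / 4" using e by simp
      ultimately have "s < \<epsilon>\<^sup>2 / 4" by linarith
      then show ?thesis using z[of s] by (simp add: \<rho>_def)
    qed
    show "\<rho> \<epsilon> s = 0" if "s \<ge> \<epsilon>\<^sup>2" for s
      using z[of s] that by (simp add: \<rho>_def)
    have "deriv (\<xi> \<epsilon>) (\<epsilon>\<^sup>2 / 2) < 0"
      unfolding deriv\<xi> using X(5)[of "1/2"] e by (simp add: mult_neg_pos)
    then have "\<rho> \<epsilon> (\<epsilon>\<^sup>2 / 2) > 0"
      unfolding \<rho>_def using e by (intro divide_pos_pos mult_pos_pos) auto
    then show "\<exists>s>0. \<rho> \<epsilon> s > 0" using e by (intro exI[of _ "\<epsilon>\<^sup>2 / 2"]) simp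
  qed
  moreover have "\<exists>Q :: real \<Rightarrow> real. smooth Q \<and> (\<forall>s\<ge>(max \<epsilon> \<delta>)\<^sup>2. Q s = 0) \<and>
      (\<forall>s. \<rho> \<epsilon> s - \<rho> \<delta> s = real n * Q s + s * deriv Q s)" if e: "\<epsilon> > 0" "\<delta> > 0" for \<epsilon> \<delta>
  proof (intro exI conjI allI impI)
    \<comment> \<open>With Q = P / s^n, the terms containing P itself cancel in n Q + s Q', leaving
      s P' / s^n, which is the difference of the two kernels.\<close>
    define P where "P = (\<lambda>s. \<xi> \<delta> s - \<xi> \<epsilon> s)"
    let ?Q = "\<lambda>s. P s / s ^ n"
    define a where "a = (min \<epsilon> \<delta>)\<^sup>2 / 4"
    have a: "a > 0" using e by (simp add: a_def)
    have sq: "(min \<epsilon> \<delta>)\<^sup>2 \<le> \<epsilon>\<^sup>2" "(min \<epsilon> \<delta>)\<^sup>2 \<le> \<delta>\<^sup>2" "\<epsilon>\<^sup>2 \<le> (max \<epsilon> \<delta>)\<^sup>2" "\<delta>\<^sup>2 \<le> (max \<epsilon> \<delta>)\<^sup>2"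
      using e by (auto intro!: power_mono)
    have P0: "P s = 0" if "\<bar>s\<bar> < a" for s
    proof -
      have "s * inverse (\<epsilon>\<^sup>2) \<le> 1/4" "s * inverse (\<delta>\<^sup>2) \<le> 1/4"
      proof -
        have "4 * s \<le> \<epsilon>\<^sup>2" "4 * s \<le> \<delta>\<^sup>2"
          using that sq(1,2) unfolding a_def by linarith+
        then show "s * inverse (\<epsilon>\<^sup>2) \<le> 1/4" "s * inverse (\<delta>\<^sup>2) \<le> 1/4"
          using e by (auto simp: field_simps)
      qed
      then show ?thesis by (simp add: P_def \<xi>_def X(2))
    qed
    show sQ: "smooth ?Q"
      by (rule smooth_divide_power[OF _ a P0]) (auto simp: P_def intro: smooth_diff s\<xi>)
    show "?Q s = 0" if "s \<ge> (max \<epsilon> \<delta>)\<^sup>2" for s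
    proof -
      have "s * inverse (\<epsilon>\<^sup>2) \<ge> 1" "s * inverse (\<delta>\<^sup>2) \<ge> 1"
      proof -
        have "\<epsilon>\<^sup>2 \<le> s" "\<delta>\<^sup>2 \<le> s" using that sq(3,4) by linarith+
        then show "s * inverse (\<epsilon>\<^sup>2) \<ge> 1" "s * inverse (\<delta>\<^sup>2) \<ge> 1"
          using e by (auto simp: field_simps)
      qed
      then show ?thesis by (simp add: P_def \<xi>_def X(3))
    qed
    show "\<rho> \<epsilon> s - \<rho> \<delta> s = n * ?Q s + s * deriv ?Q s" for s
    proof (cases "s = 0")
      case True
      then show ?thesis using n by (simp add: \<rho>_def)
    next
      case False
      have dP: "(P has_real_derivative (deriv (\<xi> \<delta>) s - deriv (\<xi> \<epsilon>) s)) (at s)"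
        unfolding P_def using d\<xi> deriv\<xi> by (intro DERIV_diff) simp_all
      have dp: "((\<lambda>s. s ^ n) has_real_derivative n * s ^ n / s) (at s)"
        using False n DERIV_pow[of n s UNIV] by (cases n) simp_all
      have "(?Q has_real_derivative ((deriv (\<xi> \<delta>) s - deriv (\<xi> \<epsilon>) s) * s ^ n - P s * (n * s ^ n / s)) / (s ^ n * s ^ n)) (at s)"
        by (rule DERIV_divide[OF dP dp]) (use False in simp)
      then have "deriv ?Q s = ((deriv (\<xi> \<delta>) s - deriv (\<xi> \<epsilon>) s) * s ^ n - P s * (n * s ^ n / s)) / (s ^ n * s ^ n)"
        by (rule DERIV_imp_deriv)
      also have "\<dots> = (deriv (\<xi> \<delta>) s - deriv (\<xi> \<epsilon>) s) / s ^ n - n * P s / (s * s ^ n)"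
        using False by (simp add: divide_simps) (simp add: algebra_simps)
      finally show ?thesis
        using False by (simp add: \<rho>_def divide_simps) (simp add: algebra_simps)
    qed
  qed
  ultimately show ?thesis
    unfolding averaging_family_def by (intro exI[of _ \<rho>]) simp
qed

section \<open>Averages of weakly holomorphic functions\<close>

definition weakly_holomorphic_on :: "(complex ^ 'n \<Rightarrow> complex) \<Rightarrow> (complex ^ 'n) set \<Rightarrow> bool" where
  "weakly_holomorphic_on f U \<longleftrightarrow>
    (\<forall>k. \<forall>\<phi>\<in>test_functions U. integral\<^sup>L (lebesgue_on U) (\<lambda>z. f z * wirtinger_bar k \<phi> z) = 0)"

lemma integrable_continuous_compact_support:
  fixes \<psi> :: "'a::euclidean_space \<Rightarrow> complex"
  assumes "open U" "continuous_on UNIV \<psi>" "compact K" "K \<subseteq> U" "\<And>z. z \<notin> K \<Longrightarrow> \<psi> z = 0"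
  shows "integrable (lebesgue_on U) \<psi>"
proof (rule integrable_lebesgue_on_open[OF assms(1)])
  have "(\<lambda>z. if z \<in> U then \<psi> z else 0) = \<psi>"
    using assms(4,5) by (auto simp: fun_eq_iff)
  then show "integrable lborel (\<lambda>z. if z \<in> U then \<psi> z else 0)"
    using integrable_lborel_compact_support[OF assms(2,3,5)] by simp
qed

lemma integrable_L_infty_mult:
  assumes f: "f \<in> L_infty U" and \<psi>: "integrable (lebesgue_on U) \<psi>"
  shows "integrable (lebesgue_on U) (\<lambda>z. f z * \<psi> z)"
proof -
  obtain C where C: "AE z in lebesgue_on U. norm (f z) \<le> C" and m: "f \<in> borel_measurable (lebesgue_on U)"
    using f by (auto simp: L_infty_def)
  show ?thesis
  proof (rule Bochner_Integration.integrable_bound[where f = "\<lambda>z. C * norm (\<psi> z)"])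
    show "AE z in lebesgue_on U. norm (f z * \<psi> z) \<le> norm (C * norm (\<psi> z))"
      using C
    proof eventually_elim
      case (elim z)
      then have "norm (f z) * norm (\<psi> z) \<le> C * norm (\<psi> z)" by (rule mult_right_mono) simp
      then show ?case by (simp add: norm_mult)
    qed
  qed (use \<psi> m in \<open>auto intro!: borel_measurable_times\<close>)
qed

lemma radial_commute: "radial K a z = radial K z a"
  by (simp add: radial_def norm_minus_commute)

lemma radial_eq_0:
  assumes "\<And>s. s \<ge> r\<^sup>2 \<Longrightarrow> K s = 0" "r > 0" "z \<notin> cball a r"
  shows "radial K a z = 0"
proof -
  have "r \<le> norm (z - a)" using assms(3) by (simp add: dist_norm norm_minus_commute)
  then have "r\<^sup>2 \<le> (norm (z - a))\<^sup>2" using assms(2) by (intro power_mono) auto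
  then show ?thesis using assms(1) by (simp add: radial_def)
qed

lemma norm_sq_coordinates: "complex_of_real ((norm (z :: complex ^ 'n))\<^sup>2) = (\<Sum>k\<in>UNIV. z $ k * cnj (z $ k))"
  by (simp add: norm_vec_def L2_set_def sum_nonneg complex_norm_square[symmetric])

text \<open>The identity for \<open>Q\<close>, with s the squared distance, writes the difference of
  the kernels centred at \<open>z\<close> as the sum over k of the Wirtinger derivatives of
  \<open>\<phi> k\<close>. Each \<open>\<phi> k\<close> is a test function, since the larger of the
  two balls lies in \<open>U\<close>, and weak holomorphy annihilates the sum.\<close>

lemma integral_averaging_family_eq:
  fixes f :: "complex ^ 'n \<Rightarrow> complex"
  assumes \<rho>: "averaging_family CARD('n) \<rho>"
    and U: "open U" and f: "f \<in> L_infty U" "weakly_holomorphic_on f U"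
    and e: "\<epsilon> > 0" "\<delta> > 0" "cball z \<epsilon> \<subseteq> U" "cball z \<delta> \<subseteq> U"
  shows "integral\<^sup>L (lebesgue_on U) (\<lambda>w. f w * radial (\<rho> \<epsilon>) z w)
       = integral\<^sup>L (lebesgue_on U) (\<lambda>w. f w * radial (\<rho> \<delta>) z w)"
proof -
  obtain Q :: "real \<Rightarrow> real" where Q: "smooth Q" "\<And>s. s \<ge> (max \<epsilon> \<delta>)\<^sup>2 \<Longrightarrow> Q s = 0"
    "\<And>s. \<rho> \<epsilon> s - \<rho> \<delta> s = real CARD('n) * Q s + s * deriv Q s"
    using \<rho> e unfolding averaging_family_def by blast
  have \<rho>': "smooth (\<rho> \<epsilon>)" "smooth (\<rho> \<delta>)" "\<And>s. s \<ge> \<epsilon>\<^sup>2 \<Longrightarrow> \<rho> \<epsilon> s = 0" "\<And>s. s \<ge> \<delta>\<^sup>2 \<Longrightarrow> \<rho> \<delta> s = 0"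
    using \<rho> e unfolding averaging_family_def by blast+
  define \<phi> where "\<phi> = (\<lambda>k w. cnj (w $ k - z $ k) * radial Q z w)"
  have "cball z (max \<epsilon> \<delta>) \<subseteq> U" using e by (auto simp: max_def)
  moreover have "radial Q z w = 0" if "w \<notin> cball z (max \<epsilon> \<delta>)" for w
    by (rule radial_eq_0[where r = "max \<epsilon> \<delta>"]) (use Q(2) e that in auto)
  ultimately have \<phi>: "\<phi> k \<in> test_functions U" for k
    unfolding \<phi>_def
    by (intro test_functionsI[where K = "cball z (max \<epsilon> \<delta>)"] smooth_mult smooth_cnj_coordinate
        smooth_radial Q(1)) simp_all
  have diff: "(\<lambda>w. cnj (w $ k - z $ k)) differentiable (at w)" "radial Q z differentiable (at w)" for k w
    by (rule differentiableI, rule has_derivative_cnj_coordinate)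
      (rule differentiableI, rule has_derivative_radial[OF Q(1)])
  have wirt: "wirtinger_bar k (\<phi> k) w = cnj (w $ k - z $ k) * ((w $ k - z $ k) * radial (deriv Q) z w) + radial Q z w" for k w
    unfolding \<phi>_def
    by (simp only: wirtinger_bar_mult[OF diff] wirtinger_bar_radial[OF Q(1)] wirtinger_bar_cnj_coordinate)
      simp
  have sum: "radial (\<rho> \<epsilon>) z w - radial (\<rho> \<delta>) z w = (\<Sum>k\<in>UNIV. wirtinger_bar k (\<phi> k) w)" for w
  proof -
    have "(\<Sum>k\<in>UNIV. wirtinger_bar k (\<phi> k) w) = of_nat CARD('n) * radial Q z w
        + (\<Sum>k\<in>UNIV. (w - z) $ k * cnj ((w - z) $ k)) * radial (deriv Q) z w"
      by (simp add: wirt sum.distrib sum_distrib_left mult_ac)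
    then show ?thesis
      unfolding norm_sq_coordinates[symmetric] radial_def of_real_diff[symmetric] Q(3)
      by simp
  qed
  have int\<rho>: "integrable (lebesgue_on U) (\<lambda>w. f w * radial (\<rho> \<epsilon>) z w)"
    "integrable (lebesgue_on U) (\<lambda>w. f w * radial (\<rho> \<delta>) z w)"
    by (rule integrable_L_infty_mult[OF f(1)],
        rule integrable_continuous_compact_support[OF U smooth_continuous[OF smooth_radial] compact_cball];
        use \<rho>' e radial_eq_0 in blast)+
  have int: "integrable (lebesgue_on U) (\<lambda>w. f w * wirtinger_bar k (\<phi> k) w)" for k
  proof (rule integrable_L_infty_mult[OF f(1)])
    obtain K where K: "compact K" "K \<subseteq> U" "\<And>w. w \<notin> K \<Longrightarrow> wirtinger_bar k (\<phi> k) w = 0"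
      using test_functions_support[OF \<phi>] by metis
    show "integrable (lebesgue_on U) (wirtinger_bar k (\<phi> k))"
      by (rule integrable_continuous_compact_support[OF U
            smooth_continuous[OF smooth_wirtinger_bar[OF test_functions_smooth[OF \<phi>]]] K])
  qed
  have "integral\<^sup>L (lebesgue_on U) (\<lambda>w. f w * radial (\<rho> \<epsilon>) z w) - integral\<^sup>L (lebesgue_on U) (\<lambda>w. f w * radial (\<rho> \<delta>) z w)
      = integral\<^sup>L (lebesgue_on U) (\<lambda>w. \<Sum>k\<in>UNIV. f w * wirtinger_bar k (\<phi> k) w)"
    unfolding Bochner_Integration.integral_diff[OF int\<rho>, symmetric] right_diff_distrib[symmetric] sum sum_distrib_left ..
  also have "\<dots> = (\<Sum>k\<in>UNIV. integral\<^sup>L (lebesgue_on U) (\<lambda>w. f w * wirtinger_bar k (\<phi> k) w))"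
    using int by (intro Bochner_Integration.integral_sum) auto
  also have "\<dots> = 0"
    using f(2) \<phi> by (simp add: weakly_holomorphic_on_def)
  finally show ?thesis by simp
qed

section \<open>Weyl's lemma for bounded functions\<close>

lemma averaging_familyD:
  assumes "averaging_family n \<rho>" "\<epsilon> > 0"
  shows "smooth (\<rho> \<epsilon>)" "\<rho> \<epsilon> s \<ge> 0" "s \<ge> \<epsilon>\<^sup>2 \<Longrightarrow> \<rho> \<epsilon> s = 0" "\<exists>s>0. \<rho> \<epsilon> s > 0"
  using assms unfolding averaging_family_def by blast+

lemma radial_averaging_eq_0:
  assumes "averaging_family n \<rho>" "\<epsilon> > 0" "w \<notin> cball z \<epsilon>"
  shows "radial (\<rho> \<epsilon>) z w = 0"
  by (rule radial_eq_0[where r = \<epsilon>]) (use assms averaging_familyD(3)[OF assms(1,2)] in auto)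

lemma integrable_radial_averaging:
  assumes "averaging_family n \<rho>" "\<epsilon> > 0" "open U" "cball z \<epsilon> \<subseteq> U"
  shows "integrable (lebesgue_on U) (radial (\<rho> \<epsilon>) z)"
  by (rule integrable_continuous_compact_support[OF assms(3)
        smooth_continuous[OF smooth_radial[OF averaging_familyD(1)[OF assms(1,2)]]]
        compact_cball assms(4) radial_averaging_eq_0[OF assms(1,2)]])

lemma const_L_infty: "(\<lambda>z. c) \<in> L_infty U"
  by (auto simp: L_infty_def)

lemma holomorphic_weakly_holomorphic:
  assumes "open U" "holomorphic_several_on f U"
  shows "weakly_holomorphic_on f U"
  unfolding weakly_holomorphic_on_def
proof (intro allI ballI)
  fix k \<phi> assume \<phi>: "\<phi> \<in> test_functions U"
  have "integral\<^sup>L (lebesgue_on U) (\<lambda>z. wirtinger_bar k f z * \<phi> z) = integral\<^sup>L (lebesgue_on U) (\<lambda>z. 0)"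
    by (rule Bochner_Integration.integral_cong) (auto simp: wirtinger_bar_holomorphic[OF assms(2)])
  then show "integral\<^sup>L (lebesgue_on U) (\<lambda>z. f z * wirtinger_bar k \<phi> z) = 0"
    using integral_wirtinger_bar_by_parts[OF assms(1) holomorphic_tame_on[OF assms(2,1)] \<phi>, of k] by simp
qed

definition averaging_mass :: "'n::finite itself \<Rightarrow> (real \<Rightarrow> real \<Rightarrow> real) \<Rightarrow> real" where
  "averaging_mass T \<rho> = integral\<^sup>L lborel (\<lambda>w :: complex ^ 'n. \<rho> 1 ((norm w)\<^sup>2))"

text \<open>If a continuous nonnegative kernel had integral 0, the open set where it is positive
  would be null and hence empty.\<close>

lemma averaging_mass_pos:
  assumes \<rho>: "averaging_family CARD('n) \<rho>"
  shows "averaging_mass TYPE('n::finite) \<rho> > 0"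
proof -
  define f where "f = (\<lambda>w :: complex ^ 'n. \<rho> 1 ((norm w)\<^sup>2))"
  note \<rho>' = averaging_familyD[OF \<rho>, of 1, simplified]
  have nn: "f w \<ge> 0" for w by (simp add: f_def \<rho>')
  have cont: "continuous_on UNIV f"
    using smooth_continuous[OF smooth_compose_real[OF \<rho>'(1) smooth_norm_sq[of 0]], of UNIV]
    by (simp add: f_def)
  have supp: "f w = 0" if "w \<notin> cball 0 1" for w
    using that \<rho>'(3)[of "(norm w)\<^sup>2"] by (simp add: f_def)
  have int: "integrable lborel f"
    by (rule integrable_lborel_compact_support[OF cont compact_cball supp])
  have "integral\<^sup>L lborel f \<noteq> 0"
  proof
    assume "integral\<^sup>L lborel f = 0"
    then have "AE w in lborel. f w = 0"
      using integral_nonneg_eq_0_iff_AE[OF int] nn by simp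
    then have "AE w in lborel. w \<notin> {w. f w > 0}"
      by eventually_elim simp
    moreover have op: "open {w. f w > 0}"
      using open_Collect_less[OF continuous_on_const cont] by simp
    ultimately have "{w. f w > 0} \<in> null_sets lborel"
      by (subst AE_iff_null_sets) auto
    then have "negligible {w. f w > 0}"
      unfolding negligible_iff_null_sets by (rule null_sets_completionI)
    then have "{w. f w > 0} = {}"
      using open_not_negligible[OF op] by blast
    moreover obtain s where s: "s > 0" "\<rho> 1 s > 0" using \<rho>'(4) by blast
    moreover obtain w :: "complex ^ 'n" where "norm w = sqrt s"
      using vector_choose_size[of "sqrt s"] s by auto
    ultimately have "f w > 0" by (simp add: f_def)
    with \<open>{w. f w > 0} = {}\<close> show False by blast
  qed
  moreover have "integral\<^sup>L lborel f \<ge> 0" by (rule integral_nonneg_AE) (simp add: nn)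
  ultimately show ?thesis by (simp add: averaging_mass_def f_def)
qed

text \<open>Constants are weakly holomorphic, so independence of the radius, applied to the function
  1, gives every kernel the mass at radius 1. The comparison is made on the whole space because a
  ball of radius 1 need not fit into \<open>U\<close>.\<close>

lemma integral_radial_averaging:
  fixes z :: "complex ^ 'n"
  assumes \<rho>: "averaging_family CARD('n) \<rho>" and e: "\<epsilon> > 0" and U: "open U" "cball z \<epsilon> \<subseteq> U"
  shows "integral\<^sup>L (lebesgue_on U) (radial (\<rho> \<epsilon>) z) = complex_of_real (averaging_mass TYPE('n) \<rho>)"
proof -
  have lb: "integral\<^sup>L (lebesgue_on V) (radial (\<rho> \<delta>) z) = integral\<^sup>L lborel (radial (\<rho> \<delta>) z)"
    if "open V" "cball z \<delta> \<subseteq> V" "\<delta> > 0" for V \<delta>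
  proof -
    have eq: "(\<lambda>w. if w \<in> V then radial (\<rho> \<delta>) z w else 0) = radial (\<rho> \<delta>) z"
    proof
      show "(if w \<in> V then radial (\<rho> \<delta>) z w else 0) = radial (\<rho> \<delta>) z w" for w
      proof (cases "w \<in> V")
        case False
        then have "w \<notin> cball z \<delta>" using that(2) by blast
        then have "radial (\<rho> \<delta>) z w = 0" by (rule radial_averaging_eq_0[OF \<rho> that(3)])
        then show ?thesis by simp
      qed simp
    qed
    have "integrable lborel (radial (\<rho> \<delta>) z)"
      by (rule integrable_lborel_compact_support[OF smooth_continuous[OF smooth_radial[OF averaging_familyD(1)[OF \<rho> that(3)]]]
            compact_cball radial_averaging_eq_0[OF \<rho> that(3)]])
    then show ?thesis
      using integral_lebesgue_on_open[OF that(1), of "radial (\<rho> \<delta>) z"] unfolding eq by simp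
  qed
  have "integral\<^sup>L (lebesgue_on U) (radial (\<rho> \<epsilon>) z) = integral\<^sup>L (lebesgue_on UNIV) (\<lambda>w. 1 * radial (\<rho> \<epsilon>) z w)"
    using lb[OF U e] lb[OF open_UNIV _ e] by simp
  also have "\<dots> = integral\<^sup>L (lebesgue_on UNIV) (\<lambda>w. 1 * radial (\<rho> 1) z w)"
    by (rule integral_averaging_family_eq[OF \<rho> open_UNIV const_L_infty
          holomorphic_weakly_holomorphic[OF open_UNIV holomorphic_const] e]) auto
  also have "\<dots> = integral\<^sup>L lborel (radial (\<rho> 1) z)"
    using lb[OF open_UNIV _ zero_less_one] by simp
  also have "\<dots> = integral\<^sup>L lborel (\<lambda>w. radial (\<rho> 1) z (z + w))"
    by (rule lborel_integral_translate[symmetric] borel_measurable_continuous_onI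
        smooth_continuous smooth_radial averaging_familyD(1)[OF \<rho>] zero_less_one)+
  also have "\<dots> = complex_of_real (averaging_mass TYPE('n) \<rho>)"
    by (simp add: averaging_mass_def radial_def)
  finally show ?thesis .
qed

text \<open>Turns the Cauchy-Riemann equations in the separate coordinates into complex linearity of
  the total derivative.\<close>

lemma complex_linear_iff_axis:
  fixes L :: "complex ^ 'n \<Rightarrow> complex"
  assumes L: "linear L" and ax: "\<And>k. L (axis k \<i>) = \<i> * L (axis k 1)"
  shows "L (c *s v) = c * L v"
proof -
  have axis: "L (axis k a) = a * L (axis k 1)" for k a
  proof -
    have "axis k a = Re a *\<^sub>R axis k 1 + Im a *\<^sub>R (axis k \<i> :: complex ^ 'n)"
      by (simp add: vec_eq_iff axis_def complex_eq_iff)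
    then have "L (axis k a) = Re a *\<^sub>R L (axis k 1) + Im a *\<^sub>R (\<i> * L (axis k 1))"
      by (simp only: linear_add[OF L] linear_scale[OF L] ax)
    also have "\<dots> = a * L (axis k 1)"
      by (simp add: complex_eq_iff algebra_simps)
    finally show ?thesis .
  qed
  have "(\<Sum>k\<in>UNIV. axis k (v $ k)) = v" for v :: "complex ^ 'n"
  proof -
    have "(\<Sum>k\<in>UNIV. axis k (v $ k)) $ i = (\<Sum>k\<in>UNIV. if i = k then v $ k else 0)" for i
      unfolding sum_component by (rule sum.cong) (auto simp: axis_def)
    then show ?thesis by (simp add: vec_eq_iff)
  qed
  then have "L v = L (\<Sum>k\<in>UNIV. axis k (v $ k))" for v by simp
  then have eq: "L v = (\<Sum>k\<in>UNIV. v $ k * L (axis k 1))" for v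
    unfolding linear_sum[OF L] sum.cong[OF refl axis] .
  show ?thesis
    unfolding eq[of "c *s v"] eq[of v] by (simp add: sum_distrib_left mult_ac)
qed

text \<open>The derivative depends on \<open>z - a\<close> only and vanishes beyond distance
  \<epsilon>, so one bound serves all centres. It provides the dominating function when an average
  is differentiated in its centre.\<close>

lemma radial_derivative_bound:
  assumes K: "smooth K" and e: "\<epsilon> > 0" and supp: "\<And>s. s \<ge> \<epsilon>\<^sup>2 \<Longrightarrow> K s = 0"
  obtains B where "\<And>a z v :: complex ^ 'n. norm (frechet_derivative (radial K a) (at z) v) \<le> B * norm v"
proof -
  have "continuous_on {0..\<epsilon>\<^sup>2} (deriv K)" by (rule smooth_continuous[OF smooth_deriv[OF K]])
  then have "bounded (deriv K ` {0..\<epsilon>\<^sup>2})"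
    by (rule compact_imp_bounded[OF compact_continuous_image[OF _ compact_Icc]])
  then obtain B0 where B0: "\<And>s. s \<in> {0..\<epsilon>\<^sup>2} \<Longrightarrow> norm (deriv K s) \<le> B0"
    unfolding bounded_iff by blast
  have B0': "B0 \<ge> 0" using B0[of 0] norm_ge_zero order_trans by fastforce
  have z: "deriv K s = 0" if "s > \<epsilon>\<^sup>2" for s
    by (rule deriv_eq_0_beyond[OF _ that]) (simp add: supp)
  have "norm (frechet_derivative (radial K a) (at z) v) \<le> (B0 * (2 * \<epsilon>)) * norm v" for a z v :: "complex ^ 'n"
  proof -
    have fd: "frechet_derivative (radial K a) (at z) v = complex_of_real (deriv K ((norm (z - a))\<^sup>2) * (2 * ((z - a) \<bullet> v)))"
      using fun_cong[OF frechet_derivative_at[OF has_derivative_radial[OF K, of a z]], of v] by simp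
    show ?thesis
    proof (cases "norm (z - a) \<le> \<epsilon>")
      case True
      have "\<bar>deriv K ((norm (z - a))\<^sup>2)\<bar> \<le> B0"
        using B0[of "(norm (z - a))\<^sup>2"] True power_mono[OF True, of 2] by simp
      moreover have "\<bar>2 * ((z - a) \<bullet> v)\<bar> \<le> 2 * \<epsilon> * norm v"
        using Cauchy_Schwarz_ineq2[of "z - a" v] mult_right_mono[OF True norm_ge_zero[of v]] by simp
      ultimately have "\<bar>deriv K ((norm (z - a))\<^sup>2)\<bar> * \<bar>2 * ((z - a) \<bullet> v)\<bar> \<le> B0 * (2 * \<epsilon> * norm v)"
        using B0' by (intro mult_mono) auto
      then show ?thesis by (simp add: fd abs_mult norm_mult mult_ac)
    next
      case False
      then have "(norm (z - a))\<^sup>2 > \<epsilon>\<^sup>2" using e by (intro power_strict_mono) auto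
      then show ?thesis using z B0' e by (simp add: fd)
    qed
  qed
  then show thesis by (rule that)
qed

text \<open>\<open>F\<close> is the normalised average as a function of its centre. Moving the
  centre is opposite to moving the integration variable, so a Wirtinger derivative of
  \<open>F\<close> is an integral of \<open>f\<close> against that of a test function and vanishes.
  Boundedness follows since the kernels are nonnegative with fixed mass.\<close>

lemma weakly_holomorphic_representative:
  fixes f :: "complex ^ 'n \<Rightarrow> complex"
  assumes \<rho>: "averaging_family CARD('n) \<rho>"
    and U: "open U" "bounded U" and f: "f \<in> L_infty U" "weakly_holomorphic_on f U"
  shows "\<exists>F\<in>H_infty U. \<forall>z \<epsilon>. \<epsilon> > 0 \<longrightarrow> cball z \<epsilon> \<subseteq> U \<longrightarrow>
    integral\<^sup>L (lebesgue_on U) (\<lambda>w. f w * radial (\<rho> \<epsilon>) z w) = complex_of_real (averaging_mass TYPE('n) \<rho>) * F z"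
proof -
  define c where "c = averaging_mass TYPE('n) \<rho>"
  have c: "c > 0" unfolding c_def by (rule averaging_mass_pos[OF \<rho>])
  obtain C0 where C0: "AE z in lebesgue_on U. norm (f z) \<le> C0" and m: "f \<in> borel_measurable (lebesgue_on U)"
    using f(1) by (auto simp: L_infty_def)
  define C where "C = max C0 0"
  have C: "AE z in lebesgue_on U. norm (f z) \<le> C" "C \<ge> 0" using C0 by (auto simp: C_def elim: eventually_mono)
  have one: "integrable (lebesgue_on U) (\<lambda>w. 1 :: complex)"
  proof -
    have "U \<in> lmeasurable" using U by (simp add: bounded_set_imp_lmeasurable)
    then show ?thesis
      by (rule finite_measure.integrable_const[OF finite_measure_lebesgue_on])
  qed
  have intf: "integrable (lebesgue_on U) f"
    using integrable_L_infty_mult[OF f(1) one] by simp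
  \<comment> \<open>The radius may vary with z without any regularity, since the average does not
    depend on it.\<close>
  define r where "r = (\<lambda>z. SOME r. r > 0 \<and> cball z r \<subseteq> U)"
  have r: "r z > 0" "cball z (r z) \<subseteq> U" if "z \<in> U" for z
    using someI_ex[of "\<lambda>r. r > 0 \<and> cball z r \<subseteq> U"] U(1) that
    unfolding r_def open_contains_cball by blast+
  define F where "F = (\<lambda>z. integral\<^sup>L (lebesgue_on U) (\<lambda>w. f w * radial (\<rho> (r z)) z w) / c)"
  have rep: "integral\<^sup>L (lebesgue_on U) (\<lambda>w. f w * radial (\<rho> \<epsilon>) z w) = c * F z"
    if "\<epsilon> > 0" "cball z \<epsilon> \<subseteq> U" for z \<epsilon>
  proof -
    have "z \<in> U" using that by auto
    then show ?thesis
      using integral_averaging_family_eq[OF \<rho> U(1) f that(1) r(1) that(2) r(2)] c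
      by (simp add: F_def)
  qed
  have "holomorphic_several_on F U"
    unfolding holomorphic_several_on_def
  proof
    fix z0 assume z0: "z0 \<in> U"
    \<comment> \<open>Half the radius at \<open>z0\<close> is admissible for all centres in
      \<open>ball z0 \<epsilon>\<close>, so near \<open>z0\<close> the function \<open>F\<close> is
      an average with a fixed kernel and can be differentiated under the integral.\<close>
    define \<epsilon> where "\<epsilon> = r z0 / 2"
    have e: "\<epsilon> > 0" using r(1)[OF z0] by (simp add: \<epsilon>_def)
    have sub: "cball z \<epsilon> \<subseteq> U" if "z \<in> ball z0 \<epsilon>" for z
      using cball_subset_cball_double[OF that] r(2)[OF z0] by (simp add: \<epsilon>_def)
    note \<rho>e = averaging_familyD[OF \<rho> e]
    obtain B where B: "\<And>a z v :: complex ^ 'n. norm (frechet_derivative (radial (\<rho> \<epsilon>) a) (at z) v) \<le> B * norm v"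
      using radial_derivative_bound[OF \<rho>e(1) e \<rho>e(3)] by blast
    define L where "L = (\<lambda>v. integral\<^sup>L (lebesgue_on U) (\<lambda>w. f w * frechet_derivative (radial (\<rho> \<epsilon>) w) (at z0) v))"
    have meas: "(\<lambda>w. f w * radial (\<rho> \<epsilon>) w z) \<in> borel_measurable (lebesgue_on U)" if "z \<in> ball z0 \<epsilon>" for z
      using integrable_L_infty_mult[OF f(1) integrable_radial_averaging[OF \<rho> e U(1) sub[OF that]]]
      by (simp add: radial_commute borel_measurable_integrable)
    have der: "((\<lambda>z. f w * radial (\<rho> \<epsilon>) w z) has_derivative (\<lambda>v. f w * frechet_derivative (radial (\<rho> \<epsilon>) w) (at z) v)) (at z)" for w z
      by (intro has_derivative_mult_right smooth_has_derivative smooth_radial \<rho>e(1))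
    have bd: "norm (f w * frechet_derivative (radial (\<rho> \<epsilon>) w) (at z) v) \<le> (norm (f w) * B) * norm v" for w z v
      using mult_left_mono[OF B[of w z v] norm_ge_zero[of "f w"]] by (simp add: norm_mult mult_ac)
    have G: "integrable (lebesgue_on U) (\<lambda>w. norm (f w) * B)"
      using intf by simp
    have int0: "integrable (lebesgue_on U) (\<lambda>w. f w * radial (\<rho> \<epsilon>) w z0)"
      using integrable_L_infty_mult[OF f(1) integrable_radial_averaging[OF \<rho> e U(1) sub[of z0]]] e
      by (simp add: radial_commute[of _ _ z0])
    note * = has_derivative_parameter_integral[OF e meas der bd G int0]
      and intL = integrable_parameter_derivative[OF e meas der bd G int0]
    have dL: "((\<lambda>z. integral\<^sup>L (lebesgue_on U) (\<lambda>w. f w * radial (\<rho> \<epsilon>) w z)) has_derivative L) (at z0)"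
      unfolding L_def by (rule *)
    have "L (axis k \<i>) = \<i> * L (axis k 1)" for k
    proof -
      have "(L (axis k 1) + \<i> * L (axis k \<i>)) / 2 = integral\<^sup>L (lebesgue_on U) (\<lambda>w. f w * wirtinger_bar k (radial (\<rho> \<epsilon>) w) z0)"
        unfolding L_def wirtinger_bar_def using intL by (simp add: distrib_left mult.left_commute)
      also have "\<dots> = - integral\<^sup>L (lebesgue_on U) (\<lambda>w. f w * wirtinger_bar k (radial (\<rho> \<epsilon>) z0) w)"
      proof -
        have "f w * wirtinger_bar k (radial (\<rho> \<epsilon>) w) z0 = - (f w * wirtinger_bar k (radial (\<rho> \<epsilon>) z0) w)" for w
          by (simp add: wirtinger_bar_radial[OF \<rho>e(1)] radial_commute[of _ w z0] algebra_simps)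
        then show ?thesis by simp
      qed
      also have "\<dots> = 0"
      proof -
        have "radial (\<rho> \<epsilon>) z0 \<in> test_functions U"
          by (rule test_functionsI[OF smooth_radial[OF \<rho>e(1)] compact_cball sub radial_averaging_eq_0[OF \<rho> e]])
            (use e in auto)
        then show ?thesis using f(2) by (simp add: weakly_holomorphic_on_def)
      qed
      finally have "L (axis k 1) = - (\<i> * L (axis k \<i>))" by (simp add: add_eq_0_iff2)
      then show ?thesis by simp
    qed
    then have lin: "L (a *s v) = a * L v" for a v
      by (rule complex_linear_iff_axis[OF has_derivative_linear[OF dL]])
    have "(F has_derivative (\<lambda>v. inverse (complex_of_real c) * L v)) (at z0)"
    proof (rule has_derivative_transform_within_open[OF has_derivative_mult_right[OF dL] open_ball])
      show "z0 \<in> ball z0 \<epsilon>" using e by simp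
      show "inverse (complex_of_real c) * integral\<^sup>L (lebesgue_on U) (\<lambda>w. f w * radial (\<rho> \<epsilon>) w z) = F z" if "z \<in> ball z0 \<epsilon>" for z
        using rep[OF e sub[OF that]] c by (simp add: radial_commute[of _ _ z])
    qed
    then show "\<exists>L. (F has_derivative L) (at z0) \<and> (\<forall>c v. L (c *s v) = c * L v)"
      using lin by (intro exI conjI) (auto simp: mult_ac)
  qed
  moreover have "norm (F z) \<le> C" if "z \<in> U" for z
  proof -
    note rz = r[OF that]
    have int\<rho>: "integrable (lebesgue_on U) (radial (\<rho> (r z)) z)"
      by (rule integrable_radial_averaging[OF \<rho> rz(1) U(1) rz(2)])
    have nr: "norm (radial (\<rho> (r z)) z w) = Re (radial (\<rho> (r z)) z w)" for w
      by (simp add: radial_def averaging_familyD(2)[OF \<rho> rz(1)])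
    have "norm (integral\<^sup>L (lebesgue_on U) (\<lambda>w. f w * radial (\<rho> (r z)) z w))
        \<le> integral\<^sup>L (lebesgue_on U) (\<lambda>w. norm (f w * radial (\<rho> (r z)) z w))"
      by (rule integral_norm_bound)
    also have "\<dots> \<le> integral\<^sup>L (lebesgue_on U) (\<lambda>w. C * Re (radial (\<rho> (r z)) z w))"
    proof (rule integral_mono_AE)
      show "AE w in lebesgue_on U. norm (f w * radial (\<rho> (r z)) z w) \<le> C * Re (radial (\<rho> (r z)) z w)"
        using C(1) by eventually_elim (auto simp: norm_mult nr[symmetric] intro: mult_right_mono)
    qed (use integrable_L_infty_mult[OF f(1) int\<rho>] int\<rho> in auto)
    also have "\<dots> = C * c"
      using integral_radial_averaging[OF \<rho> rz(1) U(1) rz(2)] int\<rho> by (simp add: c_def)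
    finally have "c * norm (F z) \<le> C * c"
      unfolding rep[OF rz] using c by (simp add: norm_mult)
    then show ?thesis using c by (simp add: mult.commute)
  qed
  ultimately have "F \<in> H_infty U"
    unfolding H_infty_def bounded_iff by blast
  then show ?thesis
    using rep unfolding c_def by blast
qed

text \<open>For w within \<epsilon> of z, replacing z_j by w_j in the coefficients costs at most
  \<epsilon> times the bounds of the \<open>f j\<close>, and \<open>g w\<close> is close to
  \<open>g z\<close>. Each admissible radius reproduces the same \<open>F j z\<close>, so the errors
  can be made arbitrarily small while the discrepancy \<open>d\<close> stays fixed.\<close>

lemma holomorphic_division_of_weak:
  fixes f :: "'n \<Rightarrow> complex ^ 'n \<Rightarrow> complex"
  assumes U: "open U" "bounded U"
    and f: "\<And>j. f j \<in> L_infty U" "\<And>j. weakly_holomorphic_on (f j) U"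
    and g: "continuous_on U g" "\<And>z. z \<in> U \<Longrightarrow> (\<Sum>j\<in>UNIV. (z $ j - \<alpha> $ j) * f j z) = g z"
  shows "\<exists>F. (\<forall>j. F j \<in> H_infty U) \<and> (\<forall>z\<in>U. g z = (\<Sum>j\<in>UNIV. (z $ j - \<alpha> $ j) * F j z))"
proof -
  obtain \<rho> where \<rho>: "averaging_family CARD('n) \<rho>"
    using averaging_family_exists[of "CARD('n)"] by auto
  define c where "c = averaging_mass TYPE('n) \<rho>"
  have c: "c > 0" unfolding c_def by (rule averaging_mass_pos[OF \<rho>])
  obtain F :: "'n \<Rightarrow> complex ^ 'n \<Rightarrow> complex" where F: "\<And>j. F j \<in> H_infty U"
    "\<And>j z \<epsilon>. \<epsilon> > 0 \<Longrightarrow> cball z \<epsilon> \<subseteq> U \<Longrightarrow>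
      integral\<^sup>L (lebesgue_on U) (\<lambda>w. f j w * radial (\<rho> \<epsilon>) z w) = complex_of_real c * F j z"
  proof -
    have "\<forall>j. \<exists>F :: complex ^ 'n \<Rightarrow> complex. F \<in> H_infty U \<and> (\<forall>z \<epsilon>. \<epsilon> > 0 \<longrightarrow> cball z \<epsilon> \<subseteq> U \<longrightarrow>
      integral\<^sup>L (lebesgue_on U) (\<lambda>w. f j w * radial (\<rho> \<epsilon>) z w) = complex_of_real c * F z)"
      using weakly_holomorphic_representative[OF \<rho> U f] unfolding c_def by blast
    from choice[OF this] show ?thesis using that by blast
  qed
  have "\<forall>j. \<exists>C. AE z in lebesgue_on U. norm (f j z) \<le> C" using f(1) by (auto simp: L_infty_def)
  then obtain C where C: "\<And>j. AE z in lebesgue_on U. norm (f j z) \<le> C j" by metis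
  define M where "M = (\<Sum>j\<in>UNIV. \<bar>C j\<bar>)"
  have M: "M \<ge> 0" by (simp add: M_def sum_nonneg)
  have "g z = (\<Sum>j\<in>UNIV. (z $ j - \<alpha> $ j) * F j z)" if z: "z \<in> U" for z
  proof -
    define d where "d = (\<Sum>j\<in>UNIV. (z $ j - \<alpha> $ j) * F j z) - g z"
    have "norm d \<le> \<eta>" if \<eta>: "\<eta> > 0" for \<eta>
    proof -
      obtain e1 where e1: "e1 > 0" "\<And>w. w \<in> U \<Longrightarrow> dist w z < e1 \<Longrightarrow> dist (g w) (g z) < \<eta> / 2"
        using g(1) z \<eta> unfolding continuous_on_iff by (meson half_gt_zero)
      obtain e2 where e2: "e2 > 0" "cball z e2 \<subseteq> U"
        using U(1) z unfolding open_contains_cball by blast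
      \<comment> \<open>The three radii serve continuity of \<open>g\<close>, the inclusion in
        \<open>U\<close>, and the error from moving the coefficients; \<open>M + 1\<close> avoids a
        division by 0.\<close>
      define \<epsilon> where "\<epsilon> = Min {e1 / 2, e2, \<eta> / (2 * (M + 1))}"
      have e: "\<epsilon> > 0" "\<epsilon> < e1" "\<epsilon> \<le> e2" "\<epsilon> \<le> \<eta> / (2 * (M + 1))"
        using e1(1) e2(1) \<eta> M by (auto simp: \<epsilon>_def min_less_iff_disj)
      have eM: "\<epsilon> * M \<le> \<eta> / 2"
      proof -
        have "\<epsilon> * M \<le> \<epsilon> * (M + 1)" using e(1) by simp
        also have "\<dots> \<le> \<eta> / 2" using e(4) M by (simp add: field_simps)
        finally show ?thesis .
      qed
      have sub: "cball z \<epsilon> \<subseteq> U" using e2(2) e(3) by (meson order_trans subset_cball)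
      define R where "R = radial (\<rho> \<epsilon>) z"
      have intR: "integrable (lebesgue_on U) R"
        unfolding R_def by (rule integrable_radial_averaging[OF \<rho> e(1) U(1) sub])
      have nR: "norm (R w) = Re (R w)" for w
        by (simp add: R_def radial_def averaging_familyD(2)[OF \<rho> e(1)])
      have IR: "integral\<^sup>L (lebesgue_on U) R = complex_of_real c"
        unfolding R_def c_def by (rule integral_radial_averaging[OF \<rho> e(1) U(1) sub])
      have intfR: "integrable (lebesgue_on U) (\<lambda>w. f j w * R w)" for j
        by (rule integrable_L_infty_mult[OF f(1) intR])
      \<comment> \<open>Coefficients and value of \<open>g\<close> are frozen at z while the
        \<open>f j\<close> vary with w; the integral of \<open>H\<close> is then \<open>c\<close>
        times the discrepancy \<open>d\<close>.\<close>
      define H where "H = (\<lambda>w. (\<Sum>j\<in>UNIV. (z $ j - \<alpha> $ j) * (f j w * R w)) - g z * R w)"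
      have intH: "integrable (lebesgue_on U) H"
        unfolding H_def using intR intfR by auto
      have "integral\<^sup>L (lebesgue_on U) H = (\<Sum>j\<in>UNIV. (z $ j - \<alpha> $ j) * (complex_of_real c * F j z)) - g z * complex_of_real c"
        unfolding H_def using intR intfR F(2)[OF e(1) sub]
        by (simp add: IR R_def[symmetric])
      also have "\<dots> = complex_of_real c * d"
        by (simp add: d_def sum_distrib_left algebra_simps)
      finally have cd: "integral\<^sup>L (lebesgue_on U) H = complex_of_real c * d" .
      have "AE w in lebesgue_on U. \<forall>j. norm (f j w) \<le> C j"
        using C by (simp add: AE_all_countable)
      then have bound: "AE w in lebesgue_on U. norm (H w) \<le> \<eta> * Re (R w)"
      proof (rule AE_mp, intro AE_I2 impI)
        fix w assume "w \<in> space (lebesgue_on U)" and Cw: "\<forall>j. norm (f j w) \<le> C j"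
        then have w: "w \<in> U" by simp
        show "norm (H w) \<le> \<eta> * Re (R w)"
        proof (cases "w \<in> cball z \<epsilon>")
          case False
          then have "R w = 0" unfolding R_def by (rule radial_averaging_eq_0[OF \<rho> e(1)])
          then show ?thesis by (simp add: H_def)
        next
          case True
          define S where "S = (\<Sum>j\<in>UNIV. (z $ j - w $ j) * f j w)"
          have e2: "(\<Sum>j\<in>UNIV. (z $ j - \<alpha> $ j) * f j w) = g w + S"
            unfolding g(2)[OF w, symmetric] S_def sum.distrib[symmetric]
            by (rule sum.cong) (simp_all add: ring_distribs)
          have eH: "(\<Sum>j\<in>UNIV. (z $ j - \<alpha> $ j) * (f j w * R w)) = (g w + S) * R w"
            unfolding e2[symmetric] sum_distrib_right by (simp add: mult.assoc)
          have "H w = ((g w - g z) + S) * R w"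
            unfolding H_def eH by (simp only: ring_distribs) simp
          moreover have "norm ((g w - g z) + S) \<le> \<eta> / 2 + \<eta> / 2"
          proof (rule norm_triangle_mono)
            show "norm (g w - g z) \<le> \<eta> / 2"
              using e1(2)[OF w] True e(2) by (simp add: dist_norm norm_minus_commute)
            have "norm (\<Sum>j\<in>UNIV. (z $ j - w $ j) * f j w) \<le> (\<Sum>j\<in>UNIV. \<epsilon> * \<bar>C j\<bar>)"
            proof (rule sum_norm_le)
              fix j
              have "norm (z $ j - w $ j) \<le> \<epsilon>"
                using True Finite_Cartesian_Product.norm_nth_le[of "z - w" j] by (simp add: dist_norm)
              moreover have "norm (f j w) \<le> \<bar>C j\<bar>" using Cw by (meson abs_ge_self order_trans)
              ultimately show "norm ((z $ j - w $ j) * f j w) \<le> \<epsilon> * \<bar>C j\<bar>"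
                unfolding norm_mult using e(1) by (intro mult_mono) auto
            qed
            then show "norm S \<le> \<eta> / 2"
              using eM by (simp add: S_def M_def sum_distrib_left)
          qed
          ultimately have "norm (H w) \<le> \<eta> * norm (R w)"
            by (simp add: norm_mult mult_right_mono)
          then show ?thesis by (simp only: nR)
        qed
      qed
      have "c * norm d = norm (integral\<^sup>L (lebesgue_on U) H)"
        unfolding cd using c by (simp add: norm_mult)
      also have "\<dots> \<le> integral\<^sup>L (lebesgue_on U) (\<lambda>w. norm (H w))"
        by (rule integral_norm_bound)
      also have "\<dots> \<le> integral\<^sup>L (lebesgue_on U) (\<lambda>w. \<eta> * Re (R w))"
        by (rule integral_mono_AE[OF _ _ bound]) (use intH intR in auto)
      also have "\<dots> = \<eta> * c"
        using IR intR by simp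
      finally show ?thesis using c by (simp add: mult.commute)
    qed
    then have "norm d \<le> 0 + \<eta>" if "\<eta> > 0" for \<eta> using that by simp
    then have "norm d \<le> 0" by (rule field_le_epsilon)
    then show ?thesis by (simp add: d_def)
  qed
  then show ?thesis using F(1) by (intro exI[of _ F]) simp
qed

section \<open>Local division\<close>

text \<open>A bound for the values is enough: Cauchy estimates on smaller balls turn it into a
  uniform bound for the derivatives, which is integrable because \<open>M\<close> is finite.\<close>

lemma holomorphic_parameter_integral:
  fixes f :: "'p \<Rightarrow> complex ^ 'n \<Rightarrow> complex"
  assumes U: "open U" and M: "finite_measure M"
    and hol: "\<And>p. p \<in> space M \<Longrightarrow> holomorphic_several_on (f p) U"
    and bd: "\<And>p z. p \<in> space M \<Longrightarrow> z \<in> U \<Longrightarrow> norm (f p z) \<le> B"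
    and meas: "\<And>z. z \<in> U \<Longrightarrow> (\<lambda>p. f p z) \<in> borel_measurable M"
  shows "holomorphic_several_on (\<lambda>z. integral\<^sup>L M (\<lambda>p. f p z)) U"
  unfolding holomorphic_several_on_def
proof
  interpret finite_measure M by (rule M)
  fix z0 assume z0: "z0 \<in> U"
  obtain e where e: "e > 0" "cball z0 e \<subseteq> U" using U z0 unfolding open_contains_cball by blast
  define r where "r = e / 2"
  have r: "r > 0" using e by (simp add: r_def)
  have sub: "cball z r \<subseteq> U" if "z \<in> ball z0 r" for z
    using cball_subset_cball_double[OF that] e(2) by (simp add: r_def)
  have inU: "z \<in> U" if "z \<in> ball z0 r" for z using sub[OF that] r by auto
  let ?f' = "\<lambda>p z. frechet_derivative (f p) (at z)"
  have meas': "(\<lambda>p. f p z) \<in> borel_measurable M" if "z \<in> ball z0 r" for z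
    by (rule meas[OF inU[OF that]])
  have der: "(f p has_derivative ?f' p z) (at z)" if "p \<in> space M" "z \<in> ball z0 r" for p z
    by (rule holomorphic_has_derivative(1)[OF hol[OF that(1)] inU[OF that(2)]])
  have est: "norm (?f' p z v) \<le> B / r * norm v" if "p \<in> space M" "z \<in> ball z0 r" for p z v
    by (rule Cauchy_estimate_several[OF hol[OF that(1)] r sub[OF that(2)]])
      (use bd[OF that(1)] sub[OF that(2)] in auto)
  have int: "integrable M (\<lambda>p. f p z0)"
    by (rule integrable_const_bound[of _ B]) (use bd[OF _ z0] meas[OF z0] in \<open>auto intro: AE_I2\<close>)
  have "((\<lambda>z. integral\<^sup>L M (\<lambda>p. f p z)) has_derivative (\<lambda>v. integral\<^sup>L M (\<lambda>p. ?f' p z0 v))) (at z0)"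
    by (rule has_derivative_parameter_integral[OF r meas' der est integrable_const int])
  moreover have "integral\<^sup>L M (\<lambda>p. ?f' p z0 (c *s v)) = c * integral\<^sup>L M (\<lambda>p. ?f' p z0 v)" for c v
  proof -
    have "integral\<^sup>L M (\<lambda>p. ?f' p z0 (c *s v)) = integral\<^sup>L M (\<lambda>p. c * ?f' p z0 v)"
      by (rule Bochner_Integration.integral_cong) (simp_all add: holomorphic_has_derivative(2)[OF hol z0])
    then show ?thesis by simp
  qed
  ultimately show "\<exists>L. ((\<lambda>z. integral\<^sup>L M (\<lambda>p. f p z)) has_derivative L) (at z0) \<and> (\<forall>c v. L (c *s v) = c * L v)"
    by blast
qed

lemma holomorphic_affine:
  fixes f :: "complex ^ 'n \<Rightarrow> complex"
  assumes f: "holomorphic_several_on f V" and sub: "\<And>z. z \<in> U \<Longrightarrow> a + c *\<^sub>R z \<in> V"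
  shows "holomorphic_several_on (\<lambda>z. f (a + c *\<^sub>R z)) U"
  unfolding holomorphic_several_on_def
proof
  fix z assume z: "z \<in> U"
  have "((\<lambda>z. a + c *\<^sub>R z) has_derivative (\<lambda>v. c *\<^sub>R v)) (at z)"
    by (auto intro!: derivative_eq_intros)
  from has_derivative_compose[OF this holomorphic_has_derivative(1)[OF f sub[OF z]]]
  have d: "((\<lambda>z. f (a + c *\<^sub>R z)) has_derivative (\<lambda>v. frechet_derivative f (at (a + c *\<^sub>R z)) (c *\<^sub>R v))) (at z)" .
  have "c *\<^sub>R (b *s v) = b *s (c *\<^sub>R v)" for b and v :: "complex ^ 'n"
    by (simp add: vec_eq_iff)
  then have "frechet_derivative f (at (a + c *\<^sub>R z)) (c *\<^sub>R (b *s v)) = b * frechet_derivative f (at (a + c *\<^sub>R z)) (c *\<^sub>R v)" for b v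
    by (simp add: holomorphic_has_derivative(2)[OF f sub[OF z]])
  with d show "\<exists>L. ((\<lambda>z. f (a + c *\<^sub>R z)) has_derivative L) (at z) \<and> (\<forall>c v. L (c *s v) = c * L v)"
    by (intro exI conjI allI)
qed

lemma holomorphic_cmult:
  assumes "holomorphic_several_on f U"
  shows "holomorphic_several_on (\<lambda>z. c * f z) U"
  unfolding holomorphic_several_on_def
proof
  fix z assume z: "z \<in> U"
  show "\<exists>L. ((\<lambda>z. c * f z) has_derivative L) (at z) \<and> (\<forall>c v. L (c *s v) = c * L v)"
    using has_derivative_mult_right[OF holomorphic_has_derivative(1)[OF assms z], of c]
    by (intro exI[of _ "\<lambda>v. c * frechet_derivative f (at z) v"])
      (simp add: holomorphic_has_derivative(2)[OF assms z] mult.left_commute)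
qed

text \<open>Cauchy's formula for the first derivative. Parametrising the circle over the unit
  interval cancels the factor 2 pi i, so the directional derivative becomes an integral over a
  finite measure, to which \<open>holomorphic_parameter_integral\<close> applies.\<close>

lemma circle_mean_derivative:
  assumes g: "holomorphic_several_on g \<Omega>" and r: "r > 0"
    and sub: "\<And>c. norm c \<le> r \<Longrightarrow> x + c *s v \<in> \<Omega>"
  shows "frechet_derivative g (at x) v
    = integral\<^sup>L (restrict_space lborel {0..1}) (\<lambda>t. inverse (circlepath 0 r t) * g (x + circlepath 0 r t *s v))"
proof -
  define F where "F = (\<lambda>c. g (x + c *s v))"
  have dF: "(F has_field_derivative frechet_derivative g (at (x + c *s v)) v) (at c)" if "norm c \<le> r" for c
    unfolding F_def by (rule holomorphic_on_line[OF g sub[OF that]])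
  have contF: "continuous_on (cball 0 r) F"
    using dF by (intro continuous_at_imp_continuous_on ballI DERIV_isCont) auto
  have holF: "F holomorphic_on ball 0 r"
    unfolding holomorphic_on_open[OF open_ball] using dF by (meson less_imp_le mem_ball_0)
  have c0: "circlepath 0 r t \<noteq> 0" for t using r by (simp add: circlepath)
  have c_in: "circlepath 0 r t \<in> cball 0 r" for t using r by (simp add: circlepath norm_mult)
  have contc: "continuous_on S (circlepath 0 r)" for S
    unfolding circlepath by (intro continuous_intros)
  have "(F has_field_derivative (1 / (2 * of_real pi * \<i>) * contour_integral (circlepath 0 r) (\<lambda>u. F u / (u - 0)\<^sup>2))) (at 0)"
    by (rule Cauchy_derivative_integral_circlepath(2)[OF contF holF]) (use r in simp)
  then have "frechet_derivative g (at x) v = 1 / (2 * of_real pi * \<i>) * contour_integral (circlepath 0 r) (\<lambda>u. F u / (u - 0)\<^sup>2)"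
    using dF[of 0] r DERIV_unique by fastforce
  also have "\<dots> = 1 / (2 * of_real pi * \<i>) * integral {0..1} (\<lambda>t. (2 * of_real pi * \<i>) * (inverse (circlepath 0 r t) * F (circlepath 0 r t)))"
  proof -
    have vd: "vector_derivative (circlepath 0 r) (at t) = (2 * of_real pi * \<i>) * circlepath 0 r t" for t
      unfolding vector_derivative_circlepath by (simp add: circlepath)
    have "F (circlepath 0 r t) / (circlepath 0 r t - 0)\<^sup>2 * vector_derivative (circlepath 0 r) (at t)
        = (2 * of_real pi * \<i>) * (inverse (circlepath 0 r t) * F (circlepath 0 r t))" for t
      unfolding vd using c0[of t] by (simp add: power2_eq_square field_simps)
    then show ?thesis unfolding contour_integral_integral by (simp only:)
  qed
  also have "\<dots> = integral {0..1} (\<lambda>t. inverse (circlepath 0 r t) * F (circlepath 0 r t))"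
    by simp
  also have "\<dots> = integral\<^sup>L lborel (\<lambda>t. indicator {0..1} t *\<^sub>R (inverse (circlepath 0 r t) * F (circlepath 0 r t)))"
  proof -
    have "set_integrable lborel {0..1} (\<lambda>t. inverse (circlepath 0 r t) * F (circlepath 0 r t))"
      unfolding set_integrable_def
    proof (rule borel_integrable_compact[unfolded set_integrable_def, OF compact_Icc])
      show "continuous_on {0..1} (\<lambda>t. inverse (circlepath 0 r t) * F (circlepath 0 r t))"
        using c0 c_in by (intro continuous_intros contc continuous_on_compose2[OF contF contc]) auto
    qed
    from set_borel_integral_eq_integral(2)[OF this] show ?thesis
      by (simp add: set_lebesgue_integral_def)
  qed
  also have "\<dots> = integral\<^sup>L (restrict_space lborel {0..1}) (\<lambda>t. inverse (circlepath 0 r t) * F (circlepath 0 r t))"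
    by (rule integral_restrict_space[symmetric]) simp
  finally show ?thesis by (simp add: F_def)
qed

lemma finite_measure_unit_interval: "finite_measure (restrict_space lborel {0..1::real})"
  by (rule finite_measureI) (simp add: emeasure_restrict_space space_restrict_space)

lemma measurable_unit_interval:
  fixes f :: "real \<Rightarrow> complex"
  shows "continuous_on {0..1} f \<Longrightarrow> f \<in> borel_measurable (restrict_space lborel {0..1})"
  using borel_measurable_continuous_on_restrict[of "{0..1}" f]
  by (simp add: measurable_def space_restrict_space sets_restrict_space)

text \<open>Hadamard's lemma in holomorphic form: \<open>h j\<close> is the mean of the j-th partial
  derivative of \<open>g\<close> along the segment from \<alpha> to z, and the fundamental theorem
  of calculus on that segment gives the identity.\<close>

lemma local_division:
  fixes g :: "complex ^ 'n \<Rightarrow> complex"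
  assumes g: "holomorphic_several_on g \<Omega>" and \<Omega>: "open \<Omega>" "\<alpha> \<in> \<Omega>" and g0: "g \<alpha> = 0"
  obtains r h where "r > 0" "ball \<alpha> r \<subseteq> \<Omega>"
    "\<And>j::'n. holomorphic_several_on (h j) (ball \<alpha> r)" "\<And>j. bounded (h j ` ball \<alpha> r)"
    "\<And>z. z \<in> ball \<alpha> r \<Longrightarrow> g z = (\<Sum>j\<in>UNIV. (z $ j - \<alpha> $ j) * h j z)"
proof -
  obtain R where R: "R > 0" "cball \<alpha> R \<subseteq> \<Omega>" using \<Omega> unfolding open_contains_cball by blast
  have contg: "continuous_on (cball \<alpha> R) g"
    using holomorphic_continuous[OF g] R(2) continuous_on_subset by blast
  then have "bounded (g ` cball \<alpha> R)"
    by (rule compact_imp_bounded[OF compact_continuous_image[OF _ compact_cball]])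
  then obtain B where B: "\<And>z. z \<in> cball \<alpha> R \<Longrightarrow> norm (g z) \<le> B"
    unfolding bounded_iff by blast
  \<comment> \<open>Half of \<open>R\<close>, so that circles of radius \<open>r\<close> around
    points of \<open>ball \<alpha> r\<close> stay in \<open>cball \<alpha> R\<close>.\<close>
  define r where "r = R / 2"
  have r: "r > 0" using R by (simp add: r_def)
  have rR: "ball \<alpha> r \<subseteq> cball \<alpha> R" using r by (auto simp: r_def)
  let ?M = "restrict_space lborel {0..1::real}"
  let ?c = "circlepath 0 r"
  have c: "norm (?c t) = r" for t using r by (simp add: circlepath norm_mult)
  have c0: "?c t \<noteq> 0" for t using c[of t] r by auto
  have contc: "continuous_on S ?c" for S unfolding circlepath by (intro continuous_intros)
  have mem: "x + b *s axis j 1 \<in> cball \<alpha> R" if "x \<in> ball \<alpha> r" "norm b \<le> r" for x b and j :: 'n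
  proof -
    have "dist \<alpha> (x + b *s axis j 1) \<le> dist \<alpha> x + dist x (x + b *s axis j 1)" by (rule dist_triangle)
    also have "\<dots> \<le> R" using that by (simp add: dist_norm norm_vector_smult r_def)
    finally show ?thesis by simp
  qed
  have contl: "continuous_on S (\<lambda>t. x + ?c t *s axis j 1)" for S and x :: "complex ^ 'n" and j
    by (rule continuous_on_add[OF continuous_on_const
          bounded_linear.continuous_on[OF bounded_linear_vector_smult contc]])
  \<comment> \<open>The partial derivative enters as a circle mean, a form in which its holomorphy
    follows from that of \<open>g\<close>.\<close>
  define D where "D = (\<lambda>j x. integral\<^sup>L ?M (\<lambda>t. inverse (?c t) * g (x + ?c t *s axis j 1)))"
  have D: "D j x = frechet_derivative g (at x) (axis j 1)" if "x \<in> ball \<alpha> r" for j x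
    unfolding D_def
    by (rule circle_mean_derivative[OF g r, symmetric]) (use mem[OF that] R(2) in blast)
  have holD: "holomorphic_several_on (D j) (ball \<alpha> r)" for j
    unfolding D_def
  proof (rule holomorphic_parameter_integral[OF open_ball finite_measure_unit_interval])
    fix t
    have "holomorphic_several_on (\<lambda>z. g (?c t *s axis j 1 + 1 *\<^sub>R z)) (ball \<alpha> r)"
      by (rule holomorphic_affine[OF g]) (use mem[of _ "?c t" j] c R(2) in \<open>auto simp: add.commute\<close>)
    from holomorphic_cmult[OF this]
    show "holomorphic_several_on (\<lambda>x. inverse (?c t) * g (x + ?c t *s axis j 1)) (ball \<alpha> r)"
      by (simp add: add.commute)
    fix z assume z: "z \<in> ball \<alpha> r"
    have "norm (g (z + ?c t *s axis j 1)) \<le> B" by (rule B[OF mem[OF z]]) (simp add: c)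
    then show "norm (inverse (?c t) * g (z + ?c t *s axis j 1)) \<le> inverse r * B"
      using r by (simp add: norm_mult norm_inverse c)
  next
    fix z assume z: "z \<in> ball \<alpha> r"
    show "(\<lambda>t. inverse (?c t) * g (z + ?c t *s axis j 1)) \<in> borel_measurable ?M"
      by (rule measurable_unit_interval)
        (intro continuous_intros contc continuous_on_compose2[OF contg contl]; use c c0 mem[OF z] in force)
  qed
  have axis_norm: "norm (axis j (1::complex) :: complex ^ 'n) = 1" for j by (simp add: norm_axis_1)
  have bdD: "norm (D j x) \<le> B / r" if "x \<in> ball \<alpha> r" for j x
  proof -
    have "cball x r \<subseteq> cball \<alpha> R"
      using cball_subset_cball_double[OF that] by (simp add: r_def)
    then have "norm (frechet_derivative g (at x) (axis j 1)) \<le> B / r * norm (axis j (1::complex) :: complex ^ 'n)"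
      using R(2) B by (intro Cauchy_estimate_several[OF g r]) auto
    then show ?thesis using D[OF that] by (simp add: axis_norm)
  qed
  \<comment> \<open>The argument of \<open>D j\<close> is the point (1 - s) \<alpha> + s z of the
    segment, written in the shape that \<open>holomorphic_affine\<close> expects.\<close>
  define h where "h = (\<lambda>j z. integral\<^sup>L ?M (\<lambda>s. D j (\<alpha> - s *\<^sub>R \<alpha> + s *\<^sub>R z)))"
  have seg: "\<alpha> - s *\<^sub>R \<alpha> + s *\<^sub>R z \<in> ball \<alpha> r" if "z \<in> ball \<alpha> r" "s \<in> {0..1}" for s z
  proof -
    have "\<alpha> - s *\<^sub>R \<alpha> + s *\<^sub>R z = (1 - s) *\<^sub>R \<alpha> + s *\<^sub>R z" by (simp add: algebra_simps)
    also have "\<dots> \<in> ball \<alpha> r"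
      using convexD[OF convex_ball, of \<alpha> \<alpha> r z "1 - s" s] that r by auto
    finally show ?thesis .
  qed
  have sp: "space ?M = {0..1}" by (simp add: space_restrict_space)
  have contD: "continuous_on {0..1} (\<lambda>s. D j (\<alpha> - s *\<^sub>R \<alpha> + s *\<^sub>R z))" if "z \<in> ball \<alpha> r" for j z
    by (rule continuous_on_compose2[OF holomorphic_continuous[OF holD]])
      (use seg[OF that] in \<open>auto intro!: continuous_intros\<close>)
  have holh: "holomorphic_several_on (h j) (ball \<alpha> r)" for j
    unfolding h_def
  proof (rule holomorphic_parameter_integral[OF open_ball finite_measure_unit_interval])
    fix s assume s: "s \<in> space ?M"
    show "holomorphic_several_on (\<lambda>z. D j (\<alpha> - s *\<^sub>R \<alpha> + s *\<^sub>R z)) (ball \<alpha> r)"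
      by (rule holomorphic_affine[OF holD seg]) (use s sp in auto)
    show "norm (D j (\<alpha> - s *\<^sub>R \<alpha> + s *\<^sub>R z)) \<le> B / r" if "z \<in> ball \<alpha> r" for z
      by (rule bdD[OF seg[OF that]]) (use s sp in auto)
  qed (rule measurable_unit_interval[OF contD])
  have inth: "integrable ?M (\<lambda>s. D j (\<alpha> - s *\<^sub>R \<alpha> + s *\<^sub>R z))" if "z \<in> ball \<alpha> r" for j z
    by (rule finite_measure.integrable_const_bound[OF finite_measure_unit_interval, of _ "B / r"])
      (use bdD[OF seg[OF that]] measurable_unit_interval[OF contD[OF that]] sp in \<open>auto intro!: AE_I2\<close>)
  have bdh: "norm (h j z) \<le> B / r" if "z \<in> ball \<alpha> r" for j z
  proof -
    interpret finite_measure ?M by (rule finite_measure_unit_interval)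
    have "norm (h j z) \<le> integral\<^sup>L ?M (\<lambda>s. norm (D j (\<alpha> - s *\<^sub>R \<alpha> + s *\<^sub>R z)))"
      unfolding h_def by (rule integral_norm_bound)
    also have "\<dots> \<le> integral\<^sup>L ?M (\<lambda>s. B / r)"
      by (rule integral_mono) (use inth[OF that] bdD[OF seg[OF that]] sp in auto)
    also have "\<dots> = B / r"
      by (simp add: measure_restrict_space sp)
    finally show ?thesis .
  qed
  have div: "g z = (\<Sum>j\<in>UNIV. (z $ j - \<alpha> $ j) * h j z)" if z: "z \<in> ball \<alpha> r" for z
  proof -
    let ?p = "\<lambda>s. \<alpha> - s *\<^sub>R \<alpha> + s *\<^sub>R z"
    have "(\<Sum>j\<in>UNIV. (z $ j - \<alpha> $ j) * h j z) = integral\<^sup>L ?M (\<lambda>s. \<Sum>j\<in>UNIV. (z $ j - \<alpha> $ j) * D j (?p s))"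
      unfolding h_def using inth[OF z] by simp
    also have "\<dots> = integral\<^sup>L lborel (\<lambda>s. indicator {0..1} s *\<^sub>R (\<Sum>j\<in>UNIV. (z $ j - \<alpha> $ j) * D j (?p s)))"
      by (rule integral_restrict_space) simp
    also have "\<dots> = g (?p 1) - g (?p 0)"
    proof (rule integral_FTC_atLeastAtMost[where F = "\<lambda>s. g (?p s)"])
      fix s :: real assume s: "0 \<le> s" "s \<le> 1"
      then have ps: "?p s \<in> ball \<alpha> r" using seg[OF z, of s] by auto
      then have pO: "?p s \<in> \<Omega>" using rR R(2) by blast
      have "((\<lambda>s. \<alpha> - s *\<^sub>R \<alpha> + s *\<^sub>R z) has_derivative (\<lambda>t. t *\<^sub>R (z - \<alpha>))) (at s)"
        by (auto intro!: derivative_eq_intros simp: algebra_simps)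
      from has_derivative_compose[OF this holomorphic_has_derivative(1)[OF g pO]]
      have "((\<lambda>s. g (?p s)) has_derivative (\<lambda>t. t *\<^sub>R frechet_derivative g (at (?p s)) (z - \<alpha>))) (at s)"
        by (simp only: linear_scale[OF has_derivative_linear[OF holomorphic_has_derivative(1)[OF g pO]]])
      then have "((\<lambda>s. g (?p s)) has_vector_derivative frechet_derivative g (at (?p s)) (z - \<alpha>)) (at s within {0..1})"
        unfolding has_vector_derivative_def by (rule has_derivative_at_withinI)
      moreover have "frechet_derivative g (at (?p s)) (z - \<alpha>) = (\<Sum>j\<in>UNIV. (z $ j - \<alpha> $ j) * D j (?p s))"
      proof -
        have "frechet_derivative g (at (?p s)) (\<Sum>j\<in>UNIV. (z - \<alpha>) $ j *s axis j 1)
            = (\<Sum>j\<in>UNIV. (z $ j - \<alpha> $ j) * D j (?p s))"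
          unfolding linear_sum[OF has_derivative_linear[OF holomorphic_has_derivative(1)[OF g pO]]]
          by (simp only: holomorphic_has_derivative(2)[OF g pO] D[OF ps] vector_minus_component)
        then show ?thesis by (simp only: basis_expansion)
      qed
      ultimately show "((\<lambda>s. g (?p s)) has_vector_derivative (\<Sum>j\<in>UNIV. (z $ j - \<alpha> $ j) * D j (?p s))) (at s within {0..1})"
        by simp
    next
      show "continuous_on {0..1} (\<lambda>s. \<Sum>j\<in>UNIV. (z $ j - \<alpha> $ j) * D j (?p s))"
        by (intro continuous_intros contD z)
    qed simp
    finally show ?thesis using g0 by simp
  qed
  show thesis
  proof (rule that[OF r])
    show "ball \<alpha> r \<subseteq> \<Omega>" using rR R(2) by blast
    show "bounded (h j ` ball \<alpha> r)" for j
      using bdh unfolding bounded_iff by blast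
  qed (use holh div in auto)
qed

section \<open>Coefficients stable under Wirtinger derivatives\<close>

text \<open>
  A class of coefficients in which Wirtinger derivatives commute and stay bounded: since they never
  hit the holomorphic factors, no derivatives of \<open>g\<close> have to be controlled up to the boundary.
\<close>

inductive regular :: "(complex ^ 'n) set \<Rightarrow> complex ^ 'n \<Rightarrow> (complex ^ 'n \<Rightarrow> complex) \<Rightarrow> bool"
  for U :: "(complex ^ 'n) set" and \<alpha> :: "complex ^ 'n" where
  regular_H_infty: "h \<in> H_infty U \<Longrightarrow> regular U \<alpha> h"
| regular_radial: "smooth K \<Longrightarrow> regular U \<alpha> (radial K \<alpha>)"
| regular_cutoff: "smooth K \<Longrightarrow> (\<And>s. s > r\<^sup>2 \<Longrightarrow> K s = 0) \<Longrightarrow> 0 \<le> r \<Longrightarrow> r < R \<Longrightarrow>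
    holomorphic_several_on h (ball \<alpha> R) \<Longrightarrow> bounded (h ` ball \<alpha> R) \<Longrightarrow>
    regular U \<alpha> (\<lambda>z. radial K \<alpha> z * h z)"
| regular_cnj: "regular U \<alpha> (\<lambda>z. cnj (z $ j - \<alpha> $ j))"
| regular_add: "regular U \<alpha> f \<Longrightarrow> regular U \<alpha> g \<Longrightarrow> regular U \<alpha> (\<lambda>z. f z + g z)"
| regular_mult: "regular U \<alpha> f \<Longrightarrow> regular U \<alpha> g \<Longrightarrow> regular U \<alpha> (\<lambda>z. f z * g z)"
| regular_cong: "regular U \<alpha> f \<Longrightarrow> (\<And>z. z \<in> U \<Longrightarrow> g z = f z) \<Longrightarrow> regular U \<alpha> g"

section \<open>Tameness, boundedness and Wirtinger derivatives of regular coefficients\<close>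

lemma tame_on_cong:
  assumes f: "tame_on U f" and U: "open U" and eq: "\<And>z. z \<in> U \<Longrightarrow> f z = g z"
  shows "tame_on U g"
proof (rule tame_onI[where f' = "\<lambda>z. frechet_derivative f (at z)"])
  show "(g has_derivative frechet_derivative f (at z)) (at z)" if "z \<in> U" for z
    by (rule has_derivative_transform_within_open[OF tame_on_has_derivative[OF f that] U that eq])
qed (use f in \<open>simp add: tame_on_def\<close>)

lemma tame_on_Un:
  assumes f: "tame_on U f" "tame_on V f" and op: "open U" "open V"
  shows "tame_on (U \<union> V) f"
proof (rule tame_onI)
  show "(f has_derivative frechet_derivative f (at z)) (at z)" if "z \<in> U \<union> V" for z
    using that tame_on_has_derivative[OF f(1)] tame_on_has_derivative[OF f(2)] by blast
  have *: "\<exists>\<delta>>0. \<exists>C. \<forall>w\<in>ball z \<delta> \<inter> (U \<union> V). \<forall>v. norm (frechet_derivative f (at w) v) \<le> C * norm v"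
    if W: "tame_on W f" "open W" "z \<in> W" for W z
  proof -
    obtain \<delta> C where d: "\<delta> > 0" "\<forall>w\<in>ball z \<delta> \<inter> W. \<forall>v. norm (frechet_derivative f (at w) v) \<le> C * norm v"
      using W unfolding tame_on_def by blast
    obtain e where e: "e > 0" "ball z e \<subseteq> W" using W(2,3) openE by blast
    show ?thesis
    proof (intro exI conjI ballI allI)
      show "min \<delta> e > 0" using d e by simp
      fix w v assume "w \<in> ball z (min \<delta> e) \<inter> (U \<union> V)"
      then have "w \<in> ball z \<delta> \<inter> W" using e(2) by auto
      then show "norm (frechet_derivative f (at w) v) \<le> C * norm v" using d(2) by blast
    qed
  qed
  show "\<exists>\<delta>>0. \<exists>C. \<forall>w\<in>ball z \<delta> \<inter> (U \<union> V). \<forall>v. norm (frechet_derivative f (at w) v) \<le> C * norm v" if "z \<in> U \<union> V" for z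
    using that *[OF f(1) op(1)] *[OF f(2) op(2)] by blast
qed

text \<open>Nothing is known of \<open>h\<close> outside \<open>ball \<alpha> R\<close>, but the
  cutoff has already vanished there: since r < R, the ball and the complement of
  \<open>cball \<alpha> r\<close> are open and cover the space.\<close>

lemma cutoff_tame_on:
  assumes K: "smooth K" "\<And>s. s > r\<^sup>2 \<Longrightarrow> K s = 0" and r: "0 \<le> r" "r < R"
    and h: "holomorphic_several_on h (ball \<alpha> R)"
  shows "tame_on UNIV (\<lambda>z. radial K \<alpha> z * h z)"
proof -
  have "tame_on (ball \<alpha> R) (\<lambda>z. radial K \<alpha> z * h z)"
    by (rule tame_on_mult[OF smooth_tame_on[OF smooth_radial[OF K(1)]] holomorphic_tame_on[OF h open_ball]])
  moreover have "tame_on (- cball \<alpha> r) (\<lambda>z. radial K \<alpha> z * h z)"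
  proof (rule tame_on_cong[OF smooth_tame_on[OF smooth_const]])
    fix z assume "z \<in> - cball \<alpha> r"
    then have "norm (z - \<alpha>) > r" by (simp add: dist_norm norm_minus_commute)
    then have "(norm (z - \<alpha>))\<^sup>2 > r\<^sup>2" using r by (intro power_strict_mono) auto
    then show "0 = radial K \<alpha> z * h z" by (simp add: radial_def K(2))
  qed (simp add: open_Compl)
  ultimately have "tame_on (ball \<alpha> R \<union> - cball \<alpha> r) (\<lambda>z. radial K \<alpha> z * h z)"
    by (rule tame_on_Un) (simp_all add: open_Compl)
  moreover have "ball \<alpha> R \<union> - cball \<alpha> r = UNIV" using r by auto
  ultimately show ?thesis by simp
qed

lemma wirtinger_bar_cutoff:
  assumes K: "smooth K" "\<And>s. s > r\<^sup>2 \<Longrightarrow> K s = 0" and r: "0 \<le> r" "r < R"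
    and h: "holomorphic_several_on h (ball \<alpha> R)"
  shows "wirtinger_bar k (\<lambda>z. radial K \<alpha> z * h z) z = (z $ k - \<alpha> $ k) * (radial (deriv K) \<alpha> z * h z)"
proof (cases "z \<in> ball \<alpha> R")
  case True
  have "wirtinger_bar k (\<lambda>z. radial K \<alpha> z * h z) z = radial K \<alpha> z * wirtinger_bar k h z + wirtinger_bar k (radial K \<alpha>) z * h z"
    by (rule wirtinger_bar_mult[OF differentiableI[OF has_derivative_radial[OF K(1)]]
        differentiableI[OF holomorphic_has_derivative(1)[OF h True]]])
  then show ?thesis
    by (simp add: wirtinger_bar_holomorphic[OF h True] wirtinger_bar_radial[OF K(1)])
next
  case False
  have out: "(norm (w - \<alpha>))\<^sup>2 > r\<^sup>2" if "w \<in> - cball \<alpha> r" for w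
    using that r by (intro power_strict_mono) (auto simp: dist_norm norm_minus_commute)
  have z: "z \<in> - cball \<alpha> r" using False r by auto
  have "wirtinger_bar k (\<lambda>z. radial K \<alpha> z * h z) z = wirtinger_bar k (\<lambda>_. 0) z"
    by (rule wirtinger_bar_transform[OF _ z]) (auto simp: open_Compl radial_def K(2) out)
  then show ?thesis
    using out[OF z] by (simp add: wirtinger_bar_const radial_def deriv_eq_0_beyond[OF K(2)])
qed

lemma bounded_image_mult:
  fixes f g :: "'a \<Rightarrow> complex"
  assumes "bounded (f ` S)" "bounded (g ` S)"
  shows "bounded ((\<lambda>z. f z * g z) ` S)"
proof -
  obtain A B where "\<And>z. z \<in> S \<Longrightarrow> norm (f z) \<le> A" "\<And>z. z \<in> S \<Longrightarrow> norm (g z) \<le> B"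
    using assms unfolding bounded_iff by auto
  then have "norm (f z * g z) \<le> A * B" if "z \<in> S" for z
    unfolding norm_mult using that by (intro mult_mono) (auto intro: order_trans[OF norm_ge_zero])
  then show ?thesis unfolding bounded_iff by blast
qed

lemma smooth_bounded_image:
  fixes f :: "'a::euclidean_space \<Rightarrow> complex"
  assumes "smooth f" "bounded S"
  shows "bounded (f ` S)"
proof -
  have "bounded (f ` closure S)"
    using assms by (intro compact_imp_bounded compact_continuous_image smooth_continuous) (simp_all add: compact_closure)
  then show ?thesis by (rule bounded_subset) (use closure_subset in blast)
qed

context
  fixes U :: "(complex ^ 'n) set" and \<alpha> :: "complex ^ 'n"
  assumes op: "open U" and bd: "bounded U"
begin

lemma coordinate_H_infty: "(\<lambda>z. z $ j - a) \<in> H_infty U"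
  unfolding H_infty_def using holomorphic_coordinate smooth_bounded_image[OF smooth_coordinate bd] by blast

lemma const_H_infty: "(\<lambda>z. c) \<in> H_infty U"
  unfolding H_infty_def using holomorphic_const smooth_bounded_image[OF smooth_const bd] by blast

lemma regular_const: "regular U \<alpha> (\<lambda>z. c)"
  by (rule regular_H_infty[OF const_H_infty])

lemma regular_coordinate: "regular U \<alpha> (\<lambda>z. z $ j - a)"
  by (rule regular_H_infty[OF coordinate_H_infty])

lemma regular_cmult: "regular U \<alpha> f \<Longrightarrow> regular U \<alpha> (\<lambda>z. c * f z)"
  by (rule regular_mult[OF regular_const])

lemma regular_diff: "regular U \<alpha> f \<Longrightarrow> regular U \<alpha> g \<Longrightarrow> regular U \<alpha> (\<lambda>z. f z - g z)"
  using regular_add[OF _ regular_cmult[of g "- 1"], of f] by simp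

lemma regular_sum: "finite A \<Longrightarrow> (\<And>i. i \<in> A \<Longrightarrow> regular U \<alpha> (f i)) \<Longrightarrow> regular U \<alpha> (\<lambda>z. \<Sum>i\<in>A. f i z)"
  by (induction A rule: finite_induct) (simp_all add: regular_const regular_add)

lemma regular_tame_on: "regular U \<alpha> f \<Longrightarrow> tame_on U f"
proof (induction rule: regular.induct)
  case (regular_H_infty h)
  then show ?case by (intro holomorphic_tame_on op) (simp add: H_infty_def)
next
  case (regular_radial K)
  then show ?case by (intro smooth_tame_on smooth_radial)
next
  case (regular_cutoff K r R h)
  then show ?case using tame_on_subset[OF cutoff_tame_on] by blast
next
  case (regular_cnj j)
  show ?case by (intro smooth_tame_on smooth_cnj_coordinate)
next
  case (regular_cong f g)
  then show ?case by (metis tame_on_cong[OF _ op])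
qed (rule tame_on_add tame_on_mult; assumption)+

lemma regular_differentiable: "regular U \<alpha> f \<Longrightarrow> z \<in> U \<Longrightarrow> f differentiable (at z)"
  using regular_tame_on by (auto simp: tame_on_def)

lemma regular_bounded: "regular U \<alpha> f \<Longrightarrow> bounded (f ` U)"
proof (induction rule: regular.induct)
  case (regular_H_infty h)
  then show ?case by (simp add: H_infty_def)
next
  case (regular_radial K)
  then show ?case by (intro smooth_bounded_image smooth_radial bd)
next
  case (regular_cutoff K r R h)
  have "bounded ((\<lambda>z. radial K \<alpha> z * h z) ` (U \<inter> ball \<alpha> R))"
    by (rule bounded_image_mult[OF smooth_bounded_image[OF smooth_radial[OF regular_cutoff(1)] bounded_Int[OF disjI1[OF bd]]]
          bounded_subset[OF regular_cutoff(6)]]) auto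
  then obtain B where B: "\<And>z. z \<in> U \<inter> ball \<alpha> R \<Longrightarrow> norm (radial K \<alpha> z * h z) \<le> B"
    unfolding bounded_iff by blast
  have "norm (radial K \<alpha> z * h z) \<le> \<bar>B\<bar>" if "z \<in> U" for z
  proof (cases "z \<in> ball \<alpha> R")
    case True
    then show ?thesis using B[of z] that by simp
  next
    case False
    then have "(norm (z - \<alpha>))\<^sup>2 > r\<^sup>2"
      using regular_cutoff(3,4) by (intro power_strict_mono) (auto simp: dist_norm norm_minus_commute)
    then show ?thesis by (simp add: radial_def regular_cutoff(2))
  qed
  then show ?case unfolding bounded_iff by blast
next
  case (regular_cnj j)
  show ?case by (intro smooth_bounded_image smooth_cnj_coordinate bd)
next
  case (regular_cong f g)
  then show ?case by (metis (no_types, lifting) image_cong)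
qed (rule bounded_plus_comp bounded_image_mult; assumption)+

lemma wirtinger_bar_cong:
  "(\<And>w. w \<in> U \<Longrightarrow> f w = g w) \<Longrightarrow> z \<in> U \<Longrightarrow> wirtinger_bar k f z = wirtinger_bar k g z"
  by (rule wirtinger_bar_transform[OF op])

lemma wirtinger_bar_regular_add:
  "regular U \<alpha> f \<Longrightarrow> regular U \<alpha> g \<Longrightarrow> z \<in> U \<Longrightarrow>
    wirtinger_bar k (\<lambda>z. f z + g z) z = wirtinger_bar k f z + wirtinger_bar k g z"
  by (intro wirtinger_bar_add regular_differentiable)

lemma wirtinger_bar_regular_mult:
  "regular U \<alpha> f \<Longrightarrow> regular U \<alpha> g \<Longrightarrow> z \<in> U \<Longrightarrow>
    wirtinger_bar k (\<lambda>z. f z * g z) z = f z * wirtinger_bar k g z + wirtinger_bar k f z * g z"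
  by (intro wirtinger_bar_mult regular_differentiable)

lemma wirtinger_bar_H_infty: "h \<in> H_infty U \<Longrightarrow> z \<in> U \<Longrightarrow> wirtinger_bar k h z = 0"
  by (rule wirtinger_bar_holomorphic[of h U]) (simp_all add: H_infty_def)

lemma wirtinger_bar_mult_H_infty:
  "h \<in> H_infty U \<Longrightarrow> regular U \<alpha> f \<Longrightarrow> z \<in> U \<Longrightarrow>
    wirtinger_bar k (\<lambda>z. h z * f z) z = h z * wirtinger_bar k f z"
  by (simp add: wirtinger_bar_regular_mult[OF regular_H_infty] wirtinger_bar_H_infty)

text \<open>The derivative of a generator is constant or a coordinate times a generator of the same
  kind; sums and products follow from the usual rules. Together with \<open>regular_bounded\<close>
  this keeps all iterated d-bar derivatives bounded.\<close>

lemma regular_wirtinger_bar: "regular U \<alpha> f \<Longrightarrow> regular U \<alpha> (wirtinger_bar k f)"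
proof (induction rule: regular.induct)
  case (regular_H_infty h)
  show ?case by (rule regular_cong[OF regular_const[of 0]]) (simp add: wirtinger_bar_H_infty[OF regular_H_infty])
next
  case (regular_radial K)
  have "regular U \<alpha> (\<lambda>z. (z $ k - \<alpha> $ k) * radial (deriv K) \<alpha> z)"
    by (rule regular_mult[OF regular_coordinate regular.regular_radial[OF smooth_deriv[OF regular_radial]]])
  then show ?case by (rule regular_cong) (rule wirtinger_bar_radial[OF regular_radial])
next
  case (regular_cutoff K r R h)
  \<comment> \<open>The cutoff has to vanish only for s > r^2, a condition on an open set that
    \<open>deriv K\<close> inherits, so the same \<open>r\<close> and \<open>R\<close> serve for all
    derivatives.\<close>
  have "regular U \<alpha> (\<lambda>z. (z $ k - \<alpha> $ k) * (radial (deriv K) \<alpha> z * h z))"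
    by (rule regular_mult[OF regular_coordinate regular.regular_cutoff[OF smooth_deriv[OF regular_cutoff(1)]
            deriv_eq_0_beyond[OF regular_cutoff(2)] regular_cutoff(3-6)]])
  then show ?case by (rule regular_cong) (rule wirtinger_bar_cutoff[OF regular_cutoff(1-5)])
next
  case (regular_cnj j)
  show ?case
    by (rule regular_cong[OF regular_const[of "if j = k then 1 else 0"]]) (rule wirtinger_bar_cnj_coordinate)
next
  case (regular_add f g)
  show ?case
    by (rule regular_cong[OF regular.regular_add[OF regular_add(3,4)]]) (rule wirtinger_bar_regular_add[OF regular_add(1,2)])
next
  case (regular_mult f g)
  show ?case
    by (rule regular_cong[OF regular.regular_add[OF regular.regular_mult[OF regular_mult(1,4)] regular.regular_mult[OF regular_mult(3,2)]]])
      (rule wirtinger_bar_regular_mult[OF regular_mult(1,2)])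
next
  case (regular_cong f g)
  show ?case
    by (rule regular.regular_cong[OF regular_cong(3)]) (rule wirtinger_bar_cong[OF regular_cong(2)])
qed

text \<open>Computed on generators, where both orders give the same explicit expression; for
  holomorphic generators both are 0, so no second differentiability is asked of them.\<close>

lemma wirtinger_bar_commute:
  "regular U \<alpha> f \<Longrightarrow> z \<in> U \<Longrightarrow> wirtinger_bar j (wirtinger_bar k f) z = wirtinger_bar k (wirtinger_bar j f) z"
proof (induction arbitrary: z j k rule: regular.induct)
  case (regular_H_infty h)
  have "wirtinger_bar j (wirtinger_bar k h) z = 0" for j k
  proof -
    have "wirtinger_bar j (wirtinger_bar k h) z = wirtinger_bar j (\<lambda>z. 0) z"
      by (rule wirtinger_bar_cong[OF _ regular_H_infty(2)]) (rule wirtinger_bar_H_infty[OF regular_H_infty(1)])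
    then show ?thesis by (simp only: wirtinger_bar_const)
  qed
  then show ?case by simp
next
  case (regular_radial K)
  have "wirtinger_bar j (wirtinger_bar k (radial K \<alpha>)) z
      = (z $ k - \<alpha> $ k) * ((z $ j - \<alpha> $ j) * radial (deriv (deriv K)) \<alpha> z)" for j k
  proof -
    have "wirtinger_bar j (wirtinger_bar k (radial K \<alpha>)) z = wirtinger_bar j (\<lambda>z. (z $ k - \<alpha> $ k) * radial (deriv K) \<alpha> z) z"
      by (rule wirtinger_bar_cong[OF _ regular_radial(2)]) (rule wirtinger_bar_radial[OF regular_radial(1)])
    then show ?thesis
      unfolding wirtinger_bar_mult_H_infty[OF coordinate_H_infty regular.regular_radial[OF smooth_deriv[OF regular_radial(1)]] regular_radial(2)]
      wirtinger_bar_radial[OF smooth_deriv[OF regular_radial(1)]] .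
  qed
  then show ?case by simp
next
  case (regular_cutoff K r R h)
  have K0: "deriv K s = 0" if "s > r\<^sup>2" for s
    by (rule deriv_eq_0_beyond[OF regular_cutoff(2) that])
  have n: "regular U \<alpha> (\<lambda>z. radial (deriv K) \<alpha> z * h z)"
    by (rule regular.regular_cutoff[OF smooth_deriv[OF regular_cutoff(1)] K0 regular_cutoff(3-6)])
  have w: "wirtinger_bar j (\<lambda>z. radial (deriv K) \<alpha> z * h z) z = (z $ j - \<alpha> $ j) * (radial (deriv (deriv K)) \<alpha> z * h z)" for j
    by (rule wirtinger_bar_cutoff[OF smooth_deriv[OF regular_cutoff(1)] K0 regular_cutoff(3-5)])
  have "wirtinger_bar j (wirtinger_bar k (\<lambda>z. radial K \<alpha> z * h z)) z
      = (z $ k - \<alpha> $ k) * ((z $ j - \<alpha> $ j) * (radial (deriv (deriv K)) \<alpha> z * h z))" for j k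
  proof -
    have "wirtinger_bar j (wirtinger_bar k (\<lambda>z. radial K \<alpha> z * h z)) z
        = wirtinger_bar j (\<lambda>z. (z $ k - \<alpha> $ k) * (radial (deriv K) \<alpha> z * h z)) z"
      by (rule wirtinger_bar_cong[OF _ regular_cutoff(7)]) (rule wirtinger_bar_cutoff[OF regular_cutoff(1-5)])
    then show ?thesis
      unfolding wirtinger_bar_mult_H_infty[OF coordinate_H_infty n regular_cutoff(7)] w .
  qed
  then show ?case by simp
next
  case (regular_cnj i)
  have "wirtinger_bar j (wirtinger_bar k (\<lambda>z. cnj (z $ i - \<alpha> $ i))) z = 0" for j k
  proof -
    have "wirtinger_bar j (wirtinger_bar k (\<lambda>z. cnj (z $ i - \<alpha> $ i))) z = wirtinger_bar j (\<lambda>z. if i = k then 1 else 0) z"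
      by (rule wirtinger_bar_cong[OF _ regular_cnj]) (rule wirtinger_bar_cnj_coordinate)
    then show ?thesis by (simp only: wirtinger_bar_const)
  qed
  then show ?case by simp
next
  case (regular_add f g)
  have "wirtinger_bar j (wirtinger_bar k (\<lambda>z. f z + g z)) z
      = wirtinger_bar j (wirtinger_bar k f) z + wirtinger_bar j (wirtinger_bar k g) z" for j k
  proof -
    have "wirtinger_bar j (wirtinger_bar k (\<lambda>z. f z + g z)) z = wirtinger_bar j (\<lambda>z. wirtinger_bar k f z + wirtinger_bar k g z) z"
      by (rule wirtinger_bar_cong[OF _ regular_add(5)]) (rule wirtinger_bar_regular_add[OF regular_add(1,2)])
    then show ?thesis
      unfolding wirtinger_bar_regular_add[OF regular_wirtinger_bar[OF regular_add(1)] regular_wirtinger_bar[OF regular_add(2)] regular_add(5)] .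
  qed
  then show ?case using regular_add(3)[OF regular_add(5)] regular_add(4)[OF regular_add(5)] by simp
next
  case (regular_mult f g)
  note n = regular_mult(1,2) regular_wirtinger_bar[OF regular_mult(1)] regular_wirtinger_bar[OF regular_mult(2)]
  have "wirtinger_bar j (wirtinger_bar k (\<lambda>z. f z * g z)) z
      = (f z * wirtinger_bar j (wirtinger_bar k g) z + wirtinger_bar j f z * wirtinger_bar k g z)
      + (wirtinger_bar k f z * wirtinger_bar j g z + wirtinger_bar j (wirtinger_bar k f) z * g z)" for j k
  proof -
    have "wirtinger_bar j (wirtinger_bar k (\<lambda>z. f z * g z)) z
        = wirtinger_bar j (\<lambda>z. f z * wirtinger_bar k g z + wirtinger_bar k f z * g z) z"
      by (rule wirtinger_bar_cong[OF _ regular_mult(5)]) (rule wirtinger_bar_regular_mult[OF n(1,2)])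
    then show ?thesis
      unfolding wirtinger_bar_regular_add[OF regular.regular_mult[OF n(1) n(4)] regular.regular_mult[OF n(3) n(2)] regular_mult(5)]
      wirtinger_bar_regular_mult[OF n(1) n(4) regular_mult(5)] wirtinger_bar_regular_mult[OF n(3) n(2) regular_mult(5)] .
  qed
  then show ?case using regular_mult(3)[where j = j and k = k, OF regular_mult(5)] regular_mult(4)[where j = j and k = k, OF regular_mult(5)] by simp
next
  case (regular_cong f g)
  have "wirtinger_bar j (wirtinger_bar k g) z = wirtinger_bar j (wirtinger_bar k f) z" for j k
    by (rule wirtinger_bar_cong[OF wirtinger_bar_cong[OF regular_cong(2)] regular_cong(4)])
  then show ?case using regular_cong(3)[OF regular_cong(4)] by simp
qed

lemma wirtinger_bar_regular_sum:
  "finite A \<Longrightarrow> (\<And>i. i \<in> A \<Longrightarrow> regular U \<alpha> (f i)) \<Longrightarrow> z \<in> U \<Longrightarrow>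
    wirtinger_bar k (\<lambda>z. \<Sum>i\<in>A. f i z) z = (\<Sum>i\<in>A. wirtinger_bar k (f i) z)"
  by (rule wirtinger_bar_sum) (auto intro: regular_differentiable)

lemma continuous_bounded_L_infty:
  assumes "continuous_on U f" "bounded (f ` U)"
  shows "f \<in> L_infty U"
proof -
  obtain B where B: "\<And>z. z \<in> U \<Longrightarrow> norm (f z) \<le> B" using assms(2) unfolding bounded_iff by auto
  have "f \<in> borel_measurable (lebesgue_on U)"
    by (rule continuous_imp_measurable_on_sets_lebesgue[OF assms(1)]) (use op in simp)
  then show ?thesis unfolding L_infty_def using B by (auto intro!: exI[of _ B] AE_I2)
qed

lemma regular_L_infty: "regular U \<alpha> f \<Longrightarrow> f \<in> L_infty U"
  by (intro continuous_bounded_L_infty tame_on_continuous regular_tame_on regular_bounded)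

end

section \<open>The Koszul differential and d-bar\<close>

text \<open>
  A non-alternating variant of the Koszul complex, with lists in place of exterior monomials.  It is
  not bounded, but the descent stops anyway because forms of degree above the dimension vanish.
\<close>

fun koszul :: "('n::finite \<Rightarrow> complex) \<Rightarrow> ('n list \<Rightarrow> complex) \<Rightarrow> 'n list \<Rightarrow> complex" where
  "koszul c v [] = (\<Sum>k\<in>UNIV. c k * v [k])"
| "koszul c v (x # xs) = (\<Sum>k\<in>UNIV. c k * v (k # x # xs)) - koszul c (\<lambda>zs. v (x # zs)) xs"

lemma koszul_diff: "koszul c (\<lambda>ys. v ys - w ys) xs = koszul c v xs - koszul c w xs"
  by (induction xs arbitrary: v w) (simp_all add: right_diff_distrib sum_subtractf)

lemma koszul_cmult: "koszul c (\<lambda>ys. a * v ys) xs = a * koszul c v xs"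
  by (induction xs arbitrary: v) (simp_all add: sum_distrib_left right_diff_distrib mult.left_commute)

lemma koszul_0: "koszul c (\<lambda>ys. 0) xs = 0"
  using koszul_cmult[of c 0 "\<lambda>_. 0"] by simp

lemma koszul_add: "koszul c (\<lambda>ys. v ys + w ys) xs = koszul c v xs + koszul c w xs"
  by (induction xs arbitrary: v w) (simp_all add: distrib_left sum.distrib)

lemma koszul_sum: "finite A \<Longrightarrow> koszul c (\<lambda>ys. \<Sum>i\<in>A. v i ys) xs = (\<Sum>i\<in>A. koszul c (v i) xs)"
  by (induction A rule: finite_induct) (simp_all add: koszul_0 koszul_add)

text \<open>Unfolded, \<open>koszul\<close> is the alternating sum over all positions at which an
  index can be inserted, weighted by \<open>c\<close>. Two insertions reach the same list in two
  orders with opposite signs. In the inductive step \<open>?S\<close> is what remains of each of the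
  two parts.\<close>

lemma koszul_koszul: "koszul c (koszul c v) xs = 0"
proof (induction xs arbitrary: v)
  case Nil
  have "(\<Sum>k\<in>UNIV. \<Sum>l\<in>UNIV. c k * (c l * v [l, k])) = (\<Sum>k\<in>UNIV. \<Sum>l\<in>UNIV. c k * (c l * v [k, l]))"
    by (subst sum.swap) (simp add: mult.left_commute)
  then show ?case
    by (simp add: right_diff_distrib sum_subtractf sum_distrib_left)
next
  case (Cons x xs)
  let ?S = "\<Sum>k\<in>UNIV. c k * koszul c (\<lambda>zs. v (k # x # zs)) xs"
  have "koszul c (\<lambda>zs. koszul c v (x # zs)) xs
      = koszul c (\<lambda>zs. \<Sum>k\<in>UNIV. c k * v (k # x # zs)) xs - koszul c (koszul c (\<lambda>zs. v (x # zs))) xs"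
    by (simp add: koszul_diff)
  also have "\<dots> = ?S"
    by (simp add: Cons.IH koszul_sum koszul_cmult)
  finally have 1: "koszul c (\<lambda>zs. koszul c v (x # zs)) xs = ?S" .
  have "(\<Sum>k\<in>UNIV. \<Sum>l\<in>UNIV. c k * (c l * v (l # k # x # xs))) = (\<Sum>k\<in>UNIV. \<Sum>l\<in>UNIV. c k * (c l * v (k # l # x # xs)))"
    by (subst sum.swap) (simp add: mult.left_commute)
  then have 2: "(\<Sum>k\<in>UNIV. c k * koszul c v (k # x # xs)) = ?S"
    by (simp add: right_diff_distrib sum_subtractf sum_distrib_left)
  show ?case
    by (simp only: koszul.simps(2)[of c "koszul c v"] 1 2) simp
qed

text \<open>Prepending the index of \<open>\<theta>\<close> is a contracting homotopy wherever the pairing of \<open>c\<close> and \<open>\<theta>\<close> is 1.\<close>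

lemma koszul_prepend:
  assumes "\<And>y ys. v (y # ys) = \<theta> y * a ys"
  shows "koszul c v (x # xs) = (\<Sum>k\<in>UNIV. c k * \<theta> k) * a (x # xs) - \<theta> x * koszul c a xs"
  by (simp add: assms koszul_cmult sum_distrib_right mult.assoc)

section \<open>The d-bar operator on forms\<close>

definition dbar :: "'n::{finite,linorder} form \<Rightarrow> 'n form" where
  "dbar \<gamma> K z = (\<Sum>k\<in>K. wedge_sign k K * wirtinger_bar k (\<gamma> (K - {k})) z)"

text \<open>For k < l, deleting k lowers the number of elements below l by one, while deleting l
  leaves the number below k unchanged; exactly one sign flips.\<close>

lemma wedge_sign_swap:
  assumes "k \<in> K" "l \<in> K" "k \<noteq> (l :: 'n::{finite,linorder})"
  shows "wedge_sign k K * wedge_sign l (K - {k}) = - (wedge_sign l K * wedge_sign k (K - {l}))"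
proof -
  have *: "wedge_sign k K * wedge_sign l (K - {k}) = - (wedge_sign l K * wedge_sign k (K - {l}))"
    if "k < l" "k \<in> K" for k l :: 'n
  proof -
    have "{j \<in> K. j < l} = insert k {j \<in> K - {k}. j < l}" using that by auto
    then have "card {j \<in> K. j < l} = Suc (card {j \<in> K - {k}. j < l})" by simp
    moreover have "{j \<in> K - {l}. j < k} = {j \<in> K. j < k}" using that by auto
    ultimately show ?thesis by (simp add: wedge_sign_def)
  qed
  show ?thesis
    using *[of k l] *[of l k] assms by (cases "k < l") (auto simp: not_less)
qed

lemma sum_antisymmetric_eq_0:
  fixes F :: "'a \<Rightarrow> 'a \<Rightarrow> complex"
  assumes K: "finite K" and F: "\<And>k l. k \<in> K \<Longrightarrow> l \<in> K \<Longrightarrow> k \<noteq> l \<Longrightarrow> F k l = - F l k"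
  shows "(\<Sum>k\<in>K. \<Sum>l\<in>K - {k}. F k l) = 0"
proof -
  have split: "(\<Sum>l\<in>K - {k}. f l) = (\<Sum>l\<in>K. if l = k then 0 else f l)" for k and f :: "'a \<Rightarrow> complex"
    using K by (intro sum.mono_neutral_cong_left) auto
  have "(\<Sum>k\<in>K. \<Sum>l\<in>K. if l = k then 0 else F k l) = (\<Sum>l\<in>K. \<Sum>k\<in>K. if l = k then 0 else F k l)"
    by (rule sum.swap)
  also have "\<dots> = (\<Sum>l\<in>K. \<Sum>k\<in>K. - (if k = l then 0 else F l k))"
    by (intro sum.cong refl) (auto intro: F)
  also have "\<dots> = - (\<Sum>k\<in>K. \<Sum>l\<in>K. if l = k then 0 else F k l)"
    by (simp add: sum_negf)
  finally show ?thesis unfolding split by (simp add: equal_neg_zero)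
qed

lemma L_infty_mult:
  assumes "f \<in> L_infty U" "g \<in> L_infty U"
  shows "(\<lambda>z. f z * g z) \<in> L_infty U"
proof -
  obtain A B where "AE z in lebesgue_on U. norm (f z) \<le> A" "AE z in lebesgue_on U. norm (g z) \<le> B"
    using assms by (auto simp: L_infty_def)
  then have "AE z in lebesgue_on U. norm (f z * g z) \<le> A * B"
  proof eventually_elim
    case (elim z)
    then show ?case unfolding norm_mult by (intro mult_mono) (auto intro: order_trans[OF norm_ge_zero])
  qed
  then show ?thesis using assms by (auto simp: L_infty_def)
qed

lemma L_infty_add:
  assumes "f \<in> L_infty U" "g \<in> L_infty U"
  shows "(\<lambda>z. f z + g z) \<in> L_infty U"
proof -
  obtain A B where "AE z in lebesgue_on U. norm (f z) \<le> A" "AE z in lebesgue_on U. norm (g z) \<le> B"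
    using assms by (auto simp: L_infty_def)
  then have "AE z in lebesgue_on U. norm (f z + g z) \<le> A + B"
    by eventually_elim (rule norm_triangle_mono)
  then show ?thesis using assms by (auto simp: L_infty_def)
qed

lemma L_infty_diff:
  "f \<in> L_infty U \<Longrightarrow> g \<in> L_infty U \<Longrightarrow> (\<lambda>z. f z - g z) \<in> L_infty U"
  using L_infty_add[OF _ L_infty_mult[OF const_L_infty[of "- 1"]], of f U g] by simp

lemma L_infty_sum:
  "finite A \<Longrightarrow> (\<And>i. i \<in> A \<Longrightarrow> f i \<in> L_infty U) \<Longrightarrow> (\<lambda>z. \<Sum>i\<in>A. f i z) \<in> L_infty U"
  by (induction A rule: finite_induct) (simp_all add: const_L_infty L_infty_add)

lemma integrable_test_function:
  assumes "open U" "\<phi> \<in> test_functions U"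
  shows "integrable (lebesgue_on U) \<phi>" "integrable (lebesgue_on U) (wirtinger_bar k \<phi>)"
proof -
  obtain K where K: "compact K" "K \<subseteq> U" "\<And>z. z \<notin> K \<Longrightarrow> \<phi> z = 0" "\<And>z. z \<notin> K \<Longrightarrow> wirtinger_bar k \<phi> z = 0"
    using test_functions_support[OF assms(2)] by metis
  note s = test_functions_smooth[OF assms(2)]
  show "integrable (lebesgue_on U) \<phi>"
    by (rule integrable_continuous_compact_support[OF assms(1) smooth_continuous[OF s] K(1,2,3)])
  show "integrable (lebesgue_on U) (wirtinger_bar k \<phi>)"
    by (rule integrable_continuous_compact_support[OF assms(1)
          smooth_continuous[OF smooth_wirtinger_bar[OF s]] K(1,2,4)])
qed

text \<open>Boundedness is bundled with \<open>has_dbar\<close> because the integral of a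
  nonintegrable function is 0 by convention: linearity of the defining identity needs all its
  integrals to exist.\<close>

definition dbar_pair :: "nat \<Rightarrow> (complex ^ 'n::{finite,linorder}) set \<Rightarrow> 'n form \<Rightarrow> 'n form \<Rightarrow> bool" where
  "dbar_pair s U \<gamma> \<beta> \<longleftrightarrow> \<gamma> \<in> L_infty_forms s U \<and> \<beta> \<in> L_infty_forms (Suc s) U \<and> has_dbar s U \<gamma> \<beta>"

lemma L_infty_formsD: "\<gamma> \<in> L_infty_forms s U \<Longrightarrow> card J = s \<Longrightarrow> \<gamma> J \<in> L_infty U"
  by (simp add: L_infty_forms_def)

context
  fixes U :: "(complex ^ 'n::{finite,linorder}) set" and \<alpha> :: "complex ^ 'n::{finite,linorder}"
  assumes op: "open U" and bd: "bounded U"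
begin

lemma regular_dbar:
  assumes "\<And>J. regular U \<alpha> (\<gamma> J)"
  shows "regular U \<alpha> (dbar \<gamma> K)"
proof -
  have "regular U \<alpha> (\<lambda>z. \<Sum>k\<in>K. wedge_sign k K * wirtinger_bar k (\<gamma> (K - {k})) z)"
    by (intro regular_sum[OF op bd] regular_cmult[OF op bd] regular_wirtinger_bar[OF op bd] assms) simp
  then show ?thesis by (simp add: dbar_def[abs_def])
qed

lemma dbar_cong:
  assumes "\<And>J w. w \<in> U \<Longrightarrow> \<gamma> J w = \<gamma>' J w" "z \<in> U"
  shows "dbar \<gamma> K z = dbar \<gamma>' K z"
  unfolding dbar_def by (intro sum.cong refl arg_cong2[of _ _ _ _ "(*)"] wirtinger_bar_transform[OF op assms(2) assms(1)])

text \<open>Second Wirtinger derivatives commute while the wedge signs anticommute, so the double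
  sum over ordered pairs is antisymmetric.\<close>

lemma dbar_dbar:
  assumes n: "\<And>J. regular U \<alpha> (\<gamma> J)" and z: "z \<in> U"
  shows "dbar (dbar \<gamma>) K z = 0"
proof -
  define F where "F = (\<lambda>k l. wedge_sign k K * wedge_sign l (K - {k}) * wirtinger_bar k (wirtinger_bar l (\<gamma> (K - {k} - {l}))) z)"
  have "wirtinger_bar k (dbar \<gamma> (K - {k})) z
      = (\<Sum>l\<in>K - {k}. wedge_sign l (K - {k}) * wirtinger_bar k (wirtinger_bar l (\<gamma> (K - {k} - {l}))) z)" for k
  proof -
    have nw: "regular U \<alpha> (wirtinger_bar l (\<gamma> J))" for l J by (rule regular_wirtinger_bar[OF op bd n])
    have "wirtinger_bar k (dbar \<gamma> (K - {k})) z
        = wirtinger_bar k (\<lambda>z. \<Sum>l\<in>K - {k}. wedge_sign l (K - {k}) * wirtinger_bar l (\<gamma> (K - {k} - {l})) z) z"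
      by (simp add: dbar_def[abs_def])
    also have "\<dots> = (\<Sum>l\<in>K - {k}. wirtinger_bar k (\<lambda>z. wedge_sign l (K - {k}) * wirtinger_bar l (\<gamma> (K - {k} - {l})) z) z)"
      by (rule wirtinger_bar_regular_sum[OF op bd _ _ z]) (auto intro: regular_cmult[OF op bd nw])
    also have "\<dots> = (\<Sum>l\<in>K - {k}. wedge_sign l (K - {k}) * wirtinger_bar k (wirtinger_bar l (\<gamma> (K - {k} - {l}))) z)"
      by (intro sum.cong refl wirtinger_bar_mult_H_infty[OF op bd const_H_infty[OF op bd] nw z])
    finally show ?thesis .
  qed
  then have "dbar (dbar \<gamma>) K z = (\<Sum>k\<in>K. \<Sum>l\<in>K - {k}. F k l)"
    by (simp add: dbar_def[of "dbar \<gamma>"] F_def sum_distrib_left mult.assoc)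
  also have "\<dots> = 0"
  proof (rule sum_antisymmetric_eq_0)
    fix k l assume kl: "k \<in> K" "l \<in> K" "k \<noteq> l"
    have "K - {k} - {l} = K - {l} - {k}" by auto
    then show "F k l = - F l k"
      unfolding F_def wedge_sign_swap[OF kl] by (simp add: wirtinger_bar_commute[OF op bd n z, of k l])
  qed simp
  finally show ?thesis .
qed

text \<open>Integration by parts in each coefficient: regular functions are tame, and their
  Wirtinger derivatives are again regular, hence bounded.\<close>

lemma dbar_pair_regular:
  assumes n: "\<And>J. regular U \<alpha> (\<gamma> J)"
  shows "dbar_pair s U \<gamma> (dbar \<gamma>)"
proof -
  have "has_dbar s U \<gamma> (dbar \<gamma>)"
    unfolding has_dbar_def
  proof (intro allI impI ballI)
    fix K :: "'n set" and \<phi> assume "\<phi> \<in> test_functions U"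
    note \<phi> = this
    have int: "integrable (lebesgue_on U) (\<lambda>z. wirtinger_bar k (\<gamma> J) z * \<phi> z)" for k J
      by (rule integrable_L_infty_mult[OF regular_L_infty[OF op bd regular_wirtinger_bar[OF op bd n]]
            integrable_test_function(1)[OF op \<phi>]])
    have "(LINT z|lebesgue_on U. dbar \<gamma> K z * \<phi> z)
        = (LINT z|lebesgue_on U. (\<Sum>k\<in>K. wedge_sign k K * (wirtinger_bar k (\<gamma> (K - {k})) z * \<phi> z)))"
      by (simp add: dbar_def sum_distrib_right mult.assoc)
    also have "\<dots> = (\<Sum>k\<in>K. wedge_sign k K * (LINT z|lebesgue_on U. wirtinger_bar k (\<gamma> (K - {k})) z * \<phi> z))"
      using int by simp
    also have "\<dots> = - (\<Sum>k\<in>K. wedge_sign k K * (LINT z|lebesgue_on U. \<gamma> (K - {k}) z * wirtinger_bar k \<phi> z))"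
      by (simp add: integral_wirtinger_bar_by_parts[OF op regular_tame_on[OF op bd n] \<phi>] sum_negf)
    finally show "(LINT z|lebesgue_on U. dbar \<gamma> K z * \<phi> z)
        = - (\<Sum>k\<in>K. wedge_sign k K * (LINT z|lebesgue_on U. \<gamma> (K - {k}) z * wirtinger_bar k \<phi> z))" .
  qed
  then show ?thesis
    unfolding dbar_pair_def L_infty_forms_def
    using regular_L_infty[OF op bd n] regular_L_infty[OF op bd regular_dbar[OF n]] by simp
qed

lemma dbar_pair_integrable:
  assumes "dbar_pair s U \<gamma> \<beta>" "card K = Suc s" "\<phi> \<in> test_functions U"
  shows "integrable (lebesgue_on U) (\<lambda>z. \<beta> K z * \<phi> z)"
    and "k \<in> K \<Longrightarrow> integrable (lebesgue_on U) (\<lambda>z. \<gamma> (K - {k}) z * wirtinger_bar k \<phi> z)"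
proof -
  have "\<beta> K \<in> L_infty U" "k \<in> K \<Longrightarrow> \<gamma> (K - {k}) \<in> L_infty U"
    using assms(1,2) by (auto simp: dbar_pair_def intro!: L_infty_formsD)
  then show "integrable (lebesgue_on U) (\<lambda>z. \<beta> K z * \<phi> z)"
    and "k \<in> K \<Longrightarrow> integrable (lebesgue_on U) (\<lambda>z. \<gamma> (K - {k}) z * wirtinger_bar k \<phi> z)"
    by (simp_all add: integrable_L_infty_mult integrable_test_function[OF op assms(3)])
qed

lemma dbar_pair_diff:
  assumes 1: "dbar_pair s U \<gamma>1 \<beta>1" and 2: "dbar_pair s U \<gamma>2 \<beta>2"
  shows "dbar_pair s U (\<lambda>J z. \<gamma>1 J z - \<gamma>2 J z) (\<lambda>K z. \<beta>1 K z - \<beta>2 K z)"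
proof -
  have "has_dbar s U (\<lambda>J z. \<gamma>1 J z - \<gamma>2 J z) (\<lambda>K z. \<beta>1 K z - \<beta>2 K z)"
    unfolding has_dbar_def
  proof (intro allI impI ballI)
    fix K :: "'n set" and \<phi> assume K: "card K = Suc s" and \<phi>: "\<phi> \<in> test_functions U"
    note i1 = dbar_pair_integrable[OF 1 K \<phi>] and i2 = dbar_pair_integrable[OF 2 K \<phi>]
    have "(LINT z|lebesgue_on U. \<beta>1 K z * \<phi> z) - (LINT z|lebesgue_on U. \<beta>2 K z * \<phi> z)
        = - (\<Sum>k\<in>K. wedge_sign k K * (LINT z|lebesgue_on U. \<gamma>1 (K - {k}) z * wirtinger_bar k \<phi> z))
        + (\<Sum>k\<in>K. wedge_sign k K * (LINT z|lebesgue_on U. \<gamma>2 (K - {k}) z * wirtinger_bar k \<phi> z))"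
      using 1 2 K \<phi> unfolding dbar_pair_def has_dbar_def by simp
    also have "\<dots> = - (\<Sum>k\<in>K. wedge_sign k K *
        ((LINT z|lebesgue_on U. \<gamma>1 (K - {k}) z * wirtinger_bar k \<phi> z) - (LINT z|lebesgue_on U. \<gamma>2 (K - {k}) z * wirtinger_bar k \<phi> z)))"
      by (simp add: right_diff_distrib sum_subtractf)
    finally show "(LINT z|lebesgue_on U. (\<beta>1 K z - \<beta>2 K z) * \<phi> z)
        = - (\<Sum>k\<in>K. wedge_sign k K * (LINT z|lebesgue_on U. (\<gamma>1 (K - {k}) z - \<gamma>2 (K - {k}) z) * wirtinger_bar k \<phi> z))"
      by (simp add: left_diff_distrib i1 i2)
  qed
  then show ?thesis
    using 1 2 unfolding dbar_pair_def L_infty_forms_def by (simp add: L_infty_diff)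
qed

text \<open>The factor z_i - \<alpha>_i is moved onto the test function. Being holomorphic, it
  passes through the Wirtinger derivative there, so multiplication by it commutes with the
  distributional d-bar.\<close>

lemma dbar_pair_linear_combination:
  assumes p: "\<And>i::'n. dbar_pair s U (\<gamma> i) (\<beta> i)"
  shows "dbar_pair s U (\<lambda>J z. \<Sum>i\<in>UNIV. (z $ i - \<alpha> $ i) * \<gamma> i J z) (\<lambda>K z. \<Sum>i\<in>UNIV. (z $ i - \<alpha> $ i) * \<beta> i K z)"
proof -
  have "has_dbar s U (\<lambda>J z. \<Sum>i\<in>UNIV. (z $ i - \<alpha> $ i) * \<gamma> i J z) (\<lambda>K z. \<Sum>i\<in>UNIV. (z $ i - \<alpha> $ i) * \<beta> i K z)"
    unfolding has_dbar_def
  proof (intro allI impI ballI)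
    fix K :: "'n set" and \<phi> assume K: "card K = Suc s" and \<phi>: "\<phi> \<in> test_functions U"
    have \<phi>': "(\<lambda>z. (z $ i - \<alpha> $ i) * \<phi> z) \<in> test_functions U" for i
      by (rule test_functions_mult[OF \<phi> smooth_coordinate])
    have w: "wirtinger_bar k (\<lambda>z. (z $ i - \<alpha> $ i) * \<phi> z) z = (z $ i - \<alpha> $ i) * wirtinger_bar k \<phi> z" for i k z
      using wirtinger_bar_mult[OF differentiableI[OF has_derivative_coordinate]
          differentiableI[OF smooth_has_derivative[OF test_functions_smooth[OF \<phi>]]]]
      by (simp add: wirtinger_bar_coordinate)
    note int = dbar_pair_integrable[OF p K \<phi>', unfolded w]
    have one: "(LINT z|lebesgue_on U. \<beta> i K z * ((z $ i - \<alpha> $ i) * \<phi> z))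
        = - (\<Sum>k\<in>K. wedge_sign k K * (LINT z|lebesgue_on U. \<gamma> i (K - {k}) z * ((z $ i - \<alpha> $ i) * wirtinger_bar k \<phi> z)))" for i
    proof -
      have "has_dbar s U (\<gamma> i) (\<beta> i)" using p by (simp add: dbar_pair_def)
      from this[unfolded has_dbar_def, rule_format, OF K \<phi>'[of i]] show ?thesis by (simp only: w)
    qed
    have "(LINT z|lebesgue_on U. (\<Sum>i\<in>UNIV. (z $ i - \<alpha> $ i) * \<beta> i K z) * \<phi> z)
        = (LINT z|lebesgue_on U. (\<Sum>i\<in>UNIV. \<beta> i K z * ((z $ i - \<alpha> $ i) * \<phi> z)))"
      by (simp only: sum_distrib_left sum_distrib_right mult_ac)
    also have "\<dots> = (\<Sum>i\<in>UNIV. LINT z|lebesgue_on U. \<beta> i K z * ((z $ i - \<alpha> $ i) * \<phi> z))"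
      by (rule Bochner_Integration.integral_sum) (rule int(1))
    also have "\<dots> = - (\<Sum>i\<in>UNIV. \<Sum>k\<in>K. wedge_sign k K * (LINT z|lebesgue_on U. \<gamma> i (K - {k}) z * ((z $ i - \<alpha> $ i) * wirtinger_bar k \<phi> z)))"
      by (simp only: one sum_negf)
    also have "\<dots> = - (\<Sum>k\<in>K. wedge_sign k K * (\<Sum>i\<in>UNIV. LINT z|lebesgue_on U. \<gamma> i (K - {k}) z * ((z $ i - \<alpha> $ i) * wirtinger_bar k \<phi> z)))"
      by (subst sum.swap) (simp only: sum_distrib_left)
    also have "\<dots> = - (\<Sum>k\<in>K. wedge_sign k K * (LINT z|lebesgue_on U. (\<Sum>i\<in>UNIV. \<gamma> i (K - {k}) z * ((z $ i - \<alpha> $ i) * wirtinger_bar k \<phi> z))))"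
      by (intro arg_cong[of _ _ uminus] sum.cong refl arg_cong2[of _ _ _ _ "(*)"]
          Bochner_Integration.integral_sum[symmetric]) (rule int(2))
    also have "\<dots> = - (\<Sum>k\<in>K. wedge_sign k K * (LINT z|lebesgue_on U. (\<Sum>i\<in>UNIV. (z $ i - \<alpha> $ i) * \<gamma> i (K - {k}) z) * wirtinger_bar k \<phi> z))"
      by (simp only: sum_distrib_left sum_distrib_right mult_ac)
    finally show "(LINT z|lebesgue_on U. (\<Sum>i\<in>UNIV. (z $ i - \<alpha> $ i) * \<beta> i K z) * \<phi> z)
        = - (\<Sum>k\<in>K. wedge_sign k K * (LINT z|lebesgue_on U. (\<Sum>i\<in>UNIV. (z $ i - \<alpha> $ i) * \<gamma> i (K - {k}) z) * wirtinger_bar k \<phi> z))" .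
  qed
  moreover have "(\<lambda>z. z $ i - \<alpha> $ i) \<in> L_infty U" for i
    by (rule regular_L_infty[OF op bd regular_coordinate[OF op bd]])
  ultimately show ?thesis
    using p unfolding dbar_pair_def L_infty_forms_def by (simp add: L_infty_sum L_infty_mult)
qed

text \<open>The differential is built from linear combinations with holomorphic coefficients and
  differences. It evaluates its argument only at lists one longer than \<open>xs\<close>, so the
  hypothesis is confined to that length.\<close>

lemma dbar_pair_koszul:
  "(\<And>ys. length ys = Suc (length xs) \<Longrightarrow> dbar_pair s U (\<gamma> ys) (\<beta> ys)) \<Longrightarrow>
    dbar_pair s U (\<lambda>J z. koszul (\<lambda>k. z $ k - \<alpha> $ k) (\<lambda>ys. \<gamma> ys J z) xs)
      (\<lambda>K z. koszul (\<lambda>k. z $ k - \<alpha> $ k) (\<lambda>ys. \<beta> ys K z) xs)"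
proof (induction xs arbitrary: \<gamma> \<beta>)
  case Nil
  show ?case unfolding koszul.simps by (rule dbar_pair_linear_combination) (simp add: Nil)
next
  case (Cons x xs)
  show ?case
    unfolding koszul.simps
    by (rule dbar_pair_diff, rule dbar_pair_linear_combination, simp add: Cons.prems,
        rule Cons.IH, simp add: Cons.prems)
qed

lemma regular_koszul:
  "(\<And>ys. regular U \<alpha> (v ys)) \<Longrightarrow> regular U \<alpha> (\<lambda>z. koszul (\<lambda>k. z $ k - \<alpha> $ k) (\<lambda>ys. v ys z) xs)"
  by (induction xs arbitrary: v)
    (auto intro!: regular_diff[OF op bd] regular_sum[OF op bd] regular_mult regular_coordinate[OF op bd])

text \<open>Classical counterpart of the previous commutation: the holomorphic factors z_k -
  \<alpha>_k pass through the derivative.\<close>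

lemma wirtinger_bar_koszul:
  "(\<And>ys. regular U \<alpha> (v ys)) \<Longrightarrow> z \<in> U \<Longrightarrow>
    wirtinger_bar j (\<lambda>z. koszul (\<lambda>k. z $ k - \<alpha> $ k) (\<lambda>ys. v ys z) xs) z
    = koszul (\<lambda>k. z $ k - \<alpha> $ k) (\<lambda>ys. wirtinger_bar j (v ys) z) xs"
proof (induction xs arbitrary: v)
  case (Cons x xs)
  let ?S = "\<lambda>z. \<Sum>k\<in>UNIV. (z $ k - \<alpha> $ k) * v (k # x # xs) z"
  let ?T = "\<lambda>z. koszul (\<lambda>k. z $ k - \<alpha> $ k) (\<lambda>zs. v (x # zs) z) xs"
  have "regular U \<alpha> ?S"
    by (intro regular_sum[OF op bd] regular_mult regular_coordinate[OF op bd] Cons.prems) simp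
  moreover have "regular U \<alpha> ?T"
    by (rule regular_koszul[OF Cons.prems(1)])
  ultimately have n: "regular U \<alpha> ?S" "regular U \<alpha> ?T" .
  have "wirtinger_bar j (\<lambda>z. ?S z + (- 1) * ?T z) z = wirtinger_bar j ?S z + (- 1) * wirtinger_bar j ?T z"
    unfolding wirtinger_bar_regular_add[OF op bd n(1) regular_cmult[OF op bd n(2)] Cons.prems(2)]
      wirtinger_bar_mult_H_infty[OF op bd const_H_infty[OF op bd] n(2) Cons.prems(2)] ..
  moreover have "wirtinger_bar j ?S z = (\<Sum>k\<in>UNIV. (z $ k - \<alpha> $ k) * wirtinger_bar j (v (k # x # xs)) z)"
    by (subst wirtinger_bar_regular_sum[OF op bd])
      (auto intro!: regular_mult regular_coordinate[OF op bd] Cons.prems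
        simp: wirtinger_bar_mult_H_infty[OF op bd coordinate_H_infty[OF op bd] Cons.prems])
  moreover have "wirtinger_bar j ?T z = koszul (\<lambda>k. z $ k - \<alpha> $ k) (\<lambda>zs. wirtinger_bar j (v (x # zs)) z) xs"
    by (rule Cons.IH[OF Cons.prems])
  ultimately show ?case by simp
next
  case Nil
  show ?case
    unfolding koszul.simps
    by (subst wirtinger_bar_regular_sum[OF op bd])
      (auto intro!: regular_mult regular_coordinate[OF op bd] Nil
        simp: wirtinger_bar_mult_H_infty[OF op bd coordinate_H_infty[OF op bd] Nil])
qed

lemma dbar_koszul:
  assumes "\<And>ys J. regular U \<alpha> (\<gamma> ys J)" "z \<in> U"
  shows "dbar (\<lambda>J z. koszul (\<lambda>k. z $ k - \<alpha> $ k) (\<lambda>ys. \<gamma> ys J z) xs) K z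
    = koszul (\<lambda>k. z $ k - \<alpha> $ k) (\<lambda>ys. dbar (\<gamma> ys) K z) xs"
  unfolding dbar_def
  by (simp add: wirtinger_bar_koszul[OF assms(1) assms(2)] koszul_sum koszul_cmult)

end

section \<open>Gleason solvability\<close>

lemma smooth_bump:
  fixes a :: real
  assumes "a > 0"
  obtains K :: "real \<Rightarrow> real" where "smooth K" "\<And>s. s \<le> a / 4 \<Longrightarrow> K s = 1" "\<And>s. s \<ge> a \<Longrightarrow> K s = 0"
proof -
  obtain X :: "real \<Rightarrow> real" where X: "smooth X" "\<And>s. s \<le> 1/4 \<Longrightarrow> X s = 1" "\<And>s. s \<ge> 1 \<Longrightarrow> X s = 0"
    using smooth_step_exists by metis
  show thesis
  proof
    show "smooth (\<lambda>s. X (s * inverse a))"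
      by (rule smooth_compose_real[OF X(1) smooth_mult[OF smooth_linear[OF bounded_linear_ident] smooth_const]])
    show "X (s * inverse a) = 1" if "s \<le> a / 4" for s
      by (rule X(2)) (use that assms in \<open>simp add: field_simps\<close>)
    show "X (s * inverse a) = 0" if "s \<ge> a" for s
      by (rule X(3)) (use that assms in \<open>simp add: field_simps\<close>)
  qed
qed

text \<open>The functions cnj (z_j - \<alpha>_j) / |z - \<alpha>|^2 pair to 1 with z - \<alpha> but
  are singular at \<alpha>. Multiplying them by 1 - \<eta>, which vanishes near \<alpha>, makes them
  smooth and turns the pairing into 1 - \<eta>.\<close>

lemma regular_multipliers_exist:
  fixes \<Omega> :: "(complex ^ 'n) set"
  assumes op: "open \<Omega>" and bd: "bounded \<Omega>" and a: "a > 0"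
  obtains \<theta> \<eta> where "\<And>j. regular \<Omega> \<alpha> (\<theta> j)" "smooth \<eta>"
    "\<And>s. s \<le> a / 4 \<Longrightarrow> \<eta> s = 1" "\<And>s. s \<ge> a \<Longrightarrow> \<eta> s = 0"
    "\<And>z. (\<Sum>j\<in>UNIV. (z $ j - \<alpha> $ j) * \<theta> j z) = 1 - radial \<eta> \<alpha> z"
    "\<And>z j. (norm (z - \<alpha>))\<^sup>2 \<le> a / 4 \<Longrightarrow> \<theta> j z = 0"
proof -
  obtain \<eta> :: "real \<Rightarrow> real" where \<eta>: "smooth \<eta>" "\<And>s. s \<le> a / 4 \<Longrightarrow> \<eta> s = 1" "\<And>s. s \<ge> a \<Longrightarrow> \<eta> s = 0"
    using smooth_bump[OF a] by metis
  define \<kappa> where "\<kappa> = (\<lambda>s. (1 - \<eta> s) / s)"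
  have \<kappa>: "smooth \<kappa>"
    unfolding \<kappa>_def
  proof (rule smooth_divide_ident)
    show "smooth (\<lambda>s. 1 - \<eta> s)" by (rule smooth_diff[OF smooth_const \<eta>(1)])
    show "1 - \<eta> s = 0" if "\<bar>s\<bar> < a / 4" for s using \<eta>(2)[of s] that by auto
  qed (use a in simp)
  have s\<kappa>: "s * \<kappa> s = 1 - \<eta> s" for s
    using \<eta>(2)[of 0] a by (simp add: \<kappa>_def)
  show thesis
  proof (rule that[OF _ \<eta>])
    show "regular \<Omega> \<alpha> (\<lambda>z. cnj (z $ j - \<alpha> $ j) * radial \<kappa> \<alpha> z)" for j
      by (rule regular_mult[OF regular_cnj regular_radial[OF \<kappa>]])
    show "(\<Sum>j\<in>UNIV. (z $ j - \<alpha> $ j) * (cnj (z $ j - \<alpha> $ j) * radial \<kappa> \<alpha> z)) = 1 - radial \<eta> \<alpha> z" for z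
    proof -
      have "(\<Sum>j\<in>UNIV. (z $ j - \<alpha> $ j) * (cnj (z $ j - \<alpha> $ j) * radial \<kappa> \<alpha> z))
          = complex_of_real ((norm (z - \<alpha>))\<^sup>2) * radial \<kappa> \<alpha> z"
        unfolding norm_sq_coordinates sum_distrib_right by (simp add: mult.assoc)
      also have "\<dots> = complex_of_real (1 - \<eta> ((norm (z - \<alpha>))\<^sup>2))"
        unfolding radial_def of_real_mult[symmetric] s\<kappa> ..
      finally show ?thesis by (simp add: radial_def)
    qed
    show "cnj (z $ j - \<alpha> $ j) * radial \<kappa> \<alpha> z = 0" if "(norm (z - \<alpha>))\<^sup>2 \<le> a / 4" for z j
      by (simp add: radial_def \<kappa>_def \<eta>(2)[OF that])
  qed
qed

text \<open>
  Level \<open>m\<close> carries lists of length \<open>m + 1\<close> and form degree \<open>m\<close>.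
\<close>

primrec koszul_lift ::
  "('n \<Rightarrow> complex ^ 'n::{finite,linorder} \<Rightarrow> complex) \<Rightarrow> ('n \<Rightarrow> complex ^ 'n::{finite,linorder} \<Rightarrow> complex) \<Rightarrow> nat \<Rightarrow>
    'n list \<Rightarrow> 'n form" where
  "koszul_lift u \<theta> 0 xs = (\<lambda>J. u (hd xs))"
| "koszul_lift u \<theta> (Suc m) xs = (\<lambda>J z. \<theta> (hd xs) z * dbar (koszul_lift u \<theta> m (tl xs)) J z)"

theorem theorem4:
  fixes \<Omega> :: "(complex ^ 'n::{finite,linorder}) set"
  assumes "bounded \<Omega>" and "L_infty_pseudoconvex \<Omega>"
  shows "gleason_solvable \<Omega>"
  unfolding gleason_solvable_def
proof (intro ballI impI)
  fix \<alpha> g assume \<alpha>: "\<alpha> \<in> \<Omega>" and g: "g \<in> H_infty \<Omega>" and g0: "g \<alpha> = 0"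
  have bd: "bounded \<Omega>" by (rule assms(1))
  have op: "open \<Omega>"
    using assms(2) by (simp add: L_infty_pseudoconvex_def pseudoconvex_domain_def)
  have solve: "\<exists>\<gamma>\<in>L_infty_forms (s - 1) \<Omega>. has_dbar (s - 1) \<Omega> \<gamma> \<beta>"
    if "s \<ge> 1" "\<beta> \<in> L_infty_forms s \<Omega>" "dbar_closed s \<Omega> \<beta>" for s \<beta>
    using assms(2) that unfolding L_infty_pseudoconvex_def by blast
  have holg: "holomorphic_several_on g \<Omega>" using g by (simp add: H_infty_def)
  obtain r h where r: "r > 0" "ball \<alpha> r \<subseteq> \<Omega>"
    and h: "\<And>j::'n. holomorphic_several_on (h j) (ball \<alpha> r)" "\<And>j. bounded (h j ` ball \<alpha> r)"
      "\<And>z. z \<in> ball \<alpha> r \<Longrightarrow> g z = (\<Sum>j\<in>UNIV. (z $ j - \<alpha> $ j) * h j z)"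
    by (rule local_division[OF holg op \<alpha> g0]) (rule that; assumption)
  \<comment> \<open>A squared radius, because \<open>\<eta>\<close> is evaluated at squared
    distances: it is 1 up to distance r / 4 and 0 from r / 2 on, well inside the ball on which the
    \<open>h j\<close> are controlled.\<close>
  define a where "a = (r / 2)\<^sup>2"
  have a: "a > 0" "a / 4 > 0" using r(1) by (simp_all add: a_def)
  obtain \<theta> \<eta> where \<theta>: "\<And>j. regular \<Omega> \<alpha> (\<theta> j)" and \<eta>: "smooth \<eta>"
    "\<And>s. s \<le> a / 4 \<Longrightarrow> \<eta> s = 1" "\<And>s. s \<ge> a \<Longrightarrow> \<eta> s = 0"
    and \<theta>\<eta>: "\<And>z. (\<Sum>j\<in>UNIV. (z $ j - \<alpha> $ j) * \<theta> j z) = 1 - radial \<eta> \<alpha> z"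
    "\<And>z j. (norm (z - \<alpha>))\<^sup>2 \<le> a / 4 \<Longrightarrow> \<theta> j z = 0"
    by (rule regular_multipliers_exist[OF op bd a(1), of \<alpha>]) (rule that; assumption)
  \<comment> \<open>A smaller scale: \<open>\<eta>'\<close> vanishes from distance r / 4 on, so the
    pairing of \<open>\<theta>'\<close> with z - \<alpha> can differ from 1 only inside the ball
    where \<open>\<eta>\<close> is 1.\<close>
  obtain \<theta>' \<eta>' where \<theta>': "\<And>j. regular \<Omega> \<alpha> (\<theta>' j)"
    and \<eta>': "\<And>s. s \<ge> a / 4 \<Longrightarrow> \<eta>' s = 0"
    and \<theta>\<eta>': "\<And>z. (\<Sum>j\<in>UNIV. (z $ j - \<alpha> $ j) * \<theta>' j z) = 1 - radial \<eta>' \<alpha> z"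
    by (rule regular_multipliers_exist[OF op bd a(2), of \<alpha>]) (rule that; assumption)
  \<comment> \<open>Up to distance r / 4 this is the holomorphic \<open>h j\<close>, beyond r / 2 it
    is \<open>g\<close> times the homotopy factor. The pairings carry the complementary weights
    \<eta> and 1 - \<eta>, so the two divisions add up to \<open>g\<close>.\<close>
  define u where "u = (\<lambda>j z. radial \<eta> \<alpha> z * h j z + g z * \<theta> j z)"
  have nu: "regular \<Omega> \<alpha> (u j)" for j
    unfolding u_def
  proof (rule regular_add[OF regular_cutoff[where r = "r / 2" and R = r] regular_mult[OF regular_H_infty[OF g] \<theta>]])
    show "\<eta> s = 0" if "s > (r / 2)\<^sup>2" for s using \<eta>(3)[of s] that by (simp add: a_def)
  qed (use \<eta>(1) r(1) h in auto)
  define V where "V = ball \<alpha> (r / 4) \<inter> \<Omega>"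
  have V: "open V" using op by (auto simp: V_def)
  have normV: "(norm (z - \<alpha>))\<^sup>2 < a / 4 \<longleftrightarrow> z \<in> V" if "z \<in> \<Omega>" for z
  proof -
    have "a / 4 = (r / 4)\<^sup>2" by (simp add: a_def power2_eq_square)
    then have "(norm (z - \<alpha>))\<^sup>2 < a / 4 \<longleftrightarrow> norm (z - \<alpha>) < r / 4"
      using r(1) power_mono_iff[of "r / 4" "norm (z - \<alpha>)" 2] by (simp del: power_mono_iff add: not_le[symmetric])
    then show ?thesis using that by (auto simp: V_def dist_norm norm_minus_commute)
  qed
  have u_div: "(\<Sum>j\<in>UNIV. (z $ j - \<alpha> $ j) * u j z) = g z" if z: "z \<in> \<Omega>" for z
  proof -
    have "radial \<eta> \<alpha> z * (\<Sum>j\<in>UNIV. (z $ j - \<alpha> $ j) * h j z) = radial \<eta> \<alpha> z * g z"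
    proof (cases "z \<in> ball \<alpha> r")
      case True
      then show ?thesis by (simp only: h(3))
    next
      case False
      have "radial \<eta> \<alpha> z = 0"
        by (rule radial_eq_0[where r = "r / 2"]) (use \<eta>(3) a_def r(1) False in auto)
      then show ?thesis by simp
    qed
    moreover have "(\<Sum>j\<in>UNIV. (z $ j - \<alpha> $ j) * u j z)
        = radial \<eta> \<alpha> z * (\<Sum>j\<in>UNIV. (z $ j - \<alpha> $ j) * h j z) + g z * (\<Sum>j\<in>UNIV. (z $ j - \<alpha> $ j) * \<theta> j z)"
      by (simp add: u_def distrib_left sum.distrib sum_distrib_left mult.left_commute)
    ultimately show ?thesis by (simp add: \<theta>\<eta>(1) right_diff_distrib)
  qed
  let ?\<zeta> = "\<lambda>z k. z $ k - \<alpha> $ k"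
  define w where "w = koszul_lift u \<theta>'"
  have nw: "regular \<Omega> \<alpha> (w m xs J)" for m xs J
    unfolding w_def
    by (induction m arbitrary: xs J) (simp_all add: nu regular_mult[OF \<theta>' regular_dbar[OF op bd]])
  \<comment> \<open>On \<open>V\<close> level 0 coincides with the holomorphic \<open>h\<close>, and
    each higher level is a multiple of d-bar of the one below, hence 0 there.\<close>
  have wV: "dbar (w m xs) J z = 0" if z: "z \<in> V" for m xs J z
  proof -
    have "wirtinger_bar k (w m xs L) z = 0" if "k \<in> J" for k L
      using z
    proof (induction m arbitrary: xs k L z J)
      case 0
      have zb: "z \<in> ball \<alpha> r" using 0 r(1) by (simp add: V_def)
      have "wirtinger_bar k (u (hd xs)) z = wirtinger_bar k (h (hd xs)) z"
      proof (rule wirtinger_bar_transform[OF V 0])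
        fix y assume y: "y \<in> V"
        then have "(norm (y - \<alpha>))\<^sup>2 \<le> a / 4" using normV[of y] by (auto simp: V_def)
        then show "u (hd xs) y = h (hd xs) y"
          using \<theta>\<eta>(2)[of y] \<eta>(2) by (simp add: u_def radial_def)
      qed
      then show ?case
        using wirtinger_bar_holomorphic[OF h(1) zb] by (simp add: w_def)
    next
      case (Suc m)
      have "wirtinger_bar k (w (Suc m) xs L) z = wirtinger_bar k (\<lambda>_. 0) z"
        by (rule wirtinger_bar_transform[OF V Suc.prems]) (simp add: w_def dbar_def Suc.IH[unfolded w_def])
      then show ?case by (simp only: wirtinger_bar_const)
    qed
    then show ?thesis by (simp add: dbar_def)
  qed
  have w0: "koszul (?\<zeta> z) (\<lambda>ys. w 0 ys J z) [] = g z" if "z \<in> \<Omega>" for J z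
    using u_div[OF that] by (simp add: w_def)
  \<comment> \<open>Multiplication by \<open>\<theta>'\<close> lifts the Koszul cycle formed by
    d-bar of \<open>w m\<close>. The error carries the factor \<open>radial \<eta>'\<close>, which
    in \<Omega> is nonzero only on \<open>V\<close>, exactly where d-bar of \<open>w m\<close>
    vanishes.\<close>
  have step: "koszul (?\<zeta> z) (\<lambda>ys. w (Suc m) ys J z) (x # xs) = dbar (w m (x # xs)) J z"
    if z: "z \<in> \<Omega>" and k0: "koszul (?\<zeta> z) (\<lambda>ys. dbar (w m ys) J z) xs = 0" for m x xs J z
  proof -
    have "koszul (?\<zeta> z) (\<lambda>ys. w (Suc m) ys J z) (x # xs)
        = (\<Sum>k\<in>UNIV. ?\<zeta> z k * \<theta>' k z) * dbar (w m (x # xs)) J z - \<theta>' x z * koszul (?\<zeta> z) (\<lambda>ys. dbar (w m ys) J z) xs"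
      by (rule koszul_prepend) (simp add: w_def)
    also have "\<dots> = (1 - radial \<eta>' \<alpha> z) * dbar (w m (x # xs)) J z"
      by (simp only: \<theta>\<eta>' k0) simp
    also have "\<dots> = dbar (w m (x # xs)) J z"
    proof (cases "z \<in> V")
      case False
      then have "radial \<eta>' \<alpha> z = 0" using normV[OF z] \<eta>' by (simp add: radial_def)
      then show ?thesis by simp
    qed (simp add: wV)
    finally show ?thesis .
  qed
  \<comment> \<open>The cycle condition propagates upward: the Koszul differential commutes with
    d-bar, and the image of a level is \<open>g\<close> at the bottom and d-bar of the preceding
    level above it; d-bar annihilates both.\<close>
  have wSuc: "koszul (?\<zeta> z) (\<lambda>ys. w (Suc m) ys J z) xs = dbar (w m xs) J z"
    if "length xs = Suc m" "z \<in> \<Omega>" for m xs J z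
    using that
  proof (induction m arbitrary: xs J z)
    case (0 xs J z)
    then obtain x where xs: "xs = [x]" by (cases xs) auto
    have "koszul (?\<zeta> z) (\<lambda>ys. dbar (w 0 ys) J z) [] = dbar (\<lambda>J z. koszul (?\<zeta> z) (\<lambda>ys. w 0 ys J z) []) J z"
      by (rule dbar_koszul[OF op bd nw 0(2), symmetric])
    also have "\<dots> = dbar (\<lambda>J z. g z) J z"
      by (rule dbar_cong[OF op bd w0 0(2)])
    also have "\<dots> = 0"
      by (simp add: dbar_def wirtinger_bar_H_infty[OF op bd g 0(2)])
    finally show ?case unfolding xs by (rule step[OF 0(2)])
  next
    case (Suc m xs J z)
    then obtain x ys where xs: "xs = x # ys" "length ys = Suc m" by (cases xs) auto
    have "koszul (?\<zeta> z) (\<lambda>zs. dbar (w (Suc m) zs) J z) ys = dbar (\<lambda>J z. koszul (?\<zeta> z) (\<lambda>zs. w (Suc m) zs J z) ys) J z"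
      by (rule dbar_koszul[OF op bd nw Suc(3), symmetric])
    also have "\<dots> = dbar (dbar (w m ys)) J z"
      by (rule dbar_cong[OF op bd Suc.IH[OF xs(2)] Suc(3)])
    also have "\<dots> = 0" by (rule dbar_dbar[OF op bd nw Suc(3)])
    finally show ?case unfolding xs(1) by (rule step[OF Suc(3)])
  qed
  \<comment> \<open>\<open>S\<close> asks for d-bar exact substitutes of the lifts at level
    \<open>m\<close>, \<open>T\<close> for d-bar closed ones, with the Koszul image of
    \<open>w m\<close> retained. The truncated \<open>m - 1\<close> is harmless, as \<open>S\<close>
    is used only for m \<ge> 1. Comparing the images in \<open>S\<close> only at index sets of size
    \<open>m\<close> makes the top case vacuous.\<close>
  define S where "S = (\<lambda>m. \<exists>\<gamma> f. (\<forall>xs. length xs = Suc m \<longrightarrow> dbar_pair (m - 1) \<Omega> (\<gamma> xs) (f xs)) \<and>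
    (\<forall>ys J z. length ys = m \<longrightarrow> card J = m \<longrightarrow> z \<in> \<Omega> \<longrightarrow>
      koszul (?\<zeta> z) (\<lambda>xs. f xs J z) ys = koszul (?\<zeta> z) (\<lambda>xs. w m xs J z) ys))"
  define T where "T = (\<lambda>m f. (\<forall>xs. length xs = Suc m \<longrightarrow> f xs \<in> L_infty_forms m \<Omega> \<and> dbar_closed m \<Omega> (f xs)) \<and>
    (\<forall>ys J z. length ys = m \<longrightarrow> z \<in> \<Omega> \<longrightarrow>
      koszul (?\<zeta> z) (\<lambda>xs. f xs J z) ys = koszul (?\<zeta> z) (\<lambda>xs. w m xs J z) ys))"
  have ST: "\<exists>f. T m f" if Sm: "S (Suc m)" for m
  proof -
    obtain \<gamma> f' where \<gamma>: "\<And>xs. length xs = Suc (Suc m) \<Longrightarrow> dbar_pair m \<Omega> (\<gamma> xs) (f' xs)"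
      and f': "\<And>ys J z. length ys = Suc m \<Longrightarrow> card J = Suc m \<Longrightarrow> z \<in> \<Omega> \<Longrightarrow>
        koszul (?\<zeta> z) (\<lambda>xs. f' xs J z) ys = koszul (?\<zeta> z) (\<lambda>xs. w (Suc m) xs J z) ys"
      using Sm unfolding S_def diff_Suc_1 by blast
    \<comment> \<open>d-bar of the subtracted term is the Koszul image of \<open>f'\<close>, which
      in degree m + 1 equals that of \<open>w (Suc m)\<close>, that is, d-bar of \<open>w m\<close>;
      so the difference is closed.\<close>
    define f where "f = (\<lambda>xs J z. w m xs J z - koszul (?\<zeta> z) (\<lambda>ys. \<gamma> ys J z) xs)"
    have "f xs \<in> L_infty_forms m \<Omega> \<and> dbar_closed m \<Omega> (f xs)" if xs: "length xs = Suc m" for xs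
    proof -
      have p: "dbar_pair m \<Omega> (f xs) (\<lambda>J z. dbar (w m xs) J z - koszul (?\<zeta> z) (\<lambda>ys. f' ys J z) xs)"
        unfolding f_def
        by (rule dbar_pair_diff[OF op bd dbar_pair_regular[OF op bd nw] dbar_pair_koszul[OF op bd]])
          (simp add: \<gamma> xs)
      have z: "dbar (w m xs) J z - koszul (?\<zeta> z) (\<lambda>ys. f' ys J z) xs = 0" if "card J = Suc m" "z \<in> \<Omega>" for J z
        using f'[OF xs that] wSuc[OF xs that(2), of J] by simp
      have "dbar_closed m \<Omega> (f xs)"
        unfolding dbar_closed_def has_dbar_def
      proof (intro allI impI ballI)
        fix J :: "'n set" and \<phi> assume J: "card J = Suc m" and \<phi>: "\<phi> \<in> test_functions \<Omega>"
        have "(LINT z|lebesgue_on \<Omega>. 0 * \<phi> z)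
            = (LINT z|lebesgue_on \<Omega>. (dbar (w m xs) J z - koszul (?\<zeta> z) (\<lambda>ys. f' ys J z) xs) * \<phi> z)"
          by (rule Bochner_Integration.integral_cong) (simp_all add: z[OF J])
        also have "\<dots> = - (\<Sum>k\<in>J. wedge_sign k J * (LINT z|lebesgue_on \<Omega>. f xs (J - {k}) z * wirtinger_bar k \<phi> z))"
          using p J \<phi> unfolding dbar_pair_def has_dbar_def by blast
        finally show "(LINT z|lebesgue_on \<Omega>. 0 * \<phi> z)
            = - (\<Sum>k\<in>J. wedge_sign k J * (LINT z|lebesgue_on \<Omega>. f xs (J - {k}) z * wirtinger_bar k \<phi> z))" .
      qed
      then show ?thesis using p by (simp add: dbar_pair_def)
    qed
    \<comment> \<open>The correction is itself a Koszul image, so a second application of the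
      differential removes it at every point, whatever representatives \<open>\<gamma>\<close>
      has.\<close>
    moreover have "koszul (?\<zeta> z) (\<lambda>xs. f xs J z) ys = koszul (?\<zeta> z) (\<lambda>xs. w m xs J z) ys" for ys J z
      unfolding f_def koszul_diff by (simp add: koszul_koszul)
    ultimately show ?thesis unfolding T_def by blast
  qed
  have TS: "S m" if "m \<ge> 1" "T m f" for m f
  proof -
    have "\<exists>\<gamma>. length xs = Suc m \<longrightarrow> dbar_pair (m - 1) \<Omega> \<gamma> (f xs)" for xs
      using that solve[OF that(1), of "f xs"] unfolding T_def dbar_pair_def by fastforce
    then obtain \<gamma> where "\<And>xs. length xs = Suc m \<Longrightarrow> dbar_pair (m - 1) \<Omega> (\<gamma> xs) (f xs)" by metis
    then show ?thesis using that(2) unfolding S_def T_def by blast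
  qed
  have "S (Suc CARD('n))"
  proof -
    \<comment> \<open>No index set has more than \<open>CARD('n)\<close> elements, so in this degree
      the d-bar equation and the comparison with \<open>w\<close> are vacuous, and zero forms start
      the descent.\<close>
    have no: "card J \<noteq> Suc CARD('n)" for J :: "'n set" using card_mono[of UNIV J] by simp
    have "dbar_pair CARD('n) \<Omega> (\<lambda>J z. 0) (\<lambda>K z. 0)"
      unfolding dbar_pair_def has_dbar_def L_infty_forms_def by (simp add: no const_L_infty)
    then show ?thesis
      unfolding S_def by (intro exI[of _ "\<lambda>xs J z. 0"] conjI) (simp_all add: no)
  qed
  \<comment> \<open>The guard ends the downward induction at degree 1, the lowest in which a d-bar
    equation is solved; the last step to degree 0 uses \<open>ST\<close> alone.\<close>
  then have "1 \<le> m \<longrightarrow> S m" if m: "m \<le> Suc CARD('n)" for m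
  proof (induction rule: inc_induct[OF m])
    case (2 k)
    then show ?case using ST[of k] TS[of k] by auto
  qed simp
  then have "S 1" by simp
  then obtain f where f: "T 0 f" using ST[of 0] by auto
  \<comment> \<open>In degree 0 the only coefficient sits at the empty index set, and the lists at
    this level are singletons.\<close>
  define F where "F = (\<lambda>j. f [j] {})"
  have F1: "F j \<in> L_infty \<Omega>" "dbar_closed 0 \<Omega> (f [j])" for j
    using f unfolding T_def F_def L_infty_forms_def by simp_all
  have F2: "weakly_holomorphic_on (F j) \<Omega>" for j
    unfolding weakly_holomorphic_on_def
  proof (intro allI ballI)
    fix k :: 'n and \<phi> assume \<phi>: "\<phi> \<in> test_functions \<Omega>"
    \<comment> \<open>Closedness tested at a singleton, where the wedge sign is 1, is the separate
      weak Cauchy-Riemann equation in the k-th variable.\<close>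
    have "card {k} = Suc 0" by simp
    from F1(2)[of j, unfolded dbar_closed_def has_dbar_def, rule_format, OF this \<phi>]
    show "(LINT z|lebesgue_on \<Omega>. F j z * wirtinger_bar k \<phi> z) = 0"
      by (simp add: F_def wedge_sign_def)
  qed
  have F3: "(\<Sum>j\<in>UNIV. (z $ j - \<alpha> $ j) * F j z) = g z" if "z \<in> \<Omega>" for z
  proof -
    have "koszul (?\<zeta> z) (\<lambda>xs. f xs {} z) [] = koszul (?\<zeta> z) (\<lambda>xs. w 0 xs {} z) []"
      using f that unfolding T_def by blast
    then show ?thesis using w0[OF that, of "{}"] by (simp add: F_def)
  qed
  show "\<exists>G. (\<forall>j. G j \<in> H_infty \<Omega>) \<and> (\<forall>z\<in>\<Omega>. g z = (\<Sum>j\<in>UNIV. (z $ j - \<alpha> $ j) * G j z))"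
    by (rule holomorphic_division_of_weak[OF op bd F1(1) F2 holomorphic_continuous[OF holg] F3])
qed

end
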